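(* For $\ast\in\{f,c,b\}$ and a normed algebra $A$ let $$R_\ast(A)=\{a\in A:\ \rho(\{a\}\cup M)=\rho(M)\ \text{ for all } M\in\mathcal{M}_\ast(A)\}.$$ Then, on the class $(NA)$ of all normed algebras: $R_f$ satisfies properties (1°), (2°), (3°) and (4°) of the definition of a topological radical; $R_c$ is a hereditary topological radical (HTR); and $R_b$ is a hereditary under topological radical (hereditary UTR).
   Context: All algebras are complex and associative; "ideal" means two-sided ideal. For a normed algebra $A$, $\mathcal{M}_f(A)$, $\mathcal{M}_c(A)$, $\mathcal{M}_b(A)$ are the classes of all (nonempty) finite, precompact (totally bounded) and bounded subsets of $A$, respectively. For bounded $M\subset A$, $\|M\|=\sup_{a\in M}\|a\|$, $M^n=\{a_1\cdots a_n: a_i\in M\}$, and $\rho(M)=\inf_n\|M^n\|^{1/n}=\lim_n\|M^n\|^{1/n}$ (the joint spectral radius). For a closed ideal $I$ of $A$, $q_I:A\to A/I$ is the quotient map; a topological isomorphism is an algebra isomorphism continuous together with its inverse. For a map $R$ assigning to each normed algebra $A$ a closed ideal $R(A)$ of $A$, consider: (1°) $R(R(A))=R(A)$ for all $A\in(NA)$; (2°) $R(A/R(A))=0$ for all $A\in(NA)$; (3°) $f(R(A))=R(B)$ for every topological isomorphism $f:A\to B$ of normed algebras; (4°) $q_I(R(A))\subset R(A/I)$ for every closed ideal $I$ of $A\in(NA)$; (5°) for every ideal $I$ of $A\in(NA)$, $R(I)$ is an ideal of $A$ and $R(I)\subset I\cap R(A)$; (6°) $R(I)=I\cap R(A)$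 for every ideal $I$ of $A\in(NA)$. $R$ is a topological radical (TR) on $(NA)$ if (1°)–(5°) hold; an HTR if it is a TR and (6°) holds; a UTR if (1°), (3°), (4°), (5°) hold; a hereditary UTR if it is a UTR and (6°) holds. *)

theory Defs
  imports
    "HOL-Analysis.Analysis"
    "HOL-Algebra.Module"
    "HOL-Algebra.QuotRing"
begin

section \<open>Normed algebras\<close>

text \<open>
  Ideals (closed or not) and quotients of normed algebras are again normed algebras, so algebras
  are records with an explicit carrier.  The signature is that of a complex module record
  together with a norm.  Algebras need not have a unit: the inherited field \<^const>\<open>one\<close> is
  unconstrained and irrelevant throughout.
\<close>

record 'a nalg = "(complex, 'a) module" +
  anorm :: "'a \<Rightarrow> real"

locale normed_algebra = abelian_group A for A :: "('a, 'm) nalg_scheme" (structure) +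
  assumes mult_closed: "\<lbrakk>x \<in> carrier A; y \<in> carrier A\<rbrakk> \<Longrightarrow> x \<otimes> y \<in> carrier A"
    and mult_assoc: "\<lbrakk>x \<in> carrier A; y \<in> carrier A; z \<in> carrier A\<rbrakk> \<Longrightarrow>
      (x \<otimes> y) \<otimes> z = x \<otimes> (y \<otimes> z)"
    and mult_add_left: "\<lbrakk>x \<in> carrier A; y \<in> carrier A; z \<in> carrier A\<rbrakk> \<Longrightarrow>
      (x \<oplus> y) \<otimes> z = x \<otimes> z \<oplus> y \<otimes> z"
    and mult_add_right: "\<lbrakk>x \<in> carrier A; y \<in> carrier A; z \<in> carrier A\<rbrakk> \<Longrightarrow>
      z \<otimes> (x \<oplus> y) = z \<otimes> x \<oplus> z \<otimes> y"
    and smult_closed: "x \<in> carrier A \<Longrightarrow> c \<odot> x \<in> carrier A"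
    and smult_add_scalar: "x \<in> carrier A \<Longrightarrow> (c + d) \<odot> x = c \<odot> x \<oplus> d \<odot> x"
    and smult_add_vector: "\<lbrakk>x \<in> carrier A; y \<in> carrier A\<rbrakk> \<Longrightarrow>
      c \<odot> (x \<oplus> y) = c \<odot> x \<oplus> c \<odot> y"
    and smult_smult: "x \<in> carrier A \<Longrightarrow> c \<odot> (d \<odot> x) = (c * d) \<odot> x"
    and smult_1: "x \<in> carrier A \<Longrightarrow> 1 \<odot> x = x"
    and smult_mult_left: "\<lbrakk>x \<in> carrier A; y \<in> carrier A\<rbrakk> \<Longrightarrow>
      (c \<odot> x) \<otimes> y = c \<odot> (x \<otimes> y)"
    and smult_mult_right: "\<lbrakk>x \<in> carrier A; y \<in> carrier A\<rbrakk> \<Longrightarrow>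
      x \<otimes> (c \<odot> y) = c \<odot> (x \<otimes> y)"
    and anorm_nonneg: "x \<in> carrier A \<Longrightarrow> 0 \<le> anorm A x"
    and anorm_eq_0: "x \<in> carrier A \<Longrightarrow> anorm A x = 0 \<longleftrightarrow> x = \<zero>"
    and anorm_triangle: "\<lbrakk>x \<in> carrier A; y \<in> carrier A\<rbrakk> \<Longrightarrow>
      anorm A (x \<oplus> y) \<le> anorm A x + anorm A y"
    and anorm_smult: "x \<in> carrier A \<Longrightarrow> anorm A (c \<odot> x) = cmod c * anorm A x"
    and anorm_mult: "\<lbrakk>x \<in> carrier A; y \<in> carrier A\<rbrakk> \<Longrightarrow>
      anorm A (x \<otimes> y) \<le> anorm A x * anorm A y"

text \<open>
  The locale \<^locale>\<open>Metric_space\<close> wants a distance that is nonnegative and symmetric on the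
  whole type, hence the value 0 outside the carrier.
\<close>

definition adist :: "'a nalg \<Rightarrow> 'a \<Rightarrow> 'a \<Rightarrow> real" where
  "adist A x y = (if x \<in> carrier A \<and> y \<in> carrier A then anorm A (x \<ominus>\<^bsub>A\<^esub> y) else 0)"

abbreviation atopology :: "'a nalg \<Rightarrow> 'a topology" where
  "atopology A \<equiv> Metric_space.mtopology (carrier A) (adist A)"


section \<open>Ideals, quotients, isomorphisms\<close>

definition alg_ideal :: "'a set \<Rightarrow> 'a nalg \<Rightarrow> bool" where
  "alg_ideal I A \<longleftrightarrow> additive_subgroup I A \<and>
     (\<forall>c. \<forall>x\<in>I. c \<odot>\<^bsub>A\<^esub> x \<in> I) \<and>
     (\<forall>a\<in>carrier A. \<forall>x\<in>I. a \<otimes>\<^bsub>A\<^esub> x \<in> I \<and> x \<otimes>\<^bsub>A\<^esub> a \<in> I)"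

definition closed_ideal :: "'a set \<Rightarrow> 'a nalg \<Rightarrow> bool" where
  "closed_ideal I A \<longleftrightarrow> alg_ideal I A \<and> closedin (atopology A) I"

text \<open>An ideal regarded as a normed algebra in its own right.\<close>

abbreviation ideal_alg :: "'a nalg \<Rightarrow> 'a set \<Rightarrow> 'a nalg" where
  "ideal_alg A I \<equiv> A\<lparr>carrier := I\<rparr>"

text \<open>
  The ring structure is that of \<^term>\<open>A Quot I\<close>.  The norm is the usual quotient norm
  \<open>\<parallel>a + I\<parallel> = inf {\<parallel>x\<parallel> | x \<in> a + I}\<close>.
\<close>

definition quot_alg :: "'a nalg \<Rightarrow> 'a set \<Rightarrow> 'a set nalg" where
  "quot_alg A I =
     \<lparr>carrier = a_rcosets\<^bsub>A\<^esub> I, mult = rcoset_mult A I, one = I +>\<^bsub>A\<^esub> \<one>\<^bsub>A\<^esub>,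
      zero = I, add = set_add A,
      smult = (\<lambda>c X. \<Union>x\<in>X. I +>\<^bsub>A\<^esub> (c \<odot>\<^bsub>A\<^esub> x)),
      anorm = (\<lambda>X. INF x\<in>X. anorm A x)\<rparr>"

definition quot_map :: "'a nalg \<Rightarrow> 'a set \<Rightarrow> 'a \<Rightarrow> 'a set" where
  "quot_map A I a = I +>\<^bsub>A\<^esub> a"

definition topological_iso :: "'a nalg \<Rightarrow> 'b nalg \<Rightarrow> ('a \<Rightarrow> 'b) \<Rightarrow> bool" where
  "topological_iso A B f \<longleftrightarrow> bij_betw f (carrier A) (carrier B) \<and>
     (\<forall>x\<in>carrier A. \<forall>y\<in>carrier A. f (x \<oplus>\<^bsub>A\<^esub> y) = f x \<oplus>\<^bsub>B\<^esub> f y) \<and>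
     (\<forall>x\<in>carrier A. \<forall>y\<in>carrier A. f (x \<otimes>\<^bsub>A\<^esub> y) = f x \<otimes>\<^bsub>B\<^esub> f y) \<and>
     (\<forall>c. \<forall>x\<in>carrier A. f (c \<odot>\<^bsub>A\<^esub> x) = c \<odot>\<^bsub>B\<^esub> f x) \<and>
     homeomorphic_map (atopology A) (atopology B) f"


section \<open>The joint spectral radius\<close>

definition set_norm :: "'a nalg \<Rightarrow> 'a set \<Rightarrow> real" where
  "set_norm A M = (SUP a\<in>M. anorm A a)"

text \<open>There is no zeroth power without a unit; the value at 0 is a dummy that is never used.\<close>

fun set_power :: "'a nalg \<Rightarrow> 'a set \<Rightarrow> nat \<Rightarrow> 'a set" where
  "set_power A M 0 = {}"
| "set_power A M (Suc 0) = M"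
| "set_power A M (Suc (Suc n)) = set_power A M (Suc n) <#>\<^bsub>A\<^esub> M"

definition joint_spectral_radius :: "'a nalg \<Rightarrow> 'a set \<Rightarrow> real" where
  "joint_spectral_radius A M = (INF n\<in>{1..}. root n (set_norm A (set_power A M n)))"

definition finite_subsets :: "'a nalg \<Rightarrow> 'a set set" where
  "finite_subsets A = {M. M \<noteq> {} \<and> M \<subseteq> carrier A \<and> finite M}"

definition precompact_subsets :: "'a nalg \<Rightarrow> 'a set set" where
  "precompact_subsets A =
     {M. M \<noteq> {} \<and> M \<subseteq> carrier A \<and> Metric_space.mtotally_bounded (carrier A) (adist A) M}"

definition bounded_subsets :: "'a nalg \<Rightarrow> 'a set set" where
  "bounded_subsets A =
     {M. M \<noteq> {} \<and> M \<subseteq> carrier A \<and> Metric_space.mbounded (carrier A) (adist A) M}"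

definition jsr_radical :: "('a nalg \<Rightarrow> 'a set set) \<Rightarrow> 'a nalg \<Rightarrow> 'a set" where
  "jsr_radical \<M> A = {a \<in> carrier A. \<forall>M\<in>\<M> A.
     joint_spectral_radius A ({a} \<union> M) = joint_spectral_radius A M}"

definition Rf :: "'a nalg \<Rightarrow> 'a set" where "Rf = jsr_radical finite_subsets"
definition Rc :: "'a nalg \<Rightarrow> 'a set" where "Rc = jsr_radical precompact_subsets"
definition Rb :: "'a nalg \<Rightarrow> 'a set" where "Rb = jsr_radical bounded_subsets"


section \<open>Topological radicals\<close>

text \<open>
  A map on the class of all normed algebras is a polymorphic constant such as \<^const>\<open>Rc\<close>.
  A predicate cannot take a polymorphic argument, so the predicates below take the instances
  of the map that the conditions mention: \<open>R\<close> for algebras over \<open>'a\<close>, \<open>S\<close> for a second,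
  independent type \<open>'b\<close> (the target of an isomorphism) and \<open>Q\<close> for \<open>'a set\<close> (quotients).  They
  are meant to be applied to the three instances of one polymorphic constant, in a statement
  with \<open>'a\<close> and \<open>'b\<close> arbitrary.
\<close>

definition ideal_map :: "('a nalg \<Rightarrow> 'a set) \<Rightarrow> bool" where
  "ideal_map R \<longleftrightarrow> (\<forall>A. normed_algebra A \<longrightarrow> closed_ideal (R A) A)"

definition rad1 :: "('a nalg \<Rightarrow> 'a set) \<Rightarrow> bool" where
  "rad1 R \<longleftrightarrow> (\<forall>A. normed_algebra A \<longrightarrow> R (ideal_alg A (R A)) = R A)"

definition rad2 :: "('a nalg \<Rightarrow> 'a set) \<Rightarrow> ('a set nalg \<Rightarrow> 'a set set) \<Rightarrow> bool" where
  "rad2 R Q \<longleftrightarrow>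
     (\<forall>A. normed_algebra A \<longrightarrow> Q (quot_alg A (R A)) = {\<zero>\<^bsub>quot_alg A (R A)\<^esub>})"

definition rad3 :: "('a nalg \<Rightarrow> 'a set) \<Rightarrow> ('b nalg \<Rightarrow> 'b set) \<Rightarrow> bool" where
  "rad3 R S \<longleftrightarrow> (\<forall>A B f. normed_algebra A \<and> normed_algebra B \<and> topological_iso A B f \<longrightarrow>
     f ` R A = S B)"

definition rad4 :: "('a nalg \<Rightarrow> 'a set) \<Rightarrow> ('a set nalg \<Rightarrow> 'a set set) \<Rightarrow> bool" where
  "rad4 R Q \<longleftrightarrow> (\<forall>A I. normed_algebra A \<and> closed_ideal I A \<longrightarrow>
     quot_map A I ` R A \<subseteq> Q (quot_alg A I))"

definition rad5 :: "('a nalg \<Rightarrow> 'a set) \<Rightarrow> bool" where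
  "rad5 R \<longleftrightarrow> (\<forall>A I. normed_algebra A \<and> alg_ideal I A \<longrightarrow>
     alg_ideal (R (ideal_alg A I)) A \<and> R (ideal_alg A I) \<subseteq> I \<inter> R A)"

definition rad6 :: "('a nalg \<Rightarrow> 'a set) \<Rightarrow> bool" where
  "rad6 R \<longleftrightarrow> (\<forall>A I. normed_algebra A \<and> alg_ideal I A \<longrightarrow> R (ideal_alg A I) = I \<inter> R A)"

definition topological_radical ::
    "('a nalg \<Rightarrow> 'a set) \<Rightarrow> ('b nalg \<Rightarrow> 'b set) \<Rightarrow> ('a set nalg \<Rightarrow> 'a set set) \<Rightarrow> bool" where
  "topological_radical R S Q \<longleftrightarrow>
     ideal_map R \<and> rad1 R \<and> rad2 R Q \<and> rad3 R S \<and> rad4 R Q \<and> rad5 R"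

definition hereditary_topological_radical ::
    "('a nalg \<Rightarrow> 'a set) \<Rightarrow> ('b nalg \<Rightarrow> 'b set) \<Rightarrow> ('a set nalg \<Rightarrow> 'a set set) \<Rightarrow> bool" where
  "hereditary_topological_radical R S Q \<longleftrightarrow> topological_radical R S Q \<and> rad6 R"

definition under_topological_radical ::
    "('a nalg \<Rightarrow> 'a set) \<Rightarrow> ('b nalg \<Rightarrow> 'b set) \<Rightarrow> ('a set nalg \<Rightarrow> 'a set set) \<Rightarrow> bool" where
  "under_topological_radical R S Q \<longleftrightarrow>
     ideal_map R \<and> rad1 R \<and> rad3 R S \<and> rad4 R Q \<and> rad5 R"

definition hereditary_under_topological_radical ::
    "('a nalg \<Rightarrow> 'a set) \<Rightarrow> ('b nalg \<Rightarrow> 'b set) \<Rightarrow> ('a set nalg \<Rightarrow> 'a set set) \<Rightarrow> bool" where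
  "hereditary_under_topological_radical R S Q \<longleftrightarrow> under_topological_radical R S Q \<and> rad6 R"

end

theory Submission
  imports Defs
begin

text \<open>
  The proof replaces spectral radii by norms.  For a bounded set \<open>M\<close> one has \<open>\<rho>(M) < r\<close> only if some
  norm \<open>N\<close> equivalent to the given one satisfies \<open>N (m v) \<le> r N v\<close> for all \<open>m \<in> M\<close>
  (\<open>contracting_norm_exists\<close>, in the spirit of Rota and Strang), and such a norm forces \<open>\<rho>(M) \<le> r\<close>
  (\<open>jsr_le_contraction\<close>).  The elements that contract \<open>N\<close> are closed under products, averages and
  limits, and they include all elements of sufficiently small norm.  Nearly every estimate of a
  joint spectral radius below consists in recognising the set in question as a set of such
  elements.  Where no norm is at hand, a bounded neighbourhood of 0 that the set maps into itself
  serves instead (\<open>jsr_le_one_of_invariant\<close>).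

  After rescaling, \<open>a\<close> lies in the radical if and only if \<open>\<rho>(M) < 1\<close> implies
  \<open>\<rho>({c a} \<union> M) \<le> 1\<close> for all scalars \<open>c\<close> and all test sets \<open>M\<close>, the sets over which the definition
  of the radical quantifies (\<open>radical_jsr\<close>, \<open>radicalI\<close>).
  Because \<open>c\<close> may be large, an element of the radical absorbs anything that is bounded: a product
  \<open>a b\<close> is treated as \<open>(a / t) (t b)\<close> with \<open>t b\<close> small enough to join \<open>M\<close> without
  spoiling \<open>\<rho> < 1\<close>.  This rebalancing drives the arguments for ideals, heredity and quotients.

  \<^item> Ideals: sums are averages of doubles, products are rebalanced, limits differ from elements
    of the radical by something small.
  \<^item> Heredity (precompact and bounded sets): if \<open>\<rho>(M) < 1\<close>, the semigroup \<open>S\<close> generated by \<open>M\<close>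
    is again a test set.  An element \<open>b\<close> of the radical of an ideal \<open>I\<close> is rebalanced against the
    test set of all \<open>g b h\<close> with \<open>g\<close> and \<open>h\<close> in \<open>S\<close> or absent, which lies in \<open>I\<close>; words in \<open>b\<close>
    and \<open>M\<close> alternate between these two kinds of factor (\<open>radical_ideal_alg_subset\<close>).
  \<^item> Images in \<open>A/I\<close>: a test set \<open>M\<close> of \<open>A/I\<close> with \<open>\<rho>(M) < 1\<close> need not lift to a set with \<open>\<rho> < 1\<close>,
    but a high power \<open>M\<^sup>n\<close> has small norm and lifts to a test set of small norm
    (\<open>small_lift\<close>); the lower powers are rebalanced against the element of the radical
    (\<open>quot_map_radical\<close>).
  \<^item> The quotient by the radical (finite and precompact sets): if the image of \<open>K\<close> in \<open>A/R(A)\<close> has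
    \<open>\<rho> < 1\<close>, then \<open>K\<^sup>n\<close> consists of sums of an element of small norm and one of finitely many
    elements of \<open>R(A)\<close>, since \<open>K\<^sup>n\<close> has finite nets; hence \<open>\<rho>(K) \<le> 1\<close> (\<open>quotient_by_radical\<close>).
  \<^item> Isomorphisms: bounded homomorphisms do not increase \<open>\<rho>\<close>, because constant factors disappear
    in the growth rate.
\<close>

section \<open>Elementary rules in a normed algebra\<close>

text \<open>
  The distance and the joint spectral radius are defined for records without additional fields, which
  is why the record type is fixed here.
\<close>

locale nalg = normed_algebra A for A :: "'a nalg" (structure)
begin

declare mult_closed [simp, intro] smult_closed [simp, intro] anorm_nonneg [simp]

lemma smult_zero_scalar [simp]: "x \<in> carrier A \<Longrightarrow> 0 \<odot> x = \<zero>"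
  using smult_add_scalar[of x 0 0] add.l_cancel_one'[of "0 \<odot> x" "0 \<odot> x"] by simp

lemma smult_minus_one: "x \<in> carrier A \<Longrightarrow> (-1) \<odot> x = \<ominus> x"
  using smult_add_scalar[of x "-1" 1] by (intro add.inv_equality[symmetric]) (auto simp: smult_1)

lemma minus_smult: "x \<in> carrier A \<Longrightarrow> y \<in> carrier A \<Longrightarrow> x \<ominus> y = x \<oplus> (-1) \<odot> y"
  by (simp add: a_minus_def smult_minus_one)

lemma smult_zero [simp]: "c \<odot> \<zero> = \<zero>"
  using smult_smult[of \<zero> c 0] by simp

lemma mult_zero_left [simp]: "x \<in> carrier A \<Longrightarrow> \<zero> \<otimes> x = \<zero>"
  using smult_mult_left[of \<zero> x 0] by simp

lemma mult_zero_right [simp]: "x \<in> carrier A \<Longrightarrow> x \<otimes> \<zero> = \<zero>"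
  using smult_mult_right[of x \<zero> 0] by simp

lemma anorm_zero [simp]: "anorm A \<zero> = 0"
  using anorm_eq_0[of \<zero>] by simp

lemma smult_diff: "x \<in> carrier A \<Longrightarrow> y \<in> carrier A \<Longrightarrow> c \<odot> (x \<ominus> y) = c \<odot> x \<ominus> c \<odot> y"
  by (simp add: minus_smult smult_add_vector smult_smult mult.commute)

lemma diff_mult: "x \<in> carrier A \<Longrightarrow> y \<in> carrier A \<Longrightarrow> z \<in> carrier A \<Longrightarrow>
    (x \<ominus> y) \<otimes> z = x \<otimes> z \<ominus> y \<otimes> z"
  by (simp add: minus_smult mult_add_left smult_mult_left)

lemma mult_diff: "x \<in> carrier A \<Longrightarrow> y \<in> carrier A \<Longrightarrow> z \<in> carrier A \<Longrightarrow>
    z \<otimes> (x \<ominus> y) = z \<otimes> x \<ominus> z \<otimes> y"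
  by (simp add: minus_smult mult_add_right smult_mult_right)

lemma diff_add_cancel: "x \<in> carrier A \<Longrightarrow> y \<in> carrier A \<Longrightarrow> (x \<ominus> y) \<oplus> y = x"
  by (simp add: a_minus_def a_assoc l_neg)

lemma add_diff_cancel: "x \<in> carrier A \<Longrightarrow> y \<in> carrier A \<Longrightarrow> (x \<oplus> y) \<ominus> y = x"
  by (simp add: a_minus_def a_assoc r_neg)

lemma diff_self [simp]: "x \<in> carrier A \<Longrightarrow> x \<ominus> x = \<zero>"
  by (simp add: a_minus_def r_neg)

lemma diff_zero [simp]: "x \<in> carrier A \<Longrightarrow> x \<ominus> \<zero> = x"
  using diff_add_cancel[of x \<zero>] by simp

lemma diff_eq_zero: "x \<in> carrier A \<Longrightarrow> y \<in> carrier A \<Longrightarrow> x \<ominus> y = \<zero> \<Longrightarrow> x = y"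
  using diff_add_cancel[of x y] by simp

lemma anorm_minus [simp]: "x \<in> carrier A \<Longrightarrow> anorm A (\<ominus> x) = anorm A x"
  using anorm_smult[of x "-1"] by (simp add: smult_minus_one)

lemma diff_diff_add: "x \<in> carrier A \<Longrightarrow> y \<in> carrier A \<Longrightarrow> z \<in> carrier A \<Longrightarrow>
    (x \<ominus> y) \<oplus> (y \<ominus> z) = x \<ominus> z"
  by (metis a_assoc a_minus_def diff_add_cancel minus_closed a_inv_closed)

lemma anorm_diff_commute: "x \<in> carrier A \<Longrightarrow> y \<in> carrier A \<Longrightarrow> anorm A (x \<ominus> y) = anorm A (y \<ominus> x)"
  using anorm_minus[of "x \<ominus> y"] by (simp add: a_minus_def minus_add a_comm)

lemma anorm_diff_triangle: "x \<in> carrier A \<Longrightarrow> y \<in> carrier A \<Longrightarrow> z \<in> carrier A \<Longrightarrow>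
    anorm A (x \<ominus> z) \<le> anorm A (x \<ominus> y) + anorm A (y \<ominus> z)"
  using anorm_triangle[of "x \<ominus> y" "y \<ominus> z"] by (simp add: diff_diff_add)

lemma anorm_diff_le: "x \<in> carrier A \<Longrightarrow> y \<in> carrier A \<Longrightarrow> anorm A (x \<ominus> y) \<le> anorm A x + anorm A y"
  using anorm_triangle[of x "\<ominus> y"] by (simp add: a_minus_def)

lemma anorm_le_diff: "x \<in> carrier A \<Longrightarrow> y \<in> carrier A \<Longrightarrow> anorm A x \<le> anorm A (x \<ominus> y) + anorm A y"
  using anorm_triangle[of "x \<ominus> y" y] by (simp add: diff_add_cancel)

lemma diff_diff_swap: "\<lbrakk>x \<in> carrier A; y \<in> carrier A; u \<in> carrier A; v \<in> carrier A\<rbrakk> \<Longrightarrow>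
    (x \<ominus> y) \<ominus> (u \<ominus> v) = (x \<ominus> u) \<ominus> (y \<ominus> v)"
  by (simp add: a_minus_def minus_add a_ac)

lemma diff_diff_cancel: "x \<in> carrier A \<Longrightarrow> y \<in> carrier A \<Longrightarrow> x \<ominus> (x \<ominus> y) = y"
proof -
  assume xy: "x \<in> carrier A" "y \<in> carrier A"
  then have "x \<ominus> (x \<ominus> y) = y \<oplus> (x \<ominus> x)"
    unfolding a_minus_def by (simp add: minus_add a_ac)
  then show ?thesis using xy by simp
qed

lemma metric: "Metric_space (carrier A) (adist A)"
proof
  show "0 \<le> adist A x y" for x y by (simp add: adist_def)
  show "adist A x y = adist A y x" for x y by (simp add: adist_def anorm_diff_commute)
  show "adist A x y = 0 \<longleftrightarrow> x = y" if "x \<in> carrier A" "y \<in> carrier A" for x y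
    using that diff_eq_zero by (auto simp: adist_def anorm_eq_0)
  show "adist A x z \<le> adist A x y + adist A y z"
    if "x \<in> carrier A" "y \<in> carrier A" "z \<in> carrier A" for x y z
    using that by (simp add: adist_def anorm_diff_triangle)
qed

sublocale Met: Metric_space "carrier A" "adist A"
  by (rule metric)

section \<open>Bounded sets and the growth of their powers\<close>

lemma bounded_subsets_iff:
  "M \<in> bounded_subsets A \<longleftrightarrow> M \<noteq> {} \<and> M \<subseteq> carrier A \<and> (\<exists>K>0. \<forall>x\<in>M. anorm A x \<le> K)"
proof -
  have "(\<exists>K>0. \<forall>x\<in>M. anorm A x \<le> K)" if "M \<noteq> {}" and sub: "M \<subseteq> carrier A"
    and B: "\<And>x y. x \<in> M \<Longrightarrow> y \<in> M \<Longrightarrow> adist A x y \<le> B" for B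
  proof -
    obtain y where y: "y \<in> M" using \<open>M \<noteq> {}\<close> by blast
    have "anorm A x \<le> \<bar>B\<bar> + anorm A y + 1" if "x \<in> M" for x
      using B[OF that y] anorm_le_diff[of x y] sub that y by (auto simp: adist_def subset_iff)
    moreover have "0 < \<bar>B\<bar> + anorm A y + 1"
      using y sub anorm_nonneg[of y] by fastforce
    ultimately show ?thesis by blast
  qed
  moreover have "adist A x y \<le> K + K"
    if sub: "M \<subseteq> carrier A" and K: "\<forall>x\<in>M. anorm A x \<le> K" and xy: "x \<in> M" "y \<in> M" for x y K
  proof -
    have "x \<in> carrier A" "y \<in> carrier A" "anorm A x \<le> K" "anorm A y \<le> K" using sub K xy by auto
    then show ?thesis using anorm_diff_le[of x y] by (simp add: adist_def)
  qed
  ultimately show ?thesis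
    unfolding bounded_subsets_def Met.mbounded_alt by blast
qed

lemma bounded_subsetsE:
  assumes "M \<in> bounded_subsets A"
  obtains K where "M \<noteq> {}" "M \<subseteq> carrier A" "K > 0" "\<And>x. x \<in> M \<Longrightarrow> anorm A x \<le> K"
  using assms by (auto simp: bounded_subsets_iff)

lemma set_mult_iff: "x \<in> H <#> K \<longleftrightarrow> (\<exists>h\<in>H. \<exists>k\<in>K. x = h \<otimes> k)"
  by (auto simp: set_mult_def)

lemma bounded_set_mult:
  assumes "M \<in> bounded_subsets A" "N \<in> bounded_subsets A"
  shows "M <#> N \<in> bounded_subsets A"
proof -
  obtain K L where M: "M \<noteq> {}" "M \<subseteq> carrier A" "K > 0" "\<And>x. x \<in> M \<Longrightarrow> anorm A x \<le> K"
    and N: "N \<noteq> {}" "N \<subseteq> carrier A" "L > 0" "\<And>x. x \<in> N \<Longrightarrow> anorm A x \<le> L"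
    using assms by (auto elim!: bounded_subsetsE)
  have "anorm A z \<le> K * L" if *: "z \<in> M <#> N" for z
  proof -
    obtain x y where z: "z = x \<otimes> y" "x \<in> M" "y \<in> N" using * by (auto simp: set_mult_iff)
    have "anorm A z \<le> anorm A x * anorm A y" using z M(2) N(2) anorm_mult by blast
    also have "\<dots> \<le> K * L" using z M N by (intro mult_mono) auto
    finally show ?thesis .
  qed
  moreover have "M <#> N \<noteq> {}" "M <#> N \<subseteq> carrier A" "K * L > 0"
    using M N by (auto simp: set_mult_def)
  ultimately show ?thesis unfolding bounded_subsets_iff by blast
qed

lemma set_power_Suc: "n \<ge> 1 \<Longrightarrow> set_power A M (Suc n) = set_power A M n <#> M"
  by (cases n) auto

lemma set_power_carrier: "M \<subseteq> carrier A \<Longrightarrow> set_power A M n \<subseteq> carrier A"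
proof (induction n)
  case (Suc n)
  then show ?case by (cases n) (auto simp: set_mult_def)
qed simp

lemma bounded_set_power:
  assumes M: "M \<in> bounded_subsets A" and n: "n \<ge> 1"
  shows "set_power A M n \<in> bounded_subsets A"
  using n
proof (induction n rule: dec_induct)
  case (step n)
  then show ?case by (simp add: set_power_Suc bounded_set_mult M del: set_power.simps(3))
qed (simp add: M)

lemma anorm_le_set_norm: "M \<in> bounded_subsets A \<Longrightarrow> x \<in> M \<Longrightarrow> anorm A x \<le> set_norm A M"
  unfolding set_norm_def bounded_subsets_iff by (metis cSUP_upper bdd_aboveI2)

lemma set_norm_le: "M \<noteq> {} \<Longrightarrow> (\<And>x. x \<in> M \<Longrightarrow> anorm A x \<le> K) \<Longrightarrow> set_norm A M \<le> K"
  unfolding set_norm_def by (rule cSUP_least)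

lemma set_norm_nonneg: "M \<in> bounded_subsets A \<Longrightarrow> 0 \<le> set_norm A M"
  by (metis anorm_le_set_norm anorm_nonneg bounded_subsetsE ex_in_conv order_trans subsetD)

lemma jsr_bdd_below: "M \<in> bounded_subsets A \<Longrightarrow>
    bdd_below ((\<lambda>n. root n (set_norm A (set_power A M n))) ` {1..})"
  by (rule bdd_belowI[of _ 0]) (auto intro!: set_norm_nonneg bounded_set_power)

lemma jsr_nonneg: "M \<in> bounded_subsets A \<Longrightarrow> 0 \<le> joint_spectral_radius A M"
  unfolding joint_spectral_radius_def
  by (rule cINF_greatest) (auto intro!: set_norm_nonneg bounded_set_power)

lemma jsr_le_root: "M \<in> bounded_subsets A \<Longrightarrow> n \<ge> 1 \<Longrightarrow>
    joint_spectral_radius A M \<le> root n (set_norm A (set_power A M n))"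
  unfolding joint_spectral_radius_def by (rule cINF_lower[OF jsr_bdd_below]) auto

text \<open>
  Otherwise \<open>\<rho>(M) / r > 1\<close>, and its powers, all at most \<open>D\<close>, would be unbounded.
\<close>

lemma jsr_le_of_growth:
  assumes M: "M \<in> bounded_subsets A" and r: "0 < r"
    and D: "\<And>n x. n \<ge> 1 \<Longrightarrow> x \<in> set_power A M n \<Longrightarrow> anorm A x \<le> D * r ^ n"
  shows "joint_spectral_radius A M \<le> r"
proof (rule ccontr)
  let ?\<rho> = "joint_spectral_radius A M"
  assume "\<not> ?\<rho> \<le> r"
  then have less: "1 < ?\<rho> / r" using r by simp
  have "?\<rho> ^ n \<le> D * r ^ n" if n: "n \<ge> 1" for n
  proof -
    have P: "set_power A M n \<in> bounded_subsets A" using M n by (rule bounded_set_power)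
    have "?\<rho> ^ n \<le> root n (set_norm A (set_power A M n)) ^ n"
      using jsr_le_root[OF M n] jsr_nonneg[OF M] by (rule power_mono)
    also have "\<dots> = set_norm A (set_power A M n)"
      using n set_norm_nonneg[OF P] by simp
    also have "\<dots> \<le> D * r ^ n"
      using P D[OF n] by (intro set_norm_le) (auto simp: bounded_subsets_iff)
    finally show ?thesis .
  qed
  then have le: "(?\<rho> / r) ^ n \<le> D" if "n \<ge> 1" for n
    using that r by (simp add: power_divide divide_le_eq)
  obtain n where n: "D < (?\<rho> / r) ^ n" using real_arch_pow[OF less] by blast
  also have "(?\<rho> / r) ^ n \<le> (?\<rho> / r) ^ Suc n" using less by (intro power_increasing) auto
  also have "\<dots> \<le> D" by (rule le) simp
  finally show False by simp
qed

lemma jsr_less_power: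
  assumes M: "M \<in> bounded_subsets A" and less: "joint_spectral_radius A M < r"
  obtains n where "n \<ge> 1" "\<And>x. x \<in> set_power A M n \<Longrightarrow> anorm A x \<le> r ^ n"
proof -
  obtain n where n: "n \<ge> 1" "root n (set_norm A (set_power A M n)) < r"
    using less cINF_less_iff[OF _ jsr_bdd_below[OF M]] unfolding joint_spectral_radius_def by force
  let ?s = "set_norm A (set_power A M n)"
  have P: "set_power A M n \<in> bounded_subsets A" using M n(1) by (rule bounded_set_power)
  have "?s = root n ?s ^ n" using n(1) set_norm_nonneg[OF P] by simp
  also have "\<dots> \<le> r ^ n" using n set_norm_nonneg[OF P] by (intro power_mono) auto
  finally have "anorm A x \<le> r ^ n" if "x \<in> set_power A M n" for x
    using anorm_le_set_norm[OF P that] by simp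
  with n(1) show ?thesis by (rule that)
qed

section \<open>Equivalent norms and contractions\<close>

text \<open>
  The algebra acts by left multiplication on its underlying vector space, and these are the norms of
  that space which are equivalent to the given one, with lower constant normalised to 1.
\<close>

definition equivalent_norm :: "('a \<Rightarrow> real) \<Rightarrow> bool" where
  "equivalent_norm N \<longleftrightarrow>
     (\<forall>u\<in>carrier A. \<forall>v\<in>carrier A. N (u \<oplus> v) \<le> N u + N v) \<and>
     (\<forall>c. \<forall>v\<in>carrier A. N (c \<odot> v) = cmod c * N v) \<and>
     (\<exists>C>0. \<forall>v\<in>carrier A. anorm A v \<le> N v \<and> N v \<le> C * anorm A v)"

definition contraction :: "('a \<Rightarrow> real) \<Rightarrow> real \<Rightarrow> 'a \<Rightarrow> bool" where
  "contraction N r x \<longleftrightarrow> x \<in> carrier A \<and> (\<forall>v\<in>carrier A. N (x \<otimes> v) \<le> r * N v)"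

lemma equivalent_norm_bounds:
  assumes "equivalent_norm N"
  obtains C where "C > 0" "\<And>v. v \<in> carrier A \<Longrightarrow> anorm A v \<le> N v"
    "\<And>v. v \<in> carrier A \<Longrightarrow> N v \<le> C * anorm A v"
  using assms unfolding equivalent_norm_def by blast

lemma equivalent_norm_nonneg: "equivalent_norm N \<Longrightarrow> v \<in> carrier A \<Longrightarrow> 0 \<le> N v"
  by (meson anorm_nonneg equivalent_norm_bounds order_trans)

lemma equivalent_norm_add:
  "equivalent_norm N \<Longrightarrow> u \<in> carrier A \<Longrightarrow> v \<in> carrier A \<Longrightarrow> N (u \<oplus> v) \<le> N u + N v"
  by (simp add: equivalent_norm_def)

lemma equivalent_norm_smult:
  "equivalent_norm N \<Longrightarrow> v \<in> carrier A \<Longrightarrow> N (c \<odot> v) = cmod c * N v"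
  by (simp add: equivalent_norm_def)

lemma equivalent_norm_anorm: "equivalent_norm (anorm A)"
  unfolding equivalent_norm_def by (auto simp: anorm_triangle anorm_smult intro: exI[of _ 1])

lemma contraction_carrier: "contraction N r x \<Longrightarrow> x \<in> carrier A"
  by (simp add: contraction_def)

lemma contractionD: "contraction N r x \<Longrightarrow> v \<in> carrier A \<Longrightarrow> N (x \<otimes> v) \<le> r * N v"
  by (simp add: contraction_def)

lemma contraction_anorm: "x \<in> carrier A \<Longrightarrow> anorm A x \<le> r \<Longrightarrow> contraction (anorm A) r x"
  unfolding contraction_def by (meson anorm_mult anorm_nonneg mult_right_mono order_trans)

lemma contraction_mono:
  assumes "equivalent_norm N" "contraction N r x" "r \<le> s"
  shows "contraction N s x"
  unfolding contraction_def
  using assms equivalent_norm_nonneg[OF assms(1)] contractionD[OF assms(2)]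
    contraction_carrier[OF assms(2)]
  by (meson mult_right_mono order_trans)

lemma contraction_smult:
  assumes "equivalent_norm N" "contraction N r x"
  shows "contraction N (cmod c * r) (c \<odot> x)"
  using assms contraction_carrier[OF assms(2)] contractionD[OF assms(2)]
  by (auto simp: contraction_def smult_mult_left equivalent_norm_smult mult.assoc
        intro!: mult_left_mono)

lemma contraction_add:
  assumes N: "equivalent_norm N" and x: "contraction N r x" and y: "contraction N s y"
  shows "contraction N (r + s) (x \<oplus> y)"
  unfolding contraction_def
proof (intro conjI ballI)
  have c: "x \<in> carrier A" "y \<in> carrier A" using x y by (auto simp: contraction_def)
  then show "x \<oplus> y \<in> carrier A" by simp
  fix v assume v: "v \<in> carrier A"
  have "N ((x \<oplus> y) \<otimes> v) \<le> N (x \<otimes> v) + N (y \<otimes> v)"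
    using c v equivalent_norm_add[OF N] by (simp add: mult_add_left)
  also have "\<dots> \<le> (r + s) * N v"
    using contractionD[OF x v] contractionD[OF y v] by (simp add: algebra_simps)
  finally show "N ((x \<oplus> y) \<otimes> v) \<le> (r + s) * N v" .
qed

lemma contraction_mult:
  assumes N: "equivalent_norm N" and r: "0 \<le> r" and x: "contraction N r x" and y: "contraction N s y"
  shows "contraction N (r * s) (x \<otimes> y)"
  unfolding contraction_def
proof (intro conjI ballI)
  have c: "x \<in> carrier A" "y \<in> carrier A" using x y by (auto simp: contraction_def)
  then show "x \<otimes> y \<in> carrier A" by simp
  fix v assume v: "v \<in> carrier A"
  have "N ((x \<otimes> y) \<otimes> v) \<le> r * N (y \<otimes> v)"
    using c v contractionD[OF x, of "y \<otimes> v"] by (simp add: mult_assoc)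
  also have "\<dots> \<le> r * s * N v"
    using contractionD[OF y v] r by (simp add: mult_left_mono mult.assoc)
  finally show "N ((x \<otimes> y) \<otimes> v) \<le> r * s * N v" .
qed

text \<open>
  Elements of small norm are uniformly contracting in any equivalent norm.  This is the source of
  all semicontinuity statements below.
\<close>

lemma small_contraction:
  assumes N: "equivalent_norm N" and r: "0 < r"
  obtains e where "e > 0" "\<And>x. x \<in> carrier A \<Longrightarrow> anorm A x \<le> e \<Longrightarrow> contraction N r x"
proof -
  obtain C where C: "C > 0" "\<And>v. v \<in> carrier A \<Longrightarrow> anorm A v \<le> N v"
    "\<And>v. v \<in> carrier A \<Longrightarrow> N v \<le> C * anorm A v" using equivalent_norm_bounds[OF N] by blast
  have "N (x \<otimes> v) \<le> r * N v"
    if x: "x \<in> carrier A" and le: "anorm A x \<le> r / C" and v: "v \<in> carrier A" for x v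
  proof -
    have "N (x \<otimes> v) \<le> C * (anorm A x * anorm A v)"
      using C(1) C(3)[of "x \<otimes> v"] anorm_mult[OF x v] x v
      by (meson mult_closed mult_left_mono less_imp_le order_trans)
    also have "\<dots> \<le> C * (r / C * N v)"
      using C(1) C(2)[OF v] le r x v by (intro mult_left_mono mult_mono) auto
    also have "\<dots> = r * N v" using C(1) by simp
    finally show ?thesis .
  qed
  then have "contraction N r x" if "x \<in> carrier A" "anorm A x \<le> r / C" for x
    using that by (simp add: contraction_def)
  moreover have "r / C > 0" using r C(1) by simp
  ultimately show ?thesis using that by blast
qed

lemma contraction_closure:
  assumes N: "equivalent_norm N" and x: "x \<in> carrier A"
    and approx: "\<And>e. e > 0 \<Longrightarrow> \<exists>y. contraction N r y \<and> anorm A (x \<ominus> y) \<le> e"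
  shows "contraction N r x"
  unfolding contraction_def
proof (intro conjI ballI x)
  fix v assume v: "v \<in> carrier A"
  show "N (x \<otimes> v) \<le> r * N v"
  proof (rule field_le_epsilon)
    fix e :: real assume e: "0 < e"
    have Nv: "0 \<le> N v" by (rule equivalent_norm_nonneg[OF N v])
    obtain d where d: "d > 0" "\<And>y. y \<in> carrier A \<Longrightarrow> anorm A y \<le> d \<Longrightarrow> contraction N (e / (N v + 1)) y"
      using small_contraction[OF N, of "e / (N v + 1)"] e Nv by (metis add_nonneg_pos divide_pos_pos zero_less_one)
    obtain y where y: "contraction N r y" "anorm A (x \<ominus> y) \<le> d" using approx[OF d(1)] by blast
    have yc: "y \<in> carrier A" using y(1) by (rule contraction_carrier)
    have "contraction N (e / (N v + 1) + r) ((x \<ominus> y) \<oplus> y)"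
      using d(2)[of "x \<ominus> y"] y x yc N by (intro contraction_add) auto
    then have "N (x \<otimes> v) \<le> (e / (N v + 1) + r) * N v"
      using x yc v by (auto simp: diff_add_cancel dest: contractionD)
    also have "\<dots> \<le> r * N v + e"
      using Nv e by (simp add: algebra_simps divide_le_eq)
    finally show "N (x \<otimes> v) \<le> r * N v + e" .
  qed
qed

text \<open>
  The device that produces equivalent norms: a supremum of uniformly bounded seminorms, one of which is
  the original norm.
\<close>

lemma equivalent_norm_SUP:
  assumes base: "anorm A \<in> F" and C: "C > 0"
    and add: "\<And>p u v. p \<in> F \<Longrightarrow> u \<in> carrier A \<Longrightarrow> v \<in> carrier A \<Longrightarrow> p (u \<oplus> v) \<le> p u + p v"
    and smult: "\<And>p c v. p \<in> F \<Longrightarrow> v \<in> carrier A \<Longrightarrow> p (c \<odot> v) = cmod c * p v"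
    and bound: "\<And>p v. p \<in> F \<Longrightarrow> v \<in> carrier A \<Longrightarrow> p v \<le> C * anorm A v"
  shows "equivalent_norm (\<lambda>v. SUP p\<in>F. p v)"
    and "\<And>p v. p \<in> F \<Longrightarrow> v \<in> carrier A \<Longrightarrow> p v \<le> (SUP p\<in>F. p v)"
proof -
  show upper: "p v \<le> (SUP p\<in>F. p v)" if "p \<in> F" "v \<in> carrier A" for p v
    using that bound by (intro cSUP_upper bdd_aboveI2) auto
  have ne: "F \<noteq> {}" using base by blast
  show "equivalent_norm (\<lambda>v. SUP p\<in>F. p v)"
    unfolding equivalent_norm_def
  proof (intro conjI ballI allI exI[of _ C] C)
    fix u v assume uv: "u \<in> carrier A" "v \<in> carrier A"
    have "p (u \<oplus> v) \<le> (SUP p\<in>F. p u) + (SUP p\<in>F. p v)" if p: "p \<in> F" for p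
      using add[OF p uv] upper[OF p uv(1)] upper[OF p uv(2)] by linarith
    then show "(SUP p\<in>F. p (u \<oplus> v)) \<le> (SUP p\<in>F. p u) + (SUP p\<in>F. p v)"
      by (rule cSUP_least[OF ne])
  next
    have le: "(SUP p\<in>F. p (c \<odot> v)) \<le> cmod c * (SUP p\<in>F. p v)" if v: "v \<in> carrier A" for c v
      using upper[OF _ v] by (intro cSUP_least[OF ne]) (auto simp: smult v intro: mult_left_mono)
    fix c v assume v: "v \<in> carrier A"
    show "(SUP p\<in>F. p (c \<odot> v)) = cmod c * (SUP p\<in>F. p v)"
    proof (cases "c = 0")
      case True
      then have "(\<lambda>p. p (c \<odot> v)) ` F = {0}" using v smult[of _ v 0] ne by (auto simp: image_iff)
      then show ?thesis using True by simp
    next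
      case False
      have "cmod c * (SUP p\<in>F. p v) = cmod c * (SUP p\<in>F. p (inverse c \<odot> (c \<odot> v)))"
        using False v by (simp add: smult_smult smult_1)
      also have "\<dots> \<le> cmod c * (cmod (inverse c) * (SUP p\<in>F. p (c \<odot> v)))"
        using le[of "c \<odot> v" "inverse c"] v by (intro mult_left_mono) auto
      also have "\<dots> = (SUP p\<in>F. p (c \<odot> v))"
        using False by (simp add: norm_inverse)
      finally show ?thesis using le[OF v, of c] by simp
    qed
  next
    fix v assume v: "v \<in> carrier A"
    show "anorm A v \<le> (SUP p\<in>F. p v)" by (rule upper[OF base v])
    show "(SUP p\<in>F. p v) \<le> C * anorm A v"
      using bound v by (intro cSUP_least[OF ne])
  qed
qed

text \<open>
  Some power satisfies \<open>\<parallel>M\<^sup>n\<parallel> \<le> r\<^sup>n\<close>.  The norm is the supremum of \<open>\<parallel>v\<parallel>\<close> and all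
  \<open>\<parallel>x v\<parallel> / r\<^sup>j\<close> with \<open>x \<in> M\<^sup>j\<close>, \<open>1 \<le> j < n\<close>.  Multiplying \<open>v\<close> by an element of \<open>M\<close> moves the
  \<open>j\<close>-th term to the \<open>(j + 1)\<close>-st at the cost of a factor \<open>r\<close>, and the last term is pushed back to
  \<open>\<parallel>v\<parallel>\<close> by the choice of \<open>n\<close>.
\<close>

lemma contracting_norm_exists:
  assumes M: "M \<in> bounded_subsets A" and less: "joint_spectral_radius A M < r"
  obtains N where "equivalent_norm N" "\<And>m. m \<in> M \<Longrightarrow> contraction N r m"
proof -
  have r: "r > 0" using jsr_nonneg[OF M] less by simp
  have Mc: "M \<subseteq> carrier A" using M by (simp add: bounded_subsets_iff)
  obtain n where n: "n \<ge> 1" "\<And>x. x \<in> set_power A M n \<Longrightarrow> anorm A x \<le> r ^ n"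
    using jsr_less_power[OF M less] by blast
  define F where "F = insert (anorm A)
    {\<lambda>v. anorm A (x \<otimes> v) / r ^ j | j x. 1 \<le> j \<and> j < n \<and> x \<in> set_power A M j}"
  define C where "C = Max (insert 1 ((\<lambda>j. set_norm A (set_power A M j) / r ^ j) ` {1..<n}))"
  have C1: "1 \<le> C" unfolding C_def by (intro Max_ge) auto
  have carr: "x \<in> carrier A" if "x \<in> set_power A M j" for x j
    using that set_power_carrier[OF Mc] by blast
  have bound: "p v \<le> C * anorm A v" if p: "p \<in> F" and v: "v \<in> carrier A" for p v
    using p unfolding F_def
  proof (elim insertE CollectE exE conjE)
    assume "p = anorm A"
    then show ?thesis using C1 v mult_right_mono[of 1 C "anorm A v"] by simp
  next
    fix j x assume jx: "p = (\<lambda>v. anorm A (x \<otimes> v) / r ^ j)" "1 \<le> j" "j < n" "x \<in> set_power A M j"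
    have "anorm A (x \<otimes> v) \<le> set_norm A (set_power A M j) * anorm A v"
      using anorm_mult[OF carr[OF jx(4)] v] anorm_le_set_norm[OF bounded_set_power[OF M jx(2)] jx(4)] v
      by (meson anorm_nonneg mult_right_mono order_trans)
    then have "p v \<le> set_norm A (set_power A M j) / r ^ j * anorm A v"
      using r jx(1) by (simp add: field_simps)
    also have "\<dots> \<le> C * anorm A v"
      unfolding C_def using jx v by (intro mult_right_mono Max_ge) auto
    finally show ?thesis .
  qed
  have add: "p (u \<oplus> v) \<le> p u + p v" if "p \<in> F" "u \<in> carrier A" "v \<in> carrier A" for p u v
  proof -
    have "anorm A (x \<otimes> (u \<oplus> v)) / r ^ j \<le> anorm A (x \<otimes> u) / r ^ j + anorm A (x \<otimes> v) / r ^ j"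
      if "x \<in> carrier A" for x j
      using that \<open>u \<in> carrier A\<close> \<open>v \<in> carrier A\<close> r anorm_triangle[of "x \<otimes> u" "x \<otimes> v"]
      by (simp add: mult_add_right divide_right_mono flip: add_divide_distrib)
    then show ?thesis using that carr by (auto simp: F_def anorm_triangle)
  qed
  have smult: "p (c \<odot> v) = cmod c * p v" if "p \<in> F" "v \<in> carrier A" for p c v
    using that carr by (auto simp: F_def smult_mult_right anorm_smult)
  let ?N = "\<lambda>v. SUP p\<in>F. p v"
  have N: "equivalent_norm ?N"
    by (rule equivalent_norm_SUP[where C = C]) (use C1 bound add smult in \<open>auto simp: F_def\<close>)
  have upper: "p v \<le> ?N v" if "p \<in> F" "v \<in> carrier A" for p v
    by (rule equivalent_norm_SUP(2)[where C = C and F = F])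
      (use C1 bound add smult that in \<open>auto simp: F_def\<close>)
  have N_ge: "anorm A v \<le> ?N v" if "v \<in> carrier A" for v
    using upper[of "anorm A" v] that by (simp add: F_def)
  \<comment> \<open>For \<open>j < n\<close> this is a term of the supremum; for \<open>j = n\<close> it is the choice of \<open>n\<close>.\<close>
  have power: "anorm A (x \<otimes> v) \<le> r ^ j * ?N v"
    if j: "1 \<le> j" "j \<le> n" and x: "x \<in> set_power A M j" and v: "v \<in> carrier A" for j x v
  proof (cases "j < n")
    case True
    then have "(\<lambda>v. anorm A (x \<otimes> v) / r ^ j) \<in> F" using j x by (auto simp: F_def)
    from upper[OF this v] show ?thesis using r by (simp add: field_simps)
  next
    case False
    then have "anorm A x \<le> r ^ j" using j n x by simp
    then show ?thesis
      using anorm_mult[OF carr[OF x] v] N_ge[OF v] r v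
      by (meson anorm_nonneg less_imp_le mult_mono order_trans zero_le_power)
  qed
  have "?N (m \<otimes> v) \<le> r * ?N v" if m: "m \<in> M" and v: "v \<in> carrier A" for m v
  proof (rule cSUP_least)
    show "F \<noteq> {}" by (simp add: F_def)
    have mc: "m \<in> carrier A" using m Mc by blast
    fix p assume p: "p \<in> F"
    show "p (m \<otimes> v) \<le> r * ?N v"
      using p[unfolded F_def]
    proof (elim insertE CollectE exE conjE)
      assume "p = anorm A"
      then show ?thesis using power[of 1 m v] n(1) m v by simp
    next
      fix j x assume jx: "p = (\<lambda>v. anorm A (x \<otimes> v) / r ^ j)" "1 \<le> j" "j < n" "x \<in> set_power A M j"
      have "x \<otimes> m \<in> set_power A M (Suc j)"
        using jx m by (auto simp: set_power_Suc set_mult_iff simp del: set_power.simps(3))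
      from power[OF _ _ this v] jx(3) have "anorm A (x \<otimes> (m \<otimes> v)) \<le> r ^ Suc j * ?N v"
        using mc v carr[OF jx(4)] by (simp add: mult_assoc)
      then show ?thesis using r jx(1) by (simp add: field_simps)
    qed
  qed
  then have "contraction ?N r m" if "m \<in> M" for m
    using that Mc by (auto simp: contraction_def)
  with N show ?thesis by (rule that)
qed

lemma contraction_set_power:
  assumes N: "equivalent_norm N" and r: "0 \<le> r" and M: "\<And>m. m \<in> M \<Longrightarrow> contraction N r m"
    and n: "n \<ge> 1" and x: "x \<in> set_power A M n"
  shows "contraction N (r ^ n) x"
  using n x
proof (induction n arbitrary: x rule: dec_induct)
  case base
  then show ?case using M by simp
next
  case (step n)
  then obtain y m where "x = y \<otimes> m" "y \<in> set_power A M n" "m \<in> M"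
    by (auto simp: set_power_Suc set_mult_iff simp del: set_power.simps(3))
  then show ?case
    using contraction_mult[OF N, of "r ^ n" y r m] step.IH[of y] M r by (simp add: mult.commute)
qed

text \<open>
  Without a unit, \<open>N (x v) \<le> r\<^sup>n N v\<close> does not bound \<open>x\<close> itself, so the last factor of a product in
  \<open>M\<^sup>n\<close> is used as the vector \<open>v\<close>.
\<close>

lemma contraction_growth:
  assumes M: "M \<in> bounded_subsets A" and N: "equivalent_norm N" and r: "0 < r"
    and c: "\<And>m. m \<in> M \<Longrightarrow> contraction N r m"
  obtains D where "D > 0" "\<And>n x. n \<ge> 1 \<Longrightarrow> x \<in> set_power A M n \<Longrightarrow> anorm A x \<le> D * r ^ n"
proof -
  obtain K where K: "K > 0" "M \<subseteq> carrier A" "\<And>x. x \<in> M \<Longrightarrow> anorm A x \<le> K"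
    using M unfolding bounded_subsets_iff by blast
  obtain C where C: "C > 0" "\<And>v. v \<in> carrier A \<Longrightarrow> anorm A v \<le> N v"
    "\<And>v. v \<in> carrier A \<Longrightarrow> N v \<le> C * anorm A v" using equivalent_norm_bounds[OF N] by blast
  have NM: "N m \<le> C * K" if "m \<in> M" for m
    using C(1) C(3)[of m] K that by (meson mult_left_mono less_imp_le order_trans subsetD)
  define D where "D = C * K / r"
  have "anorm A x \<le> D * r ^ n" if n: "n \<ge> 1" and x: "x \<in> set_power A M n" for n x
  proof (cases "n = 1")
    case True
    then have "anorm A x \<le> C * K" using x K(2) C(2)[of x] NM[of x] by auto
    then show ?thesis using True r by (simp add: D_def)
  next
    case False
    then obtain k where k: "n = Suc k" "k \<ge> 1" using n by (cases n) auto
    then obtain y m where ym: "x = y \<otimes> m" "y \<in> set_power A M k" "m \<in> M"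
      using x by (auto simp: set_power_Suc set_mult_iff simp del: set_power.simps(3))
    have y: "contraction N (r ^ k) y" using contraction_set_power[OF N _ c k(2) ym(2)] r by simp
    have m: "m \<in> carrier A" using ym K by blast
    have "anorm A x \<le> N (y \<otimes> m)" using ym C(2) m contraction_carrier[OF y] by simp
    also have "\<dots> \<le> r ^ k * N m" using contractionD[OF y m] .
    also have "\<dots> \<le> r ^ k * (C * K)" using NM[OF ym(3)] r by (intro mult_left_mono) auto
    also have "\<dots> = D * r ^ n" using r k by (simp add: D_def)
    finally show ?thesis .
  qed
  moreover have "D > 0" using C K r by (simp add: D_def)
  ultimately show ?thesis using that by blast
qed

lemma jsr_le_contraction:
  assumes "M \<in> bounded_subsets A" "equivalent_norm N" "0 < r" "\<And>m. m \<in> M \<Longrightarrow> contraction N r m"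
  shows "joint_spectral_radius A M \<le> r"
proof -
  obtain D where "\<And>n x. n \<ge> 1 \<Longrightarrow> x \<in> set_power A M n \<Longrightarrow> anorm A x \<le> D * r ^ n"
    using contraction_growth[OF assms(1-3)] assms(4) by metis
  then show ?thesis by (rule jsr_le_of_growth[OF assms(1,3)])
qed

lemma jsr_growth:
  assumes M: "M \<in> bounded_subsets A" and less: "joint_spectral_radius A M < r"
  obtains D where "D > 0" "\<And>n x. n \<ge> 1 \<Longrightarrow> x \<in> set_power A M n \<Longrightarrow> anorm A x \<le> D * r ^ n"
proof -
  obtain N where "equivalent_norm N" "\<And>m. m \<in> M \<Longrightarrow> contraction N r m"
    using contracting_norm_exists[OF M less] by blast
  moreover have "0 < r" using jsr_nonneg[OF M] less by simp
  ultimately show ?thesis using contraction_growth[OF M, of N r] that by blast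
qed

text \<open>
  Choose \<open>r\<close> strictly between \<open>\<rho>(M)\<close> and 1; then \<open>\<parallel>M\<^sup>n\<parallel> \<le> D r\<^sup>n\<close> tends to 0.
\<close>

lemma jsr_small_power:
  assumes M: "M \<in> bounded_subsets A" and less: "joint_spectral_radius A M < 1" and e: "0 < e"
  obtains n0 where "\<And>n x. n \<ge> n0 \<Longrightarrow> n \<ge> 1 \<Longrightarrow> x \<in> set_power A M n \<Longrightarrow> anorm A x < e"
proof -
  obtain r where r: "joint_spectral_radius A M < r" "r < 1" using dense[OF less] by blast
  then have r0: "0 < r" using jsr_nonneg[OF M] by simp
  obtain D where D: "D > 0" "\<And>n x. n \<ge> 1 \<Longrightarrow> x \<in> set_power A M n \<Longrightarrow> anorm A x \<le> D * r ^ n"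
    using jsr_growth[OF M r(1)] by blast
  obtain n0 where n0: "r ^ n0 < e / D" using real_arch_pow_inv[of "e / D" r] e D r by auto
  have "anorm A x < e" if "n \<ge> n0" "n \<ge> 1" "x \<in> set_power A M n" for n x
  proof -
    have "anorm A x \<le> D * r ^ n" using D that by blast
    also have "\<dots> \<le> D * r ^ n0" using that r r0 D by (intro mult_left_mono power_decreasing) auto
    also have "\<dots> < e" using n0 D by (simp add: field_simps)
    finally show ?thesis .
  qed
  then show ?thesis using that by blast
qed

text \<open>
  Products of elements of \<open>M\<close> map \<open>B\<close> into itself.  As before, the last factor of a product, scaled
  into the ball of radius \<open>e\<close>, plays the role of the vector.  Since \<open>B\<close> is not required to be convex or balanced, it
  is easier to exhibit than a norm.
\<close>

lemma jsr_le_one_of_invariant: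
  assumes M: "M \<in> bounded_subsets A" and B: "B \<subseteq> carrier A" and e: "e > 0"
    and ball: "\<And>v. v \<in> carrier A \<Longrightarrow> anorm A v \<le> e \<Longrightarrow> v \<in> B"
    and bounded: "\<And>v. v \<in> B \<Longrightarrow> anorm A v \<le> L"
    and inv: "\<And>m v. m \<in> M \<Longrightarrow> v \<in> B \<Longrightarrow> m \<otimes> v \<in> B"
  shows "joint_spectral_radius A M \<le> 1"
proof -
  obtain K where K: "K > 0" "M \<subseteq> carrier A" "\<And>x. x \<in> M \<Longrightarrow> anorm A x \<le> K"
    using M unfolding bounded_subsets_iff by blast
  have inv': "x \<otimes> v \<in> B" if "n \<ge> 1" "x \<in> set_power A M n" "v \<in> B" for n x v
    using that
  proof (induction n arbitrary: x v rule: dec_induct)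
    case base
    then show ?case using inv by simp
  next
    case (step n)
    then obtain y m where ym: "x = y \<otimes> m" "y \<in> set_power A M n" "m \<in> M"
      by (auto simp: set_power_Suc set_mult_iff simp del: set_power.simps(3))
    then have "y \<otimes> (m \<otimes> v) \<in> B" using step.IH inv step.prems by blast
    then show ?case
      using ym set_power_carrier[OF K(2), of n] K(2) step.prems(2) B
      by (simp add: subset_iff mult_assoc)
  qed
  define D where "D = max K (L * K / e)"
  have "anorm A x \<le> D" if n: "n \<ge> 1" and x: "x \<in> set_power A M n" for n x
  proof (cases "n = 1")
    case True
    then show ?thesis using x K(3)[of x] by (simp add: D_def)
  next
    case False
    then obtain k where k: "n = Suc k" "k \<ge> 1" using n by (cases n) auto
    then obtain y m where ym: "x = y \<otimes> m" "y \<in> set_power A M k" "m \<in> M"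
      using x by (auto simp: set_power_Suc set_mult_iff simp del: set_power.simps(3))
    have c: "m \<in> carrier A" "y \<in> carrier A" using ym K set_power_carrier[OF K(2)] by auto
    let ?t = "complex_of_real (e / K)"
    have t: "cmod ?t = e / K" using e K(1) by (simp add: norm_divide)
    have "anorm A (?t \<odot> m) = e / K * anorm A m" using c t by (simp add: anorm_smult)
    also have "\<dots> \<le> e / K * K" using K(1) K(3)[OF ym(3)] e by (intro mult_left_mono) auto
    finally have "anorm A (?t \<odot> m) \<le> e" using K(1) by simp
    then have "y \<otimes> (?t \<odot> m) \<in> B" using ball c inv'[OF k(2) ym(2)] by simp
    then have "anorm A (?t \<odot> x) \<le> L" using bounded c ym by (simp add: smult_mult_right)
    then have "e / K * anorm A x \<le> L" using c ym t by (simp add: anorm_smult)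
    then have "anorm A x \<le> L * K / e" using e K(1) by (simp add: field_simps)
    then show ?thesis by (simp add: D_def)
  qed
  then show ?thesis using jsr_le_of_growth[OF M, of 1 D] by simp
qed

end

section \<open>Finite, precompact and bounded sets\<close>

text \<open>
  The three radicals differ only in their test sets.  Indexing the classes by a datatype, rather than
  passing a class of sets as an argument, lets one lemma speak about an algebra and about its
  quotients, which live over different types.
\<close>

datatype smallness = Finite | Precompact | Bounded

fun small_sets :: "smallness \<Rightarrow> 'a nalg \<Rightarrow> 'a set set" where
  "small_sets Finite = finite_subsets"
| "small_sets Precompact = precompact_subsets"
| "small_sets Bounded = bounded_subsets"

definition small_radical :: "smallness \<Rightarrow> 'a nalg \<Rightarrow> 'a set" where
  "small_radical k = jsr_radical (small_sets k)"

context nalg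
begin

lemma precompact_iff:
  "M \<in> precompact_subsets A \<longleftrightarrow> M \<noteq> {} \<and> M \<subseteq> carrier A \<and>
     (\<forall>e>0. \<exists>F. finite F \<and> F \<subseteq> M \<and> (\<forall>x\<in>M. \<exists>y\<in>F. anorm A (x \<ominus> y) < e))"
proof -
  have "M \<subseteq> (\<Union>y\<in>F. Met.mball y e) \<longleftrightarrow> (\<forall>x\<in>M. \<exists>y\<in>F. anorm A (x \<ominus> y) < e)"
    if "M \<subseteq> carrier A" "F \<subseteq> M" for F e
  proof -
    have "x \<in> Met.mball y e \<longleftrightarrow> anorm A (x \<ominus> y) < e" if "x \<in> M" "y \<in> F" for x y
      using that \<open>M \<subseteq> carrier A\<close> \<open>F \<subseteq> M\<close> anorm_diff_commute[of x y]
      by (auto simp: adist_def subset_iff)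
    then show ?thesis unfolding subset_iff UN_iff by blast
  qed
  then show ?thesis
    unfolding precompact_subsets_def Met.mtotally_bounded_def by (simp cong: conj_cong)
qed

text \<open>
  Centres outside the set can be moved into it at the price of doubling the radius.
\<close>

lemma precompactI:
  assumes ne: "M \<noteq> {}" and sub: "M \<subseteq> carrier A"
    and net: "\<And>e. e > 0 \<Longrightarrow> \<exists>F. finite F \<and> F \<subseteq> carrier A \<and> (\<forall>x\<in>M. \<exists>y\<in>F. anorm A (x \<ominus> y) < e)"
  shows "M \<in> precompact_subsets A"
  unfolding precompact_iff
proof (intro conjI allI impI ne sub)
  fix e :: real assume "e > 0"
  then obtain F where F: "finite F" "F \<subseteq> carrier A" "\<forall>x\<in>M. \<exists>y\<in>F. anorm A (x \<ominus> y) < e / 2"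
    using net[of "e / 2"] by auto
  define g where "g y = (SOME x. x \<in> M \<and> anorm A (x \<ominus> y) < e / 2)" for y
  let ?F' = "{y \<in> F. \<exists>x\<in>M. anorm A (x \<ominus> y) < e / 2}"
  have g: "g y \<in> M \<and> anorm A (g y \<ominus> y) < e / 2" if "y \<in> ?F'" for y
  proof -
    have "\<exists>x. x \<in> M \<and> anorm A (x \<ominus> y) < e / 2" using that by blast
    then show ?thesis unfolding g_def by (rule someI_ex)
  qed
  have "\<exists>z\<in>g ` ?F'. anorm A (x \<ominus> z) < e" if x: "x \<in> M" for x
  proof -
    obtain y where y: "y \<in> F" "anorm A (x \<ominus> y) < e / 2" using F(3) x by blast
    then have y': "y \<in> ?F'" using x by blast
    have "anorm A (x \<ominus> g y) \<le> anorm A (x \<ominus> y) + anorm A (y \<ominus> g y)"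
      using x y(1) g[OF y'] sub F(2) by (intro anorm_diff_triangle) auto
    moreover have "anorm A (y \<ominus> g y) < e / 2"
      using g[OF y'] y(1) sub F(2) anorm_diff_commute[of y "g y"] by (auto simp: subset_iff)
    ultimately show ?thesis using y' y(2) by force
  qed
  then show "\<exists>F. finite F \<and> F \<subseteq> M \<and> (\<forall>x\<in>M. \<exists>y\<in>F. anorm A (x \<ominus> y) < e)"
    using F(1) g by (intro exI[of _ "g ` ?F'"]) auto
qed

lemma small_bounded: "M \<in> small_sets k A \<Longrightarrow> M \<in> bounded_subsets A"
proof (cases k)
  case Finite
  moreover assume "M \<in> small_sets k A"
  ultimately have "finite M" "M \<noteq> {}" "M \<subseteq> carrier A" by (auto simp: finite_subsets_def)
  moreover from this have "\<forall>x\<in>M. anorm A x \<le> \<bar>Max (anorm A ` M)\<bar> + 1"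
    by (smt (verit) Max_ge finite_imageI imageI)
  moreover have "\<bar>Max (anorm A ` M)\<bar> + 1 > 0" by simp
  ultimately show ?thesis unfolding bounded_subsets_iff by blast
next
  case Precompact
  moreover assume "M \<in> small_sets k A"
  ultimately show ?thesis
    using Met.mtotally_bounded_imp_mbounded
    by (auto simp: precompact_subsets_def bounded_subsets_def)
qed simp

lemma small_nonempty: "M \<in> small_sets k A \<Longrightarrow> M \<noteq> {}"
  and small_carrier: "M \<in> small_sets k A \<Longrightarrow> M \<subseteq> carrier A"
  using small_bounded[of M k] by (auto simp: bounded_subsets_iff)

lemma finite_small: "finite M \<Longrightarrow> M \<noteq> {} \<Longrightarrow> M \<subseteq> carrier A \<Longrightarrow> M \<in> small_sets k A"
  by (cases k) (auto simp: finite_subsets_def precompact_subsets_def bounded_subsets_def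
      Met.finite_imp_mtotally_bounded Met.mtotally_bounded_imp_mbounded)

lemma small_subset: "M \<in> small_sets k A \<Longrightarrow> N \<subseteq> M \<Longrightarrow> N \<noteq> {} \<Longrightarrow> N \<in> small_sets k A"
  by (cases k) (auto simp: finite_subsets_def precompact_subsets_def bounded_subsets_def
      intro: finite_subset Met.mtotally_bounded_subset Met.mbounded_subset)

lemma small_Un: "M \<in> small_sets k A \<Longrightarrow> N \<in> small_sets k A \<Longrightarrow> M \<union> N \<in> small_sets k A"
  by (cases k) (auto simp: finite_subsets_def precompact_subsets_def bounded_subsets_def
      Met.mtotally_bounded_Un Met.mbounded_Un)

lemma small_insert: "M \<in> small_sets k A \<Longrightarrow> a \<in> carrier A \<Longrightarrow> insert a M \<in> small_sets k A"
  using small_Un[of "{a}" k M] finite_small[of "{a}" k] by simp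

text \<open>
  These nets are what the proof of \<open>R(A/R(A)) = 0\<close> consumes; a bounded set has none in general, and this is
  where that proof breaks down for \<open>R\<^sub>b\<close>.
\<close>

lemma small_net:
  assumes "M \<in> small_sets k A" "k \<noteq> Bounded" "e > 0"
  obtains F where "finite F" "F \<subseteq> M" "\<And>x. x \<in> M \<Longrightarrow> \<exists>y\<in>F. anorm A (x \<ominus> y) < e"
proof -
  have "M \<in> precompact_subsets A"
  proof (cases k)
    case Finite
    then show ?thesis
      using assms finite_small[of M Precompact] by (auto simp: finite_subsets_def)
  qed (use assms in auto)
  then show ?thesis using that assms(3) unfolding precompact_iff by meson
qed

end

text \<open>
  Images under maps of two variables that are jointly Lipschitz cover products, differences, scalar
  multiples and homomorphic images at one stroke.
\<close>

lemma small_image2: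
  assumes A: "nalg A" and B: "nalg B"
    and M: "M \<in> small_sets k A" and N: "N \<in> small_sets k A"
    and f: "\<And>x y. x \<in> M \<Longrightarrow> y \<in> N \<Longrightarrow> f x y \<in> carrier B"
    and c: "c > 0"
    and lip: "\<And>x y x' y'. \<lbrakk>x \<in> M; x' \<in> M; y \<in> N; y' \<in> N\<rbrakk> \<Longrightarrow>
      anorm B (f x y \<ominus>\<^bsub>B\<^esub> f x' y') \<le> c * (anorm A (x \<ominus>\<^bsub>A\<^esub> x') + anorm A (y \<ominus>\<^bsub>A\<^esub> y'))"
  shows "{f x y | x y. x \<in> M \<and> y \<in> N} \<in> small_sets k B"
proof -
  interpret A: nalg A by (rule A)
  interpret B: nalg B by (rule B)
  let ?I = "{f x y | x y. x \<in> M \<and> y \<in> N}"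
  have ne: "?I \<noteq> {}" using A.small_nonempty[OF M] A.small_nonempty[OF N] by blast
  have sub: "?I \<subseteq> carrier B" using f by blast
  show ?thesis
  proof (cases k)
    case Finite
    then have "finite M" "finite N" using M N by (auto simp: finite_subsets_def)
    then have "finite ((\<lambda>(x, y). f x y) ` (M \<times> N))" by blast
    also have "(\<lambda>(x, y). f x y) ` (M \<times> N) = ?I" by auto
    finally show ?thesis using ne sub by (intro B.finite_small)
  next
    case Precompact
    have "\<exists>F. finite F \<and> F \<subseteq> carrier B \<and> (\<forall>z\<in>?I. \<exists>y\<in>F. anorm B (z \<ominus>\<^bsub>B\<^esub> y) < e)"
      if e: "e > 0" for e
    proof -
      let ?d = "e / (2 * c)"
      have d: "?d > 0" using e c by simp
      obtain F where F: "finite F" "F \<subseteq> M" "\<And>x. x \<in> M \<Longrightarrow> \<exists>y\<in>F. anorm A (x \<ominus>\<^bsub>A\<^esub> y) < ?d"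
        using A.small_net[OF M _ d] Precompact by blast
      obtain G where G: "finite G" "G \<subseteq> N" "\<And>x. x \<in> N \<Longrightarrow> \<exists>y\<in>G. anorm A (x \<ominus>\<^bsub>A\<^esub> y) < ?d"
        using A.small_net[OF N _ d] Precompact by blast
      let ?H = "(\<lambda>(x, y). f x y) ` (F \<times> G)"
      have "\<exists>w\<in>?H. anorm B (z \<ominus>\<^bsub>B\<^esub> w) < e" if z: "z \<in> ?I" for z
      proof -
        obtain x y where xy: "z = f x y" "x \<in> M" "y \<in> N" using z by blast
        obtain x' y' where xy': "x' \<in> F" "anorm A (x \<ominus>\<^bsub>A\<^esub> x') < ?d"
          "y' \<in> G" "anorm A (y \<ominus>\<^bsub>A\<^esub> y') < ?d" using F(3) G(3) xy by blast
        have "anorm B (z \<ominus>\<^bsub>B\<^esub> f x' y') \<le> c * (anorm A (x \<ominus>\<^bsub>A\<^esub> x') + anorm A (y \<ominus>\<^bsub>A\<^esub> y'))"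
          unfolding xy(1) using xy xy' F G by (intro lip) auto
        also have "\<dots> < c * (?d + ?d)"
          using xy' c by (intro mult_strict_left_mono add_strict_mono)
        also have "\<dots> = e" using c by simp
        finally show ?thesis using xy' by force
      qed
      moreover have "finite ?H" using F(1) G(1) by blast
      moreover have "?H \<subseteq> carrier B"
      proof clarify
        fix x y assume "x \<in> F" "y \<in> G"
        with F(2) G(2) show "f x y \<in> carrier B" by (intro f) blast+
      qed
      ultimately show ?thesis by (intro exI[of _ ?H] conjI ballI)
    qed
    then show ?thesis using Precompact B.precompactI[OF ne sub] by simp
  next
    case Bounded
    obtain K L where K: "K > 0" "\<And>x. x \<in> M \<Longrightarrow> anorm A x \<le> K" and L: "L > 0" "\<And>x. x \<in> N \<Longrightarrow> anorm A x \<le> L"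
      using A.small_bounded[OF M] A.small_bounded[OF N] unfolding A.bounded_subsets_iff by blast
    obtain x0 y0 where xy0: "x0 \<in> M" "y0 \<in> N"
      using A.small_nonempty[OF M] A.small_nonempty[OF N] by blast
    let ?K = "c * ((K + K) + (L + L)) + anorm B (f x0 y0)"
    have "anorm B z \<le> ?K" if z: "z \<in> ?I" for z
    proof -
      obtain x y where xy: "z = f x y" "x \<in> M" "y \<in> N" using z by blast
      have carr: "x \<in> carrier A" "x0 \<in> carrier A" "y \<in> carrier A" "y0 \<in> carrier A"
        using xy xy0 A.small_carrier[OF M] A.small_carrier[OF N] by auto
      have "anorm B z \<le> anorm B (f x y \<ominus>\<^bsub>B\<^esub> f x0 y0) + anorm B (f x0 y0)"
        unfolding xy(1) using f xy xy0 by (intro B.anorm_le_diff) auto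
      moreover have "anorm A (x \<ominus>\<^bsub>A\<^esub> x0) \<le> K + K" "anorm A (y \<ominus>\<^bsub>A\<^esub> y0) \<le> L + L"
        using A.anorm_diff_le[OF carr(1,2)] A.anorm_diff_le[OF carr(3,4)] K(2) L(2) xy xy0
        by (meson add_mono order_trans)+
      then have "c * (anorm A (x \<ominus>\<^bsub>A\<^esub> x0) + anorm A (y \<ominus>\<^bsub>A\<^esub> y0)) \<le> c * ((K + K) + (L + L))"
        using c by (intro mult_left_mono add_mono) auto
      moreover have "anorm B (f x y \<ominus>\<^bsub>B\<^esub> f x0 y0) \<le> c * (anorm A (x \<ominus>\<^bsub>A\<^esub> x0) + anorm A (y \<ominus>\<^bsub>A\<^esub> y0))"
        using xy xy0 by (intro lip) auto
      ultimately show ?thesis by linarith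
    qed
    moreover have "?K > 0"
      using c K(1) L(1) B.anorm_nonneg[OF f[OF xy0]] by (intro add_pos_nonneg mult_pos_pos) auto
    ultimately show ?thesis using Bounded ne sub by (auto simp: B.bounded_subsets_iff)
  qed
qed

lemma small_image:
  assumes A: "nalg A" and B: "nalg B" and M: "M \<in> small_sets k A"
    and f: "\<And>x. x \<in> M \<Longrightarrow> f x \<in> carrier B" and c: "c > 0"
    and lip: "\<And>x x'. x \<in> M \<Longrightarrow> x' \<in> M \<Longrightarrow> anorm B (f x \<ominus>\<^bsub>B\<^esub> f x') \<le> c * anorm A (x \<ominus>\<^bsub>A\<^esub> x')"
  shows "f ` M \<in> small_sets k B"
proof -
  interpret A: nalg A by (rule A)
  have "{f x | x y. x \<in> M \<and> y \<in> M} \<in> small_sets k B"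
  proof (rule small_image2[OF A B M M _ c])
    fix x y x' y' assume xy: "x \<in> M" "x' \<in> M" "y \<in> M" "y' \<in> M"
    have "c * anorm A (x \<ominus>\<^bsub>A\<^esub> x') \<le> c * (anorm A (x \<ominus>\<^bsub>A\<^esub> x') + anorm A (y \<ominus>\<^bsub>A\<^esub> y'))"
      using c xy A.small_carrier[OF M] A.anorm_nonneg[of "y \<ominus>\<^bsub>A\<^esub> y'"]
      by (intro mult_left_mono) (auto simp: subset_iff)
    then show "anorm B (f x \<ominus>\<^bsub>B\<^esub> f x') \<le> c * (anorm A (x \<ominus>\<^bsub>A\<^esub> x') + anorm A (y \<ominus>\<^bsub>A\<^esub> y'))"
      using lip[OF xy(1,2)] by linarith
  qed (rule f)
  moreover have "{f x | x y. x \<in> M \<and> y \<in> M} = f ` M" by auto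
  ultimately show ?thesis by simp
qed

context nalg
begin

lemma small_set_mult:
  assumes M: "M \<in> small_sets k A" and N: "N \<in> small_sets k A"
  shows "M <#> N \<in> small_sets k A"
proof -
  obtain K L where K: "K > 0" "\<And>x. x \<in> M \<Longrightarrow> anorm A x \<le> K" and L: "L > 0" "\<And>x. x \<in> N \<Longrightarrow> anorm A x \<le> L"
    using small_bounded[OF M] small_bounded[OF N] unfolding bounded_subsets_iff by blast
  have "{x \<otimes> y | x y. x \<in> M \<and> y \<in> N} \<in> small_sets k A"
  proof (rule small_image2[OF nalg_axioms nalg_axioms M N, where c = "K + L"])
    fix x y x' y' assume xy: "x \<in> M" "x' \<in> M" "y \<in> N" "y' \<in> N"
    then have c: "x \<in> carrier A" "x' \<in> carrier A" "y \<in> carrier A" "y' \<in> carrier A"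
      using small_carrier[OF M] small_carrier[OF N] by auto
    have "x \<otimes> y \<ominus> x' \<otimes> y' = (x \<ominus> x') \<otimes> y \<oplus> x' \<otimes> (y \<ominus> y')"
      using c by (simp add: diff_mult mult_diff diff_diff_add)
    then have "anorm A (x \<otimes> y \<ominus> x' \<otimes> y') \<le> anorm A ((x \<ominus> x') \<otimes> y) + anorm A (x' \<otimes> (y \<ominus> y'))"
      using c anorm_triangle by simp
    also have "anorm A ((x \<ominus> x') \<otimes> y) \<le> anorm A (x \<ominus> x') * L"
      using c L(2)[OF xy(3)] anorm_mult[of "x \<ominus> x'" y]
      by (meson anorm_nonneg minus_closed mult_left_mono order_trans)
    also have "anorm A (x' \<otimes> (y \<ominus> y')) \<le> K * anorm A (y \<ominus> y')"
      using c K(2)[OF xy(2)] anorm_mult[of x' "y \<ominus> y'"]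
      by (meson anorm_nonneg minus_closed mult_right_mono order_trans)
    also have "anorm A (x \<ominus> x') * L + K * anorm A (y \<ominus> y')
        \<le> (K + L) * (anorm A (x \<ominus> x') + anorm A (y \<ominus> y'))"
      using c K(1) L(1) by (simp add: algebra_simps)
    finally show "anorm A (x \<otimes> y \<ominus> x' \<otimes> y') \<le> (K + L) * (anorm A (x \<ominus> x') + anorm A (y \<ominus> y'))"
      by simp
  qed (use K L small_carrier[OF M] small_carrier[OF N] in auto)
  moreover have "{x \<otimes> y | x y. x \<in> M \<and> y \<in> N} = M <#> N" by (auto simp: set_mult_def)
  ultimately show ?thesis by simp
qed

lemma small_set_power: 
  assumes M: "M \<in> small_sets k A" and n: "n \<ge> 1"
  shows "set_power A M n \<in> small_sets k A"
  using n
proof (induction n rule: dec_induct)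
  case (step n)
  then show ?case by (simp add: set_power_Suc small_set_mult M del: set_power.simps(3))
qed (simp add: M)

lemma small_smult: "M \<in> small_sets k A \<Longrightarrow> (\<lambda>x. c \<odot> x) ` M \<in> small_sets k A"
  using small_carrier
  by (rule_tac c = "cmod c + 1" in small_image[OF nalg_axioms nalg_axioms])
     (auto simp: subset_iff anorm_smult mult_right_mono add_nonneg_pos simp flip: smult_diff)

lemma small_diff:
  assumes M: "M \<in> small_sets k A" and N: "N \<in> small_sets k A"
  shows "{x \<ominus> y | x y. x \<in> M \<and> y \<in> N} \<in> small_sets k A"
proof (rule small_image2[OF nalg_axioms nalg_axioms M N, where c = 1])
  fix x y x' y' assume "x \<in> M" "x' \<in> M" "y \<in> N" "y' \<in> N"
  then have c: "x \<in> carrier A" "x' \<in> carrier A" "y \<in> carrier A" "y' \<in> carrier A"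
    using small_carrier[OF M] small_carrier[OF N] by auto
  show "anorm A ((x \<ominus> y) \<ominus> (x' \<ominus> y')) \<le> 1 * (anorm A (x \<ominus> x') + anorm A (y \<ominus> y'))"
    using c anorm_diff_le[of "x \<ominus> x'" "y \<ominus> y'"] by (simp add: diff_diff_swap)
qed (use small_carrier[OF M] small_carrier[OF N] in auto)

lemma small_UN_powers:
  assumes M: "M \<in> small_sets k A" and n: "1 < n"
  shows "(\<Union>j\<in>{1..<n}. set_power A M j) \<in> small_sets k A"
proof -
  have "(\<Union>j\<in>{1..<Suc m}. set_power A M j) \<in> small_sets k A" if "m \<ge> 1" for m
    using that
  proof (induction m rule: dec_induct)
    case base
    then show ?case using M by simp
  next
    case (step m)
    have "{1..<Suc (Suc m)} = insert (Suc m) {1..<Suc m}" using step by auto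
    then show ?case using step small_Un small_set_power[OF M, of "Suc m"] by simp
  qed
  from this[of "n - 1"] n show ?thesis by simp
qed

text \<open>
  The powers of \<open>M\<close> shrink to 0, so that a net for finitely many of them, together with the point 0,
  is a net for the whole semigroup generated by \<open>M\<close>.  Finite sets are excluded because the semigroup is
  usually infinite; this is what confines heredity to the two larger classes.
\<close>

lemma small_semigroup:
  assumes M: "M \<in> small_sets k A" and k: "k \<noteq> Finite" and less: "joint_spectral_radius A M < 1"
  shows "(\<Union>n\<in>{1..}. set_power A M n) \<in> small_sets k A"
proof -
  let ?S = "\<Union>n\<in>{1..}. set_power A M n"
  have Mb: "M \<in> bounded_subsets A" by (rule small_bounded[OF M])
  have ne: "?S \<noteq> {}" using small_nonempty[OF M] by force
  have sub: "?S \<subseteq> carrier A" using set_power_carrier[OF small_carrier[OF M]] by blast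
  have initial: "\<exists>m. 1 < m \<and> (\<forall>x\<in>?S. x \<in> (\<Union>j\<in>{1..<m}. set_power A M j) \<or> anorm A x < e)"
    if e: "e > 0" for e
  proof -
    obtain n0 where n0: "\<And>n x. n \<ge> n0 \<Longrightarrow> n \<ge> 1 \<Longrightarrow> x \<in> set_power A M n \<Longrightarrow> anorm A x < e"
      using jsr_small_power[OF Mb less e] by blast
    have "x \<in> (\<Union>j\<in>{1..<n0 + 2}. set_power A M j) \<or> anorm A x < e" if x: "x \<in> ?S" for x
    proof -
      obtain n where n: "n \<ge> 1" "x \<in> set_power A M n" using x by auto
      show ?thesis using n n0[of n x] by (cases "n < n0 + 2") auto
    qed
    then show ?thesis by (intro exI[of _ "n0 + 2"]) auto
  qed
  show ?thesis
  proof (cases k)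
    case Precompact
    have "\<exists>F. finite F \<and> F \<subseteq> carrier A \<and> (\<forall>x\<in>?S. \<exists>y\<in>F. anorm A (x \<ominus> y) < e)" if e: "e > 0" for e
    proof -
      obtain m where m: "1 < m" "\<And>x. x \<in> ?S \<Longrightarrow> x \<in> (\<Union>j\<in>{1..<m}. set_power A M j) \<or> anorm A x < e"
        using initial[OF e] by blast
      obtain F where F: "finite F" "F \<subseteq> (\<Union>j\<in>{1..<m}. set_power A M j)"
        "\<And>x. x \<in> (\<Union>j\<in>{1..<m}. set_power A M j) \<Longrightarrow> \<exists>y\<in>F. anorm A (x \<ominus> y) < e"
        using small_net[OF small_UN_powers[OF M m(1)] _ e] Precompact by blast
      have "\<exists>y\<in>insert \<zero> F. anorm A (x \<ominus> y) < e" if x: "x \<in> ?S" for x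
        using m(2)[OF x] F(3)[of x] x sub by auto
      moreover have "insert \<zero> F \<subseteq> carrier A" "finite (insert \<zero> F)"
        using F small_carrier[OF small_UN_powers[OF M m(1)]] by auto
      ultimately show ?thesis by blast
    qed
    then show ?thesis using Precompact precompactI[OF ne sub] by simp
  next
    case Bounded
    obtain m where m: "1 < m" "\<And>x. x \<in> ?S \<Longrightarrow> x \<in> (\<Union>j\<in>{1..<m}. set_power A M j) \<or> anorm A x < 1"
      using initial[of 1] by auto
    obtain K where K: "K > 0" "\<And>x. x \<in> (\<Union>j\<in>{1..<m}. set_power A M j) \<Longrightarrow> anorm A x \<le> K"
      using small_bounded[OF small_UN_powers[OF M m(1)]] unfolding bounded_subsets_iff by blast
    have "anorm A x \<le> K + 1" if "x \<in> ?S" for x using m(2)[OF that] K(1) K(2)[of x] by linarith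
    then have "?S \<in> bounded_subsets A"
      unfolding bounded_subsets_iff using ne sub K(1) by (intro conjI exI[of _ "K + 1"]) auto
    then show ?thesis using Bounded by simp
  qed (use k in simp)
qed

section \<open>Comparing joint spectral radii\<close>

lemma contraction_zero: "equivalent_norm N \<Longrightarrow> 0 \<le> r \<Longrightarrow> contraction N r \<zero>"
  using equivalent_norm_smult[of N \<zero> 0] equivalent_norm_nonneg[of N]
  by (auto simp: contraction_def)

lemma jsr_le_one_of_contractions:
  "M \<in> bounded_subsets A \<Longrightarrow> equivalent_norm N \<Longrightarrow> (\<And>m. m \<in> M \<Longrightarrow> contraction N 1 m) \<Longrightarrow>
    joint_spectral_radius A M \<le> 1"
  by (rule jsr_le_contraction) auto

text \<open>
  Comparisons of joint spectral radii reduce to comparisons of contractions, by letting \<open>r\<close> decrease to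
  \<open>\<rho>(M)\<close>.
\<close>

lemma jsr_le_transfer:
  assumes M: "M \<in> bounded_subsets A" and L: "L \<in> bounded_subsets A"
    and imp: "\<And>N r. equivalent_norm N \<Longrightarrow> 0 < r \<Longrightarrow> (\<And>m. m \<in> M \<Longrightarrow> contraction N r m) \<Longrightarrow>
      \<forall>m\<in>L. contraction N r m"
  shows "joint_spectral_radius A L \<le> joint_spectral_radius A M"
proof (rule dense_ge)
  fix r assume r: "joint_spectral_radius A M < r"
  then have r0: "0 < r" using jsr_nonneg[OF M] by simp
  obtain N where N: "equivalent_norm N" "\<And>m. m \<in> M \<Longrightarrow> contraction N r m"
    using contracting_norm_exists[OF M r] by blast
  show "joint_spectral_radius A L \<le> r"
    using imp[OF N(1) r0 N(2)] by (intro jsr_le_contraction[OF L N(1) r0]) auto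
qed

lemma jsr_mono:
  assumes "M \<in> bounded_subsets A" "L \<in> bounded_subsets A" "L \<subseteq> M"
  shows "joint_spectral_radius A L \<le> joint_spectral_radius A M"
  by (rule jsr_le_transfer) (use assms in auto)

lemma bounded_smult: "M \<in> bounded_subsets A \<Longrightarrow> (\<lambda>x. c \<odot> x) ` M \<in> bounded_subsets A"
  using small_smult[of M Bounded c] by simp

lemma bounded_insert: "M \<in> bounded_subsets A \<Longrightarrow> a \<in> carrier A \<Longrightarrow> insert a M \<in> bounded_subsets A"
  using small_insert[of M Bounded a] by simp

lemma jsr_smult_le:
  assumes M: "M \<in> bounded_subsets A" and c: "c \<noteq> 0"
  shows "joint_spectral_radius A ((\<lambda>x. c \<odot> x) ` M) \<le> cmod c * joint_spectral_radius A M"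
proof -
  have "joint_spectral_radius A ((\<lambda>x. c \<odot> x) ` M) / cmod c \<le> joint_spectral_radius A M"
  proof (rule dense_ge)
    fix r assume r: "joint_spectral_radius A M < r"
    then have r0: "0 < r" using jsr_nonneg[OF M] by simp
    obtain N where N: "equivalent_norm N" "\<And>m. m \<in> M \<Longrightarrow> contraction N r m"
      using contracting_norm_exists[OF M r] by blast
    have "joint_spectral_radius A ((\<lambda>x. c \<odot> x) ` M) \<le> cmod c * r"
      by (rule jsr_le_contraction[OF bounded_smult[OF M] N(1)])
        (use c r0 N contraction_smult in auto)
    then show "joint_spectral_radius A ((\<lambda>x. c \<odot> x) ` M) / cmod c \<le> r"
      using c by (simp add: field_simps)
  qed
  then show ?thesis using c by (simp add: field_simps)
qed

lemma smult_image_inverse: "M \<subseteq> carrier A \<Longrightarrow> c \<noteq> 0 \<Longrightarrow>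
    (\<lambda>x. inverse c \<odot> x) ` (\<lambda>x. c \<odot> x) ` M = M"
  by (force simp: image_image smult_smult smult_1 subset_iff image_iff)

lemma jsr_smult:
  assumes M: "M \<in> bounded_subsets A" and c: "c \<noteq> 0"
  shows "joint_spectral_radius A ((\<lambda>x. c \<odot> x) ` M) = cmod c * joint_spectral_radius A M"
proof (rule antisym)
  have "joint_spectral_radius A M \<le> cmod (inverse c) * joint_spectral_radius A ((\<lambda>x. c \<odot> x) ` M)"
    using jsr_smult_le[OF bounded_smult[OF M], of "inverse c" c] c smult_image_inverse[of M c] M
    by (simp add: bounded_subsets_iff)
  then show "cmod c * joint_spectral_radius A M \<le> joint_spectral_radius A ((\<lambda>x. c \<odot> x) ` M)"
    using c by (simp add: norm_inverse norm_divide field_simps)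
qed (rule jsr_smult_le[OF M c])

lemma jsr_less_one_of_norm:
  assumes M: "M \<in> bounded_subsets A" and r: "r < 1" and le: "\<And>x. x \<in> M \<Longrightarrow> anorm A x \<le> r"
  shows "joint_spectral_radius A M < 1"
proof -
  have "joint_spectral_radius A M \<le> max r (1 / 2)"
    using M le by (intro jsr_le_contraction[OF M equivalent_norm_anorm] contraction_anorm)
      (auto simp: bounded_subsets_iff intro: max.coboundedI1)
  then show ?thesis using r by simp
qed

text \<open>
  Upper semicontinuity of \<open>\<rho>\<close>: a norm that \<open>M\<close> contracts by a factor \<open>r < 1\<close> is contracted by the same
  factor by every element of small norm.
\<close>

lemma jsr_add_small:
  assumes M: "M \<in> bounded_subsets A" and less: "joint_spectral_radius A M < 1"
  obtains e where "e > 0" "\<And>D. D \<in> bounded_subsets A \<Longrightarrow> (\<And>x. x \<in> D \<Longrightarrow> anorm A x \<le> e) \<Longrightarrow>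
    joint_spectral_radius A (D \<union> M) < 1"
proof -
  obtain r where r: "joint_spectral_radius A M < r" "r < 1" using dense[OF less] by blast
  then have r0: "0 < r" using jsr_nonneg[OF M] by simp
  obtain N where N: "equivalent_norm N" "\<And>m. m \<in> M \<Longrightarrow> contraction N r m"
    using contracting_norm_exists[OF M r(1)] by blast
  obtain e where e: "e > 0" "\<And>x. x \<in> carrier A \<Longrightarrow> anorm A x \<le> e \<Longrightarrow> contraction N r x"
    using small_contraction[OF N(1) r0] by blast
  have "joint_spectral_radius A (D \<union> M) < 1"
    if D: "D \<in> bounded_subsets A" and small: "\<And>x. x \<in> D \<Longrightarrow> anorm A x \<le> e" for D
  proof -
    have "D \<union> M \<in> bounded_subsets A" using small_Un[of D Bounded M] D M by simp
    then have "joint_spectral_radius A (D \<union> M) \<le> r"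
      using e(2) small D N by (intro jsr_le_contraction[OF _ N(1) r0]) (auto simp: bounded_subsets_iff)
    then show ?thesis using r by simp
  qed
  with e(1) show ?thesis by (rule that)
qed

text \<open>
  If \<open>M\<^sup>n\<close> contracts \<open>N\<close>, the set of \<open>v\<close> with \<open>N v \<le> 1\<close> and \<open>N (x v) \<le> 1\<close> for \<open>x \<in> M\<^sup>j\<close>, \<open>j < n\<close>, is
  invariant under \<open>M\<close>.  It is invariant under \<open>b\<close> as well if \<open>b\<close>, alone and behind any of these \<open>x\<close>, contracts
  \<open>N\<close>.
\<close>

lemma jsr_le_one_of_power:
  assumes M: "M \<in> bounded_subsets A" and b: "contraction N 1 b" and N: "equivalent_norm N" and n: "n \<ge> 1"
    and top: "\<And>x. x \<in> set_power A M n \<Longrightarrow> contraction N 1 x"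
    and low: "\<And>j x. 1 \<le> j \<Longrightarrow> j < n \<Longrightarrow> x \<in> set_power A M j \<Longrightarrow> contraction N 1 (x \<otimes> b)"
  shows "joint_spectral_radius A (insert b M) \<le> 1"
proof -
  have Mc: "M \<subseteq> carrier A" using M by (simp add: bounded_subsets_iff)
  have bc: "b \<in> carrier A" using b by (rule contraction_carrier)
  have Pc: "x \<in> carrier A" if "x \<in> set_power A M j" for j x
    using that set_power_carrier[OF Mc] by blast
  obtain C where C: "C > 0" "\<And>v. v \<in> carrier A \<Longrightarrow> anorm A v \<le> N v"
    "\<And>v. v \<in> carrier A \<Longrightarrow> N v \<le> C * anorm A v" using equivalent_norm_bounds[OF N] by blast
  obtain K where K: "K \<ge> 1" "\<And>j x. 1 \<le> j \<Longrightarrow> j < n \<Longrightarrow> x \<in> set_power A M j \<Longrightarrow> anorm A x \<le> K"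
  proof (cases "1 < n")
    case True
    have "(\<Union>j\<in>{1..<n}. set_power A M j) \<in> bounded_subsets A"
      using small_UN_powers[of M Bounded, OF _ True] M by simp
    then obtain K where K: "\<And>x. x \<in> (\<Union>j\<in>{1..<n}. set_power A M j) \<Longrightarrow> anorm A x \<le> K"
      unfolding bounded_subsets_iff by blast
    have "anorm A x \<le> max 1 K" if "1 \<le> j" "j < n" "x \<in> set_power A M j" for j x
      using K[OF UN_I[of j]] that by (auto simp: le_max_iff_disj)
    then show ?thesis using that[of "max 1 K"] by auto
  qed (use that[of 1] n in auto)
  define B where "B = {v \<in> carrier A. N v \<le> 1 \<and>
    (\<forall>j x. 1 \<le> j \<longrightarrow> j < n \<longrightarrow> x \<in> set_power A M j \<longrightarrow> N (x \<otimes> v) \<le> 1)}"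
  show ?thesis
  proof (rule jsr_le_one_of_invariant[where B = B and e = "1 / (C * K)" and L = 1])
    show "insert b M \<in> bounded_subsets A" using M bc by (rule bounded_insert)
    show "B \<subseteq> carrier A" by (auto simp: B_def)
    show "1 / (C * K) > 0" using C(1) K(1) by simp
    show "anorm A v \<le> 1" if "v \<in> B" for v
      using that C(2)[of v] by (auto simp: B_def)
    show "v \<in> B" if v: "v \<in> carrier A" "anorm A v \<le> 1 / (C * K)" for v
    proof -
      have KC: "K * (C * anorm A v) \<le> 1" using v C(1) K(1) by (simp add: field_simps)
      have pos: "0 \<le> C * anorm A v" using v(1) C(1) by simp
      then have "C * anorm A v \<le> K * (C * anorm A v)" using K(1) mult_right_mono[of 1 K] by simp
      then have "N v \<le> 1" using C(3)[OF v(1)] KC by linarith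
      moreover have "N (x \<otimes> v) \<le> 1" if jx: "1 \<le> j" "j < n" "x \<in> set_power A M j" for j x
      proof -
        have x: "x \<in> carrier A" using jx(3) by (rule Pc)
        have "anorm A (x \<otimes> v) \<le> K * anorm A v"
          using anorm_mult[OF x v(1)] K(2)[OF jx] v(1) by (meson anorm_nonneg mult_right_mono order_trans)
        then have "C * anorm A (x \<otimes> v) \<le> C * (K * anorm A v)" using C(1) by (intro mult_left_mono) auto
        then have "N (x \<otimes> v) \<le> K * (C * anorm A v)"
          using C(3)[of "x \<otimes> v"] x v(1) by (simp add: mult.left_commute)
        then show ?thesis using KC by simp
      qed
      ultimately show ?thesis using v(1) by (auto simp: B_def)
    qed
    show "m \<otimes> v \<in> B" if m: "m \<in> insert b M" and v: "v \<in> B" for m v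
    proof (cases "m = b")
      case True
      have vc: "v \<in> carrier A" "N v \<le> 1" using v by (auto simp: B_def)
      have "N (x \<otimes> (b \<otimes> v)) \<le> 1" if "1 \<le> j" "j < n" "x \<in> set_power A M j" for j x
        using contractionD[OF low[OF that] vc(1)] vc Pc[OF that(3)] bc by (simp add: mult_assoc)
      moreover have "N (b \<otimes> v) \<le> 1" using contractionD[OF b vc(1)] vc(2) by simp
      ultimately show ?thesis using True vc bc by (auto simp: B_def)
    next
      case False
      then have m: "m \<in> M" "m \<in> carrier A" using m Mc by auto
      have vc: "v \<in> carrier A" "N v \<le> 1" using v by (auto simp: B_def)
      have step: "N (x \<otimes> v) \<le> 1" if "1 \<le> j" "j \<le> n" "x \<in> set_power A M j" for j x
      proof (cases "j = n")
        case True
        then show ?thesis using contractionD[OF top vc(1), of x] that vc(2) by simp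
      qed (use v that in \<open>auto simp: B_def\<close>)
      have "N (m \<otimes> v) \<le> 1" using step[of 1 m] m n by simp
      moreover have "N (x \<otimes> (m \<otimes> v)) \<le> 1" if jx: "1 \<le> j" "j < n" "x \<in> set_power A M j" for j x
      proof -
        have "x \<otimes> m \<in> set_power A M (Suc j)"
          using jx m by (auto simp: set_power_Suc set_mult_iff simp del: set_power.simps(3))
        then show ?thesis using step[of "Suc j" "x \<otimes> m"] jx Pc[OF jx(3)] m vc by (simp add: mult_assoc)
      qed
      ultimately show ?thesis using vc m by (auto simp: B_def)
    qed
  qed
qed

section \<open>The radicals are closed ideals\<close>

lemma radical_iff: "a \<in> small_radical k A \<longleftrightarrow> a \<in> carrier A \<and>
    (\<forall>M\<in>small_sets k A. joint_spectral_radius A (insert a M) = joint_spectral_radius A M)"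
  by (simp add: small_radical_def jsr_radical_def)

lemma radical_carrier: "a \<in> small_radical k A \<Longrightarrow> a \<in> carrier A"
  by (simp add: radical_iff)

text \<open>
  For \<open>c \<noteq> 0\<close> the set \<open>{c a} \<union> M\<close> is \<open>c\<close> times \<open>{a} \<union> (1/c) M\<close>.
\<close>

lemma radical_jsr:
  assumes a: "a \<in> small_radical k A" and M: "M \<in> small_sets k A"
  shows "joint_spectral_radius A (insert (c \<odot> a) M) = joint_spectral_radius A M"
proof (cases "c = 0")
  case True
  have ac: "a \<in> carrier A" by (rule radical_carrier[OF a])
  have Mb: "M \<in> bounded_subsets A" by (rule small_bounded[OF M])
  show ?thesis
  proof (rule antisym)
    show "joint_spectral_radius A (insert (c \<odot> a) M) \<le> joint_spectral_radius A M"
      using True ac Mb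
      by (intro jsr_le_transfer) (auto simp: bounded_insert contraction_zero)
    show "joint_spectral_radius A M \<le> joint_spectral_radius A (insert (c \<odot> a) M)"
      using ac Mb by (intro jsr_mono) (auto simp: bounded_insert)
  qed
next
  case False
  have ac: "a \<in> carrier A" by (rule radical_carrier[OF a])
  let ?M = "(\<lambda>x. inverse c \<odot> x) ` M"
  have M': "?M \<in> small_sets k A" by (rule small_smult[OF M])
  have inv: "(\<lambda>x. c \<odot> x) ` ?M = M"
    using smult_image_inverse[OF small_carrier[OF M], of "inverse c"] False by simp
  have "joint_spectral_radius A (insert (c \<odot> a) M) = joint_spectral_radius A ((\<lambda>x. c \<odot> x) ` insert a ?M)"
    by (subst (1) inv[symmetric]) simp
  also have "\<dots> = cmod c * joint_spectral_radius A (insert a ?M)"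
    using False small_bounded[OF M'] ac by (intro jsr_smult bounded_insert)
  also have "joint_spectral_radius A (insert a ?M) = joint_spectral_radius A ?M"
    using a M' by (simp add: radical_iff)
  also have "cmod c * joint_spectral_radius A ?M = joint_spectral_radius A ((\<lambda>x. c \<odot> x) ` ?M)"
    using False small_bounded[OF M'] by (intro jsr_smult[symmetric])
  finally show ?thesis unfolding inv .
qed

text \<open>
  For \<open>r > \<rho>(M)\<close> apply the hypothesis to \<open>M / r\<close> and \<open>c = 1 / r\<close>, then let \<open>r\<close> decrease to \<open>\<rho>(M)\<close>.
\<close>

lemma radicalI:
  assumes a: "a \<in> carrier A"
    and le: "\<And>c M. M \<in> small_sets k A \<Longrightarrow> joint_spectral_radius A M < 1 \<Longrightarrow>
      joint_spectral_radius A (insert (c \<odot> a) M) \<le> 1"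
  shows "a \<in> small_radical k A"
  unfolding radical_iff
proof (intro conjI ballI a antisym)
  fix M assume M: "M \<in> small_sets k A"
  have Mb: "M \<in> bounded_subsets A" by (rule small_bounded[OF M])
  show "joint_spectral_radius A M \<le> joint_spectral_radius A (insert a M)"
    using a Mb by (intro jsr_mono) (auto simp: bounded_insert)
  show "joint_spectral_radius A (insert a M) \<le> joint_spectral_radius A M"
  proof (rule dense_ge)
    fix r assume r: "joint_spectral_radius A M < r"
    then have r0: "0 < r" using jsr_nonneg[OF Mb] by simp
    let ?c = "complex_of_real (1 / r)"
    have c: "?c \<noteq> 0" "cmod ?c = 1 / r" using r0 by (auto simp: norm_divide)
    have "joint_spectral_radius A ((\<lambda>x. ?c \<odot> x) ` M) < 1"
      using jsr_smult[OF Mb c(1)] r r0 c(2) by simp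
    from le[OF small_smult[OF M] this, of ?c]
    have "joint_spectral_radius A ((\<lambda>x. ?c \<odot> x) ` insert a M) \<le> 1" by simp
    then show "joint_spectral_radius A (insert a M) \<le> r"
      using jsr_smult[OF bounded_insert[OF Mb a] c(1)] c(2) r0 by simp
  qed
qed

lemma radical_finite:
  assumes F: "finite F" "F \<subseteq> small_radical k A" and M: "M \<in> small_sets k A"
  shows "joint_spectral_radius A ((\<lambda>x. c \<odot> x) ` F \<union> M) = joint_spectral_radius A M \<and>
    (\<lambda>x. c \<odot> x) ` F \<union> M \<in> small_sets k A"
  using F
proof (induction F rule: finite_induct)
  case (insert a F)
  then have "c \<odot> a \<in> carrier A" using radical_carrier[of a k] by simp
  then show ?case using insert radical_jsr[of a k _ c] by (simp add: small_insert)
qed (simp add: M)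

lemma radical_contracting_norm:
  assumes a: "a \<in> small_radical k A" and M: "M \<in> small_sets k A" and less: "joint_spectral_radius A M < 1"
  obtains N where "equivalent_norm N" "contraction N 1 (c \<odot> a)" "\<And>m. m \<in> M \<Longrightarrow> contraction N 1 m"
proof -
  have "insert (c \<odot> a) M \<in> bounded_subsets A"
    using small_bounded[OF M] radical_carrier[OF a] by (intro bounded_insert) auto
  from contracting_norm_exists[OF this, of 1] radical_jsr[OF a M, of c] less
  obtain N where "equivalent_norm N" "\<And>m. m \<in> insert (c \<odot> a) M \<Longrightarrow> contraction N 1 m" by auto
  then show ?thesis using that by blast
qed

lemma radical_smult: "a \<in> small_radical k A \<Longrightarrow> c \<odot> a \<in> small_radical k A"
  by (rule radicalI)
     (auto simp: radical_jsr radical_carrier smult_smult less_imp_le)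

lemma half_double: "x \<in> carrier A \<Longrightarrow> complex_of_real (1/2) \<odot> (2 \<odot> x) = x"
  by (simp add: smult_smult smult_1)

text \<open>
  Written with doubles because \<open>x + y\<close> is the average of \<open>2 x\<close> and \<open>2 y\<close>, and the radical absorbs the factor 2.
\<close>

lemma contraction_mean:
  assumes N: "equivalent_norm N" and xy: "x \<in> carrier A" "y \<in> carrier A"
    and cx: "contraction N r (2 \<odot> x)" and cy: "contraction N r (2 \<odot> y)"
  shows "contraction N r (x \<oplus> y)"
proof -
  have "contraction N (r / 2 + r / 2) (complex_of_real (1/2) \<odot> (2 \<odot> x) \<oplus> complex_of_real (1/2) \<odot> (2 \<odot> y))"
    using contraction_smult[OF N cx, of "complex_of_real (1/2)"]
      contraction_smult[OF N cy, of "complex_of_real (1/2)"]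
    by (intro contraction_add[OF N]) auto
  then show ?thesis by (simp only: half_double xy field_sum_of_halves)
qed

lemma radical_add:
  assumes a: "a \<in> small_radical k A" and b: "b \<in> small_radical k A"
  shows "a \<oplus> b \<in> small_radical k A"
proof (rule radicalI)
  have ab: "a \<in> carrier A" "b \<in> carrier A" using a b radical_carrier by auto
  then show "a \<oplus> b \<in> carrier A" by simp
  fix c M assume M: "M \<in> small_sets k A" and less: "joint_spectral_radius A M < 1"
  let ?M = "insert (2 * c \<odot> a) M"
  have M': "?M \<in> small_sets k A" using small_insert[OF M] ab by simp
  have "joint_spectral_radius A ?M < 1" using radical_jsr[OF a M] less by simp
  then obtain N where N: "equivalent_norm N" "contraction N 1 (2 * c \<odot> b)"
    "\<And>m. m \<in> ?M \<Longrightarrow> contraction N 1 m"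
    using radical_contracting_norm[OF b M'] by blast
  have "contraction N 1 (c \<odot> a \<oplus> c \<odot> b)"
    using N ab by (intro contraction_mean) (auto simp: smult_smult)
  then show "joint_spectral_radius A (insert (c \<odot> (a \<oplus> b)) M) \<le> 1"
    using N ab small_bounded[OF M]
    by (intro jsr_le_one_of_contractions[OF _ N(1)]) (auto simp: bounded_insert smult_add_vector)
qed

text \<open>
  Rebalancing: \<open>c a b = ((c / s) a) (s b)\<close>, where \<open>s\<close> is so small that \<open>s b\<close> can be added to \<open>M\<close> with
  \<open>\<rho> < 1\<close> preserved.
\<close>

lemma radical_mult:
  assumes a: "a \<in> small_radical k A" and b: "b \<in> carrier A"
  shows "a \<otimes> b \<in> small_radical k A" and "b \<otimes> a \<in> small_radical k A"
proof -
  have ac: "a \<in> carrier A" by (rule radical_carrier[OF a])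
  have "joint_spectral_radius A (insert (c \<odot> (a \<otimes> b)) M) \<le> 1 \<and>
        joint_spectral_radius A (insert (c \<odot> (b \<otimes> a)) M) \<le> 1"
    if M: "M \<in> small_sets k A" and less: "joint_spectral_radius A M < 1" for c M
  proof -
    obtain e where e: "e > 0" "\<And>D. D \<in> bounded_subsets A \<Longrightarrow> (\<And>x. x \<in> D \<Longrightarrow> anorm A x \<le> e) \<Longrightarrow>
      joint_spectral_radius A (D \<union> M) < 1"
      using jsr_add_small[OF small_bounded[OF M] less] by blast
    define s where "s = e / (anorm A b + 1)"
    have s: "s > 0" using e(1) anorm_nonneg[OF b] by (simp add: s_def add_nonneg_pos)
    let ?s = "complex_of_real s" and ?b = "complex_of_real s \<odot> b"
    have "anorm A ?b = s * anorm A b" using b s by (simp add: anorm_smult)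
    also have "\<dots> \<le> e" unfolding s_def using e(1) anorm_nonneg[OF b]
      by (simp add: divide_le_eq algebra_simps)
    finally have "joint_spectral_radius A ({?b} \<union> M) < 1"
      using b finite_small[of "{?b}" Bounded] by (intro e(2)) auto
    then have "joint_spectral_radius A (insert ?b M) < 1" by simp
    then obtain N where N: "equivalent_norm N" "contraction N 1 ((c / ?s) \<odot> a)"
      "\<And>m. m \<in> insert ?b M \<Longrightarrow> contraction N 1 m"
      using radical_contracting_norm[OF a small_insert[OF M]] b by (metis smult_closed)
    have "contraction N 1 (((c / ?s) \<odot> a) \<otimes> ?b)" "contraction N 1 (?b \<otimes> ((c / ?s) \<odot> a))"
      using contraction_mult[OF N(1), of 1 _ 1] N by auto
    then have "contraction N 1 (c \<odot> (a \<otimes> b))" "contraction N 1 (c \<odot> (b \<otimes> a))"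
      using ac b s by (simp_all add: smult_mult_left smult_mult_right smult_smult)
    then show ?thesis
      using N ac b small_bounded[OF M]
      by (auto intro!: jsr_le_one_of_contractions[OF _ N(1)] simp: bounded_insert)
  qed
  then show "a \<otimes> b \<in> small_radical k A" "b \<otimes> a \<in> small_radical k A"
    using ac b by (auto intro!: radicalI)
qed

text \<open>
  \<open>c a\<close> is the average of \<open>2 c (a - b)\<close> and \<open>2 c b\<close>, where \<open>b\<close> lies in the radical and \<open>a - b\<close> is small.
\<close>

lemma radical_closed:
  assumes a: "a \<in> carrier A"
    and approx: "\<And>e. e > 0 \<Longrightarrow> \<exists>b\<in>small_radical k A. anorm A (a \<ominus> b) < e"
  shows "a \<in> small_radical k A"
proof (rule radicalI[OF a])
  fix c M assume M: "M \<in> small_sets k A" and less: "joint_spectral_radius A M < 1"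
  obtain e where e: "e > 0" "\<And>D. D \<in> bounded_subsets A \<Longrightarrow> (\<And>x. x \<in> D \<Longrightarrow> anorm A x \<le> e) \<Longrightarrow>
    joint_spectral_radius A (D \<union> M) < 1"
    using jsr_add_small[OF small_bounded[OF M] less] by blast
  have c1: "0 < 2 * (cmod c + 1)" by (simp add: add_nonneg_pos)
  obtain b where b: "b \<in> small_radical k A" "anorm A (a \<ominus> b) < e / (2 * (cmod c + 1))"
    using approx[of "e / (2 * (cmod c + 1))"] e(1) c1 by auto
  have bc: "b \<in> carrier A" by (rule radical_carrier[OF b(1)])
  let ?d = "(2 * c) \<odot> (a \<ominus> b)"
  have "anorm A ?d = 2 * cmod c * anorm A (a \<ominus> b)" using a bc by (simp add: anorm_smult norm_mult)
  also have "\<dots> \<le> 2 * (cmod c + 1) * (e / (2 * (cmod c + 1)))"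
    using b(2) a bc by (intro mult_mono) auto
  also have "\<dots> = e" using c1 by simp
  finally have "joint_spectral_radius A ({?d} \<union> M) < 1"
    using a bc finite_small[of "{?d}" Bounded] by (intro e(2)) auto
  then have "joint_spectral_radius A (insert ?d M) < 1" by simp
  then obtain N where N: "equivalent_norm N" "contraction N 1 ((2 * c) \<odot> b)"
    "\<And>m. m \<in> insert ?d M \<Longrightarrow> contraction N 1 m"
    using radical_contracting_norm[OF b(1) small_insert[OF M]] a bc by (metis minus_closed smult_closed)
  have "contraction N 1 (c \<odot> (a \<ominus> b) \<oplus> c \<odot> b)"
    using N a bc by (intro contraction_mean) (auto simp: smult_smult)
  then have "contraction N 1 (c \<odot> a)"
    using a bc by (simp add: diff_add_cancel flip: smult_add_vector)
  then show "joint_spectral_radius A (insert (c \<odot> a) M) \<le> 1"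
    using N a small_bounded[OF M]
    by (intro jsr_le_one_of_contractions[OF _ N(1)]) (auto simp: bounded_insert)
qed

lemma alg_idealI:
  assumes "I \<subseteq> carrier A" "\<zero> \<in> I"
    and "\<And>x y. x \<in> I \<Longrightarrow> y \<in> I \<Longrightarrow> x \<oplus> y \<in> I" "\<And>c x. x \<in> I \<Longrightarrow> c \<odot> x \<in> I"
    and "\<And>a x. a \<in> carrier A \<Longrightarrow> x \<in> I \<Longrightarrow> a \<otimes> x \<in> I" "\<And>a x. a \<in> carrier A \<Longrightarrow> x \<in> I \<Longrightarrow> x \<otimes> a \<in> I"
  shows "alg_ideal I A"
proof -
  have "subgroup I (add_monoid A)"
    using assms(1-3) assms(4)[of _ "-1"]
    by unfold_locales (auto simp: smult_minus_one subset_iff simp flip: a_inv_def)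
  then show ?thesis using assms by (auto simp: alg_ideal_def additive_subgroup_def)
qed

lemma radical_zero: "\<zero> \<in> small_radical k A"
proof (rule radicalI)
  fix c M assume M: "M \<in> small_sets k A" and less: "joint_spectral_radius A M < 1"
  have "joint_spectral_radius A (insert (c \<odot> \<zero>) M) \<le> joint_spectral_radius A M"
    using small_bounded[OF M] by (intro jsr_le_transfer) (auto simp: bounded_insert contraction_zero)
  then show "joint_spectral_radius A (insert (c \<odot> \<zero>) M) \<le> 1" using less by simp
qed simp

lemma radical_alg_ideal: "alg_ideal (small_radical k A) A"
  by (rule alg_idealI)
     (auto simp: radical_carrier radical_zero radical_add radical_smult radical_mult)

lemma closedin_iff: "closedin (atopology A) C \<longleftrightarrow>
    C \<subseteq> carrier A \<and> (\<forall>x\<in>carrier A. (\<forall>e>0. \<exists>y\<in>C. anorm A (x \<ominus> y) < e) \<longrightarrow> x \<in> C)"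
proof -
  have "disjnt C (Met.mball x r) \<longleftrightarrow> \<not> (\<exists>y\<in>C. anorm A (x \<ominus> y) < r)"
    if "C \<subseteq> carrier A" "x \<in> carrier A" for x r
  proof -
    have "y \<in> Met.mball x r \<longleftrightarrow> anorm A (x \<ominus> y) < r" if "y \<in> C" for y
      using that \<open>C \<subseteq> carrier A\<close> \<open>x \<in> carrier A\<close> by (auto simp: adist_def)
    then show ?thesis unfolding disjnt_iff by blast
  qed
  then show ?thesis unfolding Met.closedin_metric by blast
qed

lemma radical_closed_ideal: "closed_ideal (small_radical k A) A"
  unfolding closed_ideal_def closedin_iff
  using radical_alg_ideal radical_closed radical_carrier by blast

end

lemma ideal_map_radical: "ideal_map (small_radical k)"
  by (simp add: ideal_map_def nalg_def nalg.radical_closed_ideal)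

context nalg
begin

section \<open>Ideals as algebras and heredity\<close>

lemma alg_idealD:
  assumes "alg_ideal I A"
  shows "I \<subseteq> carrier A" "\<zero> \<in> I" "\<And>x y. x \<in> I \<Longrightarrow> y \<in> I \<Longrightarrow> x \<oplus> y \<in> I" "\<And>c x. x \<in> I \<Longrightarrow> c \<odot> x \<in> I"
    "\<And>a x. a \<in> carrier A \<Longrightarrow> x \<in> I \<Longrightarrow> a \<otimes> x \<in> I" "\<And>a x. a \<in> carrier A \<Longrightarrow> x \<in> I \<Longrightarrow> x \<otimes> a \<in> I"
proof -
  have s: "additive_subgroup I A" using assms by (simp add: alg_ideal_def)
  show "I \<subseteq> carrier A" "\<zero> \<in> I" "\<And>x y. x \<in> I \<Longrightarrow> y \<in> I \<Longrightarrow> x \<oplus> y \<in> I"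
    using additive_subgroup.a_subset[OF s] additive_subgroup.zero_closed[OF s]
      additive_subgroup.a_closed[OF s] by auto
qed (use assms in \<open>auto simp: alg_ideal_def\<close>)

lemma nalg_ideal_alg:
  assumes I: "alg_ideal I A"
  shows "nalg (ideal_alg A I)"
proof -
  note D = alg_idealD[OF I]
  have c: "x \<in> carrier A" if "x \<in> I" for x using that D(1) by blast
  have "abelian_group (ideal_alg A I)"
  proof (rule abelian_groupI)
    show "\<exists>y\<in>carrier (ideal_alg A I). y \<oplus>\<^bsub>ideal_alg A I\<^esub> x = \<zero>\<^bsub>ideal_alg A I\<^esub>"
      if "x \<in> carrier (ideal_alg A I)" for x
      using that D(4)[of x "-1"] c[of x] by (intro bexI[of _ "\<ominus> x"]) (auto simp: smult_minus_one l_neg)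
  qed (use D c in \<open>auto simp: a_ac\<close>)
  then show ?thesis
    unfolding nalg_def normed_algebra_def normed_algebra_axioms_def
    using D c by (auto simp: mult_assoc mult_add_left mult_add_right smult_add_scalar smult_add_vector
        smult_smult smult_1 smult_mult_left smult_mult_right anorm_eq_0 anorm_triangle anorm_smult anorm_mult)
qed

lemma ideal_alg_diff:
  assumes I: "alg_ideal I A" and xy: "x \<in> I" "y \<in> I"
  shows "x \<ominus>\<^bsub>ideal_alg A I\<^esub> y = x \<ominus> y"
proof -
  interpret I: nalg "ideal_alg A I" by (rule nalg_ideal_alg[OF I])
  have "x \<in> carrier A" "y \<in> carrier A" using xy alg_idealD(1)[OF I] by auto
  then show ?thesis using I.minus_smult[of x y] minus_smult[of x y] xy by simp
qed

lemma small_ideal_alg: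
  assumes I: "alg_ideal I A"
  shows "M \<in> small_sets k (ideal_alg A I) \<longleftrightarrow> M \<subseteq> I \<and> M \<in> small_sets k A"
proof -
  interpret I: nalg "ideal_alg A I" by (rule nalg_ideal_alg[OF I])
  note sub = alg_idealD(1)[OF I]
  show ?thesis
  proof (cases k)
    case Finite
    then show ?thesis using sub by (auto simp: finite_subsets_def)
  next
    case Precompact
    have "(\<exists>F. finite F \<and> F \<subseteq> M \<and> (\<forall>x\<in>M. \<exists>y\<in>F. anorm A (x \<ominus>\<^bsub>ideal_alg A I\<^esub> y) < e)) \<longleftrightarrow>
      (\<exists>F. finite F \<and> F \<subseteq> M \<and> (\<forall>x\<in>M. \<exists>y\<in>F. anorm A (x \<ominus> y) < e))" if "M \<subseteq> I" for e
    proof -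
      have "x \<ominus>\<^bsub>ideal_alg A I\<^esub> y = x \<ominus> y" if "F \<subseteq> M" "x \<in> M" "y \<in> F" for F x y
        using ideal_alg_diff[OF I] that \<open>M \<subseteq> I\<close> by blast
      then show ?thesis by (metis (no_types, lifting))
    qed
    then have "M \<in> precompact_subsets (ideal_alg A I) \<longleftrightarrow> M \<subseteq> I \<and> M \<in> precompact_subsets A"
      unfolding I.precompact_iff precompact_iff using sub by (cases "M \<subseteq> I") auto
    then show ?thesis using Precompact by simp
  next
    case Bounded
    then show ?thesis using sub by (auto simp: I.bounded_subsets_iff bounded_subsets_iff)
  qed
qed

lemma set_power_ideal_alg: "set_power (ideal_alg A I) M n = set_power A M n"
  by (induction A M n rule: set_power.induct) (simp_all add: set_mult_def)

lemma jsr_ideal_alg: "joint_spectral_radius (ideal_alg A I) M = joint_spectral_radius A M"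
  by (simp add: joint_spectral_radius_def set_norm_def set_power_ideal_alg)

text \<open>
  Test sets of the ideal are test sets of the algebra, with the same joint spectral radius.
\<close>

lemma radical_ideal_alg_supset:
  assumes I: "alg_ideal I A"
  shows "I \<inter> small_radical k A \<subseteq> small_radical k (ideal_alg A I)"
proof -
  interpret I: nalg "ideal_alg A I" by (rule nalg_ideal_alg[OF I])
  show ?thesis
    by (auto simp: radical_iff I.radical_iff small_ideal_alg[OF I] jsr_ideal_alg)
qed

text \<open>
  The hypothesis on \<open>a\<close> yields a norm on \<open>I\<close> only, while words in \<open>b = c a\<close> and \<open>M\<close> may begin with letters
  from \<open>M\<close>.  With \<open>S\<close> the semigroup generated by \<open>M\<close> and \<open>P = {b} \<union> b S\<close>, a product of two elements of \<open>P\<close>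
  has the form \<open>b l\<close> with \<open>l \<in> L = P \<union> S P\<close>, a test set in \<open>I\<close>.  Rebalancing \<open>b\<close> against \<open>L\<close> makes
  \<open>b l\<close> contract a norm \<open>N\<close> on \<open>I\<close>.  The neighbourhood \<open>B\<close> controls \<open>v\<close> through a norm \<open>N1\<close> that \<open>M\<close>
  contracts and through \<open>N (p v)\<close> and \<open>N (p q v)\<close> for \<open>p, q \<in> P\<close>.  It is invariant under \<open>M\<close> since \<open>P M\<close> is
  part of \<open>P\<close>, and under \<open>b\<close> since each further factor from \<open>P\<close> is either counted or absorbed in some
  \<open>b l\<close>.
\<close>

lemma radical_ideal_alg_subset:
  assumes I: "alg_ideal I A" and k: "k \<noteq> Finite" and a: "a \<in> small_radical k (ideal_alg A I)"
  shows "a \<in> small_radical k A"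
proof -
  interpret I: nalg "ideal_alg A I" by (rule nalg_ideal_alg[OF I])
  note D = alg_idealD[OF I]
  have cI: "x \<in> carrier A" if "x \<in> I" for x using that D(1) by blast
  have aI: "a \<in> I" using I.radical_carrier[OF a] by simp
  show ?thesis
  proof (rule radicalI)
    show "a \<in> carrier A" using aI by (rule cI)
    fix c M assume M: "M \<in> small_sets k A" and less: "joint_spectral_radius A M < 1"
    have Mb: "M \<in> bounded_subsets A" by (rule small_bounded[OF M])
    have Mc: "x \<in> carrier A" if "x \<in> M" for x using that small_carrier[OF M] by blast
    define b where "b = c \<odot> a"
    have b: "b \<in> small_radical k (ideal_alg A I)" using I.radical_smult[OF a, of c] by (simp add: b_def)
    have bI: "b \<in> I" using aI D(4) by (simp add: b_def)
    have bc: "b \<in> carrier A" using bI by (rule cI)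
    define S where "S = (\<Union>n\<in>{1..}. set_power A M n)"
    have S: "S \<in> small_sets k A" unfolding S_def by (rule small_semigroup[OF M k less])
    have Sc: "x \<in> carrier A" if "x \<in> S" for x using that small_carrier[OF S] by blast
    have MS: "m \<in> S" if "m \<in> M" for m unfolding S_def using that by (intro UN_I[of 1]) auto
    have SM: "s \<otimes> m \<in> S" if "s \<in> S" "m \<in> M" for s m
    proof -
      obtain n where n: "n \<ge> 1" "s \<in> set_power A M n" using \<open>s \<in> S\<close> by (auto simp: S_def)
      then have "s \<otimes> m \<in> set_power A M (Suc n)"
        using that by (auto simp: set_power_Suc set_mult_iff simp del: set_power.simps(3))
      then show ?thesis unfolding S_def by (intro UN_I[of "Suc n"]) auto
    qed
    define P where "P = insert b ({b} <#> S)"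
    define L where "L = P \<union> (S <#> P)"
    have b1: "{b} \<in> small_sets k A" using bc by (intro finite_small) auto
    have P: "P \<in> small_sets k A"
      unfolding P_def by (rule small_insert[OF small_set_mult[OF b1 S] bc])
    have L: "L \<in> small_sets k A" unfolding L_def by (rule small_Un[OF P small_set_mult[OF S P]])
    have PI: "x \<in> I" if "x \<in> P" for x
      using that bI Sc D(6) by (auto simp: P_def set_mult_iff)
    have LI: "x \<in> I" if "x \<in> L" for x
      using that PI Sc D(5) by (auto simp: L_def set_mult_iff)
    have bP: "b \<in> P" by (simp add: P_def)
    have PM: "p \<otimes> m \<in> P" if p: "p \<in> P" and m: "m \<in> M" for p m
      using p unfolding P_def
    proof (elim insertE)
      assume "p = b"
      then show "p \<otimes> m \<in> insert b ({b} <#> S)" using MS[OF m] by (auto simp: set_mult_iff)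
    next
      assume "p \<in> {b} <#> S"
      then obtain s where s: "p = b \<otimes> s" "s \<in> S" by (auto simp: set_mult_iff)
      then have "p \<otimes> m = b \<otimes> (s \<otimes> m)" using bc Sc Mc m by (simp add: mult_assoc)
      then show "p \<otimes> m \<in> insert b ({b} <#> S)" using SM[OF s(2) m] by (auto simp: set_mult_iff)
    qed
    have PP: "\<exists>l\<in>L. p \<otimes> q = b \<otimes> l" if p: "p \<in> P" and q: "q \<in> P" for p q
      using p unfolding P_def
    proof (elim insertE)
      assume "p = b"
      then show ?thesis using q by (auto simp: L_def)
    next
      assume "p \<in> {b} <#> S"
      then obtain s where s: "p = b \<otimes> s" "s \<in> S" by (auto simp: set_mult_iff)
      then have "p \<otimes> q = b \<otimes> (s \<otimes> q)" using bc Sc cI[OF PI[OF q]] by (simp add: mult_assoc)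
      moreover have "s \<otimes> q \<in> L" using s(2) q by (auto simp: L_def set_mult_iff)
      ultimately show ?thesis using s(1) by blast
    qed
    obtain K0 where K0: "K0 > 0" "\<And>x. x \<in> L \<Longrightarrow> anorm A x \<le> K0"
      using small_bounded[OF L] unfolding bounded_subsets_iff by blast
    \<comment> \<open>With \<open>K \<ge> 1\<close> the bound for two factors from \<open>P\<close> covers one factor.\<close>
    define K where "K = max 1 K0"
    have K: "K \<ge> 1" "\<And>x. x \<in> L \<Longrightarrow> anorm A x \<le> K"
      using K0(2) by (auto simp: K_def intro: max.coboundedI2)
    \<comment> \<open>This brings \<open>L\<close> down to norm 1/2, whence \<open>\<rho> < 1\<close>.\<close>
    define s where "s = complex_of_real (1 / (2 * K))"
    have s: "s \<noteq> 0" "cmod s = 1 / (2 * K)" using K(1) by (auto simp: s_def norm_divide)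
    let ?L = "(\<lambda>x. s \<odot> x) ` L"
    have L': "?L \<in> small_sets k (ideal_alg A I)"
      unfolding small_ideal_alg[OF I] using small_smult[OF L] LI D(4) by auto
    have "anorm A (s \<odot> x) \<le> 1 / 2" if x: "x \<in> L" for x
    proof -
      have "anorm A (s \<odot> x) = 1 / (2 * K) * anorm A x"
        using cI[OF LI[OF x]] by (simp only: anorm_smult s(2))
      also have "\<dots> \<le> 1 / (2 * K) * K" using K(1) K(2)[OF x] by (intro mult_left_mono) auto
      finally show ?thesis using K(1) by simp
    qed
    then have "joint_spectral_radius (ideal_alg A I) ?L < 1"
      by (intro I.jsr_less_one_of_norm[OF I.small_bounded[OF L'], of "1 / 2"]) auto
    from I.radical_contracting_norm[OF b L' this, of "inverse s"]
    obtain N where N: "I.equivalent_norm N" "I.contraction N 1 (inverse s \<odot> b)"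
      "\<And>x. x \<in> ?L \<Longrightarrow> I.contraction N 1 x" by auto
    have bl: "N (b \<otimes> l \<otimes> v) \<le> N v" if l: "l \<in> L" and v: "v \<in> I" for l v
    proof -
      have "I.contraction N 1 (inverse s \<odot> b \<otimes> (s \<odot> l))"
        using I.contraction_mult[OF N(1), of 1 "inverse s \<odot> b" 1 "s \<odot> l"] N(2,3) l by auto
      moreover have "inverse s \<odot> b \<otimes> (s \<odot> l) = b \<otimes> l"
        using bc cI[OF LI[OF l]] s(1) by (simp add: smult_mult_left smult_mult_right smult_smult smult_1)
      ultimately show ?thesis using I.contractionD[of N 1 "b \<otimes> l" v] v by simp
    qed
    \<comment> \<open>A norm on all of \<open>A\<close>, needed because \<open>N\<close> sees a vector \<open>v\<close> outside \<open>I\<close> only through \<open>P v\<close>.\<close>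
    obtain N1 where N1: "equivalent_norm N1" "\<And>m. m \<in> M \<Longrightarrow> contraction N1 1 m"
      using contracting_norm_exists[OF Mb less] by blast
    obtain C where C: "C > 0" "\<And>v. v \<in> carrier A \<Longrightarrow> anorm A v \<le> N1 v"
      "\<And>v. v \<in> carrier A \<Longrightarrow> N1 v \<le> C * anorm A v" using equivalent_norm_bounds[OF N1(1)] by blast
    obtain C' where C': "C' > 0" "\<And>v. v \<in> I \<Longrightarrow> anorm A v \<le> N v"
      "\<And>v. v \<in> I \<Longrightarrow> N v \<le> C' * anorm A v" using I.equivalent_norm_bounds[OF N(1)] by auto
    have N1_le: "N1 w \<le> C" if w: "w \<in> carrier A" "anorm A w \<le> 1" for w
    proof -
      have "C * anorm A w \<le> C * 1" using C(1) w(2) by (intro mult_left_mono) auto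
      then show ?thesis using C(3)[OF w(1)] by simp
    qed
    define B where "B = {v \<in> carrier A. N1 v \<le> C \<and> (\<forall>p\<in>P. N (p \<otimes> v) \<le> 1) \<and>
      (\<forall>p\<in>P. \<forall>q\<in>P. N (p \<otimes> (q \<otimes> v)) \<le> 1)}"
    have "joint_spectral_radius A (insert b M) \<le> 1"
    proof (rule jsr_le_one_of_invariant[where B = B and e = "min 1 (1 / (C' * (K * K)))" and L = C])
      show "insert b M \<in> bounded_subsets A" by (rule bounded_insert[OF Mb bc])
      show "B \<subseteq> carrier A" by (auto simp: B_def)
      show "min 1 (1 / (C' * (K * K))) > 0" using C'(1) K(1) by simp
      show "anorm A v \<le> C" if "v \<in> B" for v using that C(2)[of v] by (auto simp: B_def)
      show "v \<in> B" if v: "v \<in> carrier A" "anorm A v \<le> min 1 (1 / (C' * (K * K)))" for v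
      proof -
        have KC: "C' * (K * (K * anorm A v)) \<le> 1" using v C'(1) K(1) by (simp add: field_simps)
        have step: "anorm A (p \<otimes> w) \<le> K * anorm A w" if p: "p \<in> P" and w: "w \<in> carrier A" for p w
          using anorm_mult[OF cI[OF PI[OF p]] w] K(2)[of p] p w unfolding L_def
          by (meson UnI1 anorm_nonneg mult_right_mono order_trans)
        have one: "N (p \<otimes> w) \<le> C' * (K * anorm A w)" if p: "p \<in> P" and w: "w \<in> carrier A" for p w
          using C'(1) C'(3)[OF D(6)[OF w PI[OF p]]] step[OF p w]
          by (meson less_imp_le mult_left_mono order_trans)
        have "K * anorm A v \<le> K * (K * anorm A v)"
          using K(1) v(1) mult_right_mono[of 1 K "K * anorm A v"] by simp
        then have "C' * (K * anorm A v) \<le> C' * (K * (K * anorm A v))"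
          by (rule mult_left_mono) (use C'(1) in simp)
        then have KC': "C' * (K * anorm A v) \<le> 1" using KC by linarith
        have "N1 v \<le> C" using N1_le v by simp
        moreover have "N (p \<otimes> v) \<le> 1" if "p \<in> P" for p
          using one[OF that v(1)] KC' by linarith
        moreover have "N (p \<otimes> (q \<otimes> v)) \<le> 1" if p: "p \<in> P" and q: "q \<in> P" for p q
        proof -
          have "N (p \<otimes> (q \<otimes> v)) \<le> C' * (K * anorm A (q \<otimes> v))"
            using one[OF p, of "q \<otimes> v"] cI[OF PI[OF q]] v(1) by simp
          also have "\<dots> \<le> C' * (K * (K * anorm A v))"
            using step[OF q v(1)] C'(1) K(1) by (intro mult_left_mono) auto
          finally show ?thesis using KC by linarith
        qed
        ultimately show ?thesis using v(1) by (auto simp: B_def)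
      qed
      show "m \<otimes> v \<in> B" if m: "m \<in> insert b M" and v: "v \<in> B" for m v
      proof (cases "m = b")
        case True
        have vB: "v \<in> carrier A" "\<And>p. p \<in> P \<Longrightarrow> N (p \<otimes> v) \<le> 1"
          "\<And>p q. p \<in> P \<Longrightarrow> q \<in> P \<Longrightarrow> N (p \<otimes> (q \<otimes> v)) \<le> 1" using v by (auto simp: B_def)
        have bvI: "b \<otimes> v \<in> I" using D(6) bI vB(1) by blast
        have bv: "anorm A (b \<otimes> v) \<le> 1" using C'(2)[OF bvI] vB(2)[OF bP] by simp
        have "N1 (b \<otimes> v) \<le> C" using N1_le bc vB(1) bv by simp
        moreover have "N (p \<otimes> (q \<otimes> (b \<otimes> v))) \<le> 1" if p: "p \<in> P" and q: "q \<in> P" for p q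
        proof -
          obtain l where l: "l \<in> L" "p \<otimes> q = b \<otimes> l" using PP[OF p q] by blast
          have "p \<otimes> (q \<otimes> (b \<otimes> v)) = b \<otimes> l \<otimes> (b \<otimes> v)"
            using cI[OF PI[OF p]] cI[OF PI[OF q]] bc vB(1) by (simp add: mult_assoc flip: l(2))
          then show ?thesis using bl[OF l(1) bvI] vB(2)[OF bP] by simp
        qed
        ultimately show ?thesis using True vB bP bc by (auto simp: B_def)
      next
        case False
        then have m: "m \<in> M" "m \<in> carrier A" using m Mc by auto
        have vB: "v \<in> carrier A" "N1 v \<le> C" "\<And>p. p \<in> P \<Longrightarrow> N (p \<otimes> v) \<le> 1"
          "\<And>p q. p \<in> P \<Longrightarrow> q \<in> P \<Longrightarrow> N (p \<otimes> (q \<otimes> v)) \<le> 1" using v by (auto simp: B_def)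
        have assoc: "p \<otimes> (m \<otimes> v) = p \<otimes> m \<otimes> v" if "p \<in> P" for p
          using cI[OF PI[OF that]] m vB(1) by (simp add: mult_assoc)
        have "N1 (m \<otimes> v) \<le> C" using contractionD[OF N1(2)[OF m(1)] vB(1)] vB(2) by simp
        then show ?thesis using m vB PM[OF _ m(1)] assoc by (auto simp: B_def)
      qed
    qed
    then show "joint_spectral_radius A (insert (c \<odot> a) M) \<le> 1" by (simp add: b_def)
  qed
qed

end

lemma rad1_radical: "rad1 (small_radical k)"
  unfolding rad1_def
proof (intro allI impI)
  fix A :: "'a nalg" assume "normed_algebra A"
  then interpret nalg A by (simp add: nalg_def)
  let ?R = "small_radical k A"
  interpret I: nalg "ideal_alg A ?R" by (rule nalg_ideal_alg[OF radical_alg_ideal])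
  show "small_radical k (ideal_alg A ?R) = ?R"
    using radical_ideal_alg_supset[OF radical_alg_ideal, of k k] I.radical_carrier by auto
qed

lemma rad6_radical:
  assumes k: "k \<noteq> Finite"
  shows "rad6 (small_radical k)"
  unfolding rad6_def
proof (intro allI impI, elim conjE)
  fix A :: "'a nalg" and I assume "normed_algebra A" and I: "alg_ideal I A"
  then interpret nalg A by (simp add: nalg_def)
  interpret I: nalg "ideal_alg A I" by (rule nalg_ideal_alg[OF I])
  show "small_radical k (ideal_alg A I) = I \<inter> small_radical k A"
    using radical_ideal_alg_supset[OF I] radical_ideal_alg_subset[OF I k] I.radical_carrier by fastforce
qed

lemma rad5_of_rad6:
  assumes "ideal_map R" "rad6 R"
  shows "rad5 R"
  unfolding rad5_def
proof (intro allI impI, elim conjE)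
  fix A :: "'a nalg" and I assume A: "normed_algebra A" and I: "alg_ideal I A"
  then interpret nalg A by (simp add: nalg_def)
  have R: "alg_ideal (R A) A" using assms(1) A by (auto simp: ideal_map_def closed_ideal_def)
  have "alg_ideal (I \<inter> R A) A"
    using alg_idealD[OF I] alg_idealD[OF R] by (intro alg_idealI) auto
  moreover have "R (ideal_alg A I) = I \<inter> R A" using assms(2) A I by (simp add: rad6_def)
  ultimately show "alg_ideal (R (ideal_alg A I)) A \<and> R (ideal_alg A I) \<subseteq> I \<inter> R A" by simp
qed

section \<open>Homomorphisms and quotients\<close>

lemma set_power_hom:
  assumes A: "nalg A" and M: "M \<subseteq> carrier A"
    and hom: "\<And>x y. x \<in> carrier A \<Longrightarrow> y \<in> carrier A \<Longrightarrow> f (x \<otimes>\<^bsub>A\<^esub> y) = f x \<otimes>\<^bsub>B\<^esub> f y"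
  shows "set_power B (f ` M) n = f ` set_power A M n"
proof (induction n)
  case (Suc n)
  interpret A: nalg A by (rule A)
  show ?case
  proof (cases n)
    case (Suc m)
    have "(f ` set_power A M n) <#>\<^bsub>B\<^esub> (f ` M) = f ` (set_power A M n <#>\<^bsub>A\<^esub> M)"
      using hom A.set_power_carrier[OF M, of n] M
      by (auto simp: set_mult_def image_UN subset_iff)
    then show ?thesis using Suc Suc.IH by simp
  qed simp
qed simp

text \<open>
  The constant \<open>c\<close> is absorbed in the constant of the growth estimate for the powers of \<open>M\<close>.
\<close>

lemma jsr_image_le:
  assumes A: "nalg A" and B: "nalg B" and M: "M \<in> bounded_subsets A" and fM: "f ` M \<in> bounded_subsets B"
    and hom: "\<And>x y. x \<in> carrier A \<Longrightarrow> y \<in> carrier A \<Longrightarrow> f (x \<otimes>\<^bsub>A\<^esub> y) = f x \<otimes>\<^bsub>B\<^esub> f y"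
    and c: "\<And>x. x \<in> carrier A \<Longrightarrow> anorm B (f x) \<le> c * anorm A x" "c \<ge> 0"
  shows "joint_spectral_radius B (f ` M) \<le> joint_spectral_radius A M"
proof (rule dense_ge)
  interpret A: nalg A by (rule A)
  interpret B: nalg B by (rule B)
  have Mc: "M \<subseteq> carrier A" using M by (simp add: A.bounded_subsets_iff)
  fix r assume r: "joint_spectral_radius A M < r"
  then have r0: "0 < r" using A.jsr_nonneg[OF M] by simp
  obtain D where D: "\<And>n x. n \<ge> 1 \<Longrightarrow> x \<in> set_power A M n \<Longrightarrow> anorm A x \<le> D * r ^ n"
    using A.jsr_growth[OF M r] by metis
  show "joint_spectral_radius B (f ` M) \<le> r"
  proof (rule B.jsr_le_of_growth[OF fM r0, where D = "c * D"])
    fix n y assume n: "n \<ge> 1" and y: "y \<in> set_power B (f ` M) n"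
    then obtain x where x: "y = f x" "x \<in> set_power A M n" "x \<in> carrier A"
      using set_power_hom[OF A Mc, where f = f and B = B, OF hom] A.set_power_carrier[OF Mc, of n] by blast
    then show "anorm B y \<le> c * D * r ^ n"
      using c(1)[of x] mult_left_mono[OF D[OF n x(2)] c(2)] by simp
  qed
qed

text \<open>
  Used for the submultiplicativity of the quotient norm, an infimum that need not be attained.
\<close>

lemma le_mult_of_approx:
  fixes s t w :: real
  assumes "\<And>e. e > 0 \<Longrightarrow> w \<le> (s + e) * (t + e)"
  shows "w \<le> s * t"
proof (rule tendsto_lowerbound)
  show "((\<lambda>e. (s + e) * (t + e)) \<longlongrightarrow> s * t) (at_right 0)"
    by (auto intro!: tendsto_eq_intros)
  show "\<forall>\<^sub>F e in at_right 0. w \<le> (s + e) * (t + e)"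
    using assms by (auto simp: eventually_at_right_less intro: eventually_mono[OF eventually_at_right_less])
qed simp

locale nalg_quotient = nalg +
  fixes I assumes closed_ideal: "closed_ideal I A"
begin

lemma ideal: "alg_ideal I A"
  using closed_ideal by (simp add: closed_ideal_def)

lemmas idealD = alg_idealD[OF ideal]

abbreviation "Q \<equiv> quot_alg A I"
abbreviation "q \<equiv> quot_map A I"

lemma ideal_diff: "x \<in> I \<Longrightarrow> y \<in> I \<Longrightarrow> x \<ominus> y \<in> I"
  using idealD(1) idealD(3)[of x "(-1) \<odot> y"] idealD(4)[of y "-1"] minus_smult[of x y]
  by (simp add: subset_iff)

lemma mem_quot_map: "a \<in> carrier A \<Longrightarrow> x \<in> q a \<longleftrightarrow> x \<in> carrier A \<and> x \<ominus> a \<in> I"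
proof
  assume a: "a \<in> carrier A" and "x \<in> q a"
  then obtain i where "i \<in> I" "x = i \<oplus> a" by (auto simp: quot_map_def a_r_coset_def')
  then show "x \<in> carrier A \<and> x \<ominus> a \<in> I" using a idealD(1) by (auto simp: add_diff_cancel)
next
  assume a: "a \<in> carrier A" and "x \<in> carrier A \<and> x \<ominus> a \<in> I"
  then show "x \<in> q a"
    using diff_add_cancel[of x a] by (force simp: quot_map_def a_r_coset_def')
qed

lemma quot_map_eq_iff:
  assumes "a \<in> carrier A" "b \<in> carrier A"
  shows "q a = q b \<longleftrightarrow> a \<ominus> b \<in> I"
proof
  assume "q a = q b"
  then show "a \<ominus> b \<in> I" using mem_quot_map[of b a] mem_quot_map[of a a] assms idealD(2) by simp
next
  assume ab: "a \<ominus> b \<in> I"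
  have "x \<ominus> a \<in> I \<longleftrightarrow> x \<ominus> b \<in> I" if x: "x \<in> carrier A" for x
  proof -
    have "x \<ominus> b = (x \<ominus> a) \<oplus> (a \<ominus> b)" using x assms by (simp add: diff_diff_add)
    moreover have "x \<ominus> a = (x \<ominus> b) \<ominus> (a \<ominus> b)"
      using x assms by (simp add: diff_diff_swap)
    ultimately show ?thesis using ab idealD(3) ideal_diff by metis
  qed
  then show "q a = q b" using assms by (auto simp: mem_quot_map)
qed

lemma quot_carrier: "carrier Q = q ` carrier A"
  by (auto simp: quot_alg_def quot_map_def A_RCOSETS_def')

lemma quot_zero: "\<zero>\<^bsub>Q\<^esub> = q \<zero>"
  using mem_quot_map[of \<zero>] idealD(1) by (auto simp: quot_alg_def)

lemma quot_add: "a \<in> carrier A \<Longrightarrow> b \<in> carrier A \<Longrightarrow> q a \<oplus>\<^bsub>Q\<^esub> q b = q (a \<oplus> b)"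
proof -
  have "abelian_subgroup I A"
    using ideal by (intro abelian_subgroupI3) (auto simp: alg_ideal_def abelian_group_axioms)
  then show "a \<in> carrier A \<Longrightarrow> b \<in> carrier A \<Longrightarrow> q a \<oplus>\<^bsub>Q\<^esub> q b = q (a \<oplus> b)"
    by (simp add: quot_alg_def quot_map_def abelian_subgroup.a_rcos_sum)
qed

lemma quot_map_self: "a \<in> carrier A \<Longrightarrow> a \<in> q a"
  by (simp add: mem_quot_map idealD(2))

lemma quot_map_nonempty: "a \<in> carrier A \<Longrightarrow> q a \<noteq> {}"
  using quot_map_self by blast

lemma quot_map_mem_eq: "a \<in> carrier A \<Longrightarrow> x \<in> q a \<Longrightarrow> q x = q a"
  by (simp add: mem_quot_map quot_map_eq_iff)

lemma quot_mult:
  assumes "a \<in> carrier A" "b \<in> carrier A"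
  shows "q a \<otimes>\<^bsub>Q\<^esub> q b = q (a \<otimes> b)"
proof -
  have "q (x \<otimes> y) = q (a \<otimes> b)" if "x \<in> q a" "y \<in> q b" for x y
  proof -
    have xy: "x \<in> carrier A" "y \<in> carrier A" "x \<ominus> a \<in> I" "y \<ominus> b \<in> I"
      using that assms by (auto simp: mem_quot_map)
    have "x \<otimes> y \<ominus> a \<otimes> b = (x \<ominus> a) \<otimes> y \<oplus> a \<otimes> (y \<ominus> b)"
      using xy assms by (simp add: diff_mult mult_diff diff_diff_add)
    also have "\<dots> \<in> I" using xy assms by (intro idealD(3)[OF idealD(6) idealD(5)])
    finally show ?thesis using xy assms by (simp add: quot_map_eq_iff)
  qed
  then have "(\<Union>x\<in>q a. \<Union>y\<in>q b. q (x \<otimes> y)) = (\<Union>x\<in>q a. \<Union>y\<in>q b. q (a \<otimes> b))"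
    by (intro SUP_cong refl)
  also have "\<dots> = q (a \<otimes> b)"
    using quot_map_nonempty[OF assms(1)] quot_map_nonempty[OF assms(2)] by simp
  finally have "(\<Union>x\<in>q a. \<Union>y\<in>q b. q (x \<otimes> y)) = q (a \<otimes> b)" .
  then show ?thesis by (simp add: quot_alg_def rcoset_mult_def quot_map_def)
qed

lemma quot_smult:
  assumes "a \<in> carrier A"
  shows "c \<odot>\<^bsub>Q\<^esub> q a = q (c \<odot> a)"
proof -
  have "q (c \<odot> x) = q (c \<odot> a)" if "x \<in> q a" for x
    using that assms idealD(4) by (simp add: mem_quot_map quot_map_eq_iff flip: smult_diff)
  then have "(\<Union>x\<in>q a. q (c \<odot> x)) = (\<Union>x\<in>q a. q (c \<odot> a))"
    by (intro SUP_cong refl)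
  also have "\<dots> = q (c \<odot> a)" using quot_map_nonempty[OF assms] by simp
  finally have "(\<Union>x\<in>q a. q (c \<odot> x)) = q (c \<odot> a)" .
  then show ?thesis by (simp add: quot_alg_def quot_map_def)
qed

lemma quot_norm_eq: "anorm Q X = (INF x\<in>X. anorm A x)"
  by (simp add: quot_alg_def)

lemma quot_norm_bdd: "a \<in> carrier A \<Longrightarrow> bdd_below (anorm A ` q a)"
  by (rule bdd_belowI[of _ 0]) (auto simp: mem_quot_map)

lemma quot_norm_le: "a \<in> carrier A \<Longrightarrow> anorm Q (q a) \<le> anorm A a"
  unfolding quot_norm_eq by (rule cINF_lower[OF quot_norm_bdd quot_map_self])

lemma quot_norm_nonneg: "a \<in> carrier A \<Longrightarrow> 0 \<le> anorm Q (q a)"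
  unfolding quot_norm_eq by (rule cINF_greatest) (use quot_map_self in blast, simp add: mem_quot_map)

lemma quot_norm_less:
  assumes "a \<in> carrier A" "anorm Q (q a) < e"
  obtains x where "x \<in> carrier A" "q x = q a" "anorm A x < e"
proof -
  have "q a \<noteq> {}" using quot_map_self[OF assms(1)] by blast
  then obtain x where x: "x \<in> q a" "anorm A x < e"
    using assms(2) cINF_less_iff[OF _ quot_norm_bdd[OF assms(1)], of e] unfolding quot_norm_eq by metis
  have "x \<in> carrier A" "q x = q a"
    using x(1) assms(1) by (auto simp: mem_quot_map quot_map_mem_eq)
  then show ?thesis using that x(2) by metis
qed

lemma quot_norm_smult_le:
  assumes a: "a \<in> carrier A"
  shows "anorm Q (q (c \<odot> a)) \<le> cmod c * anorm Q (q a)"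
proof (rule field_le_epsilon)
  fix e :: real assume e: "e > 0"
  have c: "0 < cmod c + 1" by (simp add: add_nonneg_pos)
  obtain x where x: "x \<in> carrier A" "q x = q a" "anorm A x < anorm Q (q a) + e / (cmod c + 1)"
    using quot_norm_less[OF a, of "anorm Q (q a) + e / (cmod c + 1)"] e c by auto
  have "anorm Q (q (c \<odot> a)) = anorm Q (q (c \<odot> x))"
    using quot_smult[OF a, of c] quot_smult[OF x(1), of c] x(2) by simp
  also have "\<dots> \<le> cmod c * anorm A x" using quot_norm_le[of "c \<odot> x"] x(1) by (simp add: anorm_smult)
  also have "\<dots> \<le> cmod c * (anorm Q (q a) + e / (cmod c + 1))"
    using x(3) by (intro mult_left_mono) auto
  also have "\<dots> \<le> cmod c * anorm Q (q a) + e"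
    using e c by (simp add: algebra_simps divide_le_eq)
  finally show "anorm Q (q (c \<odot> a)) \<le> cmod c * anorm Q (q a) + e" .
qed

lemma nalg_quot: "nalg Q"
proof -
  have c: "\<exists>a\<in>carrier A. X = q a" if "X \<in> carrier Q" for X using that by (auto simp: quot_carrier)
  have abel: "abelian_group Q"
  proof (rule abelian_groupI)
    show "\<exists>Y\<in>carrier Q. Y \<oplus>\<^bsub>Q\<^esub> X = \<zero>\<^bsub>Q\<^esub>" if X: "X \<in> carrier Q" for X
    proof -
      obtain a where "a \<in> carrier A" "X = q a" using c[OF X] by blast
      then show ?thesis
        by (intro bexI[of _ "q (\<ominus> a)"]) (auto simp: quot_add quot_zero l_neg quot_carrier)
    qed
  qed (auto simp: quot_carrier quot_add quot_zero a_ac intro!: imageI)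
  have ax: "normed_algebra_axioms Q"
  proof (unfold_locales, goal_cases)
    case (12 X)
    then show ?case using quot_norm_nonneg by (auto simp: quot_carrier)
  next
    case (13 X)
    then obtain a where a: "a \<in> carrier A" "X = q a" using c by blast
    show ?case
    proof
      assume *: "anorm Q X = 0"
      have "\<exists>y\<in>I. anorm A (a \<ominus> y) < e" if e: "e > 0" for e
      proof -
        obtain x where x: "x \<in> carrier A" "q x = q a" "anorm A x < e"
          using quot_norm_less[OF a(1), of e] * a e by auto
        have "a \<ominus> x \<in> I" using x a by (simp flip: quot_map_eq_iff)
        moreover have "a \<ominus> (a \<ominus> x) = x" using x a by (simp add: diff_diff_cancel)
        ultimately show ?thesis using x by (intro bexI[of _ "a \<ominus> x"]) auto
      qed
      then have "a \<in> I" using closed_ideal a(1) unfolding closed_ideal_def closedin_iff by blast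
      then show "X = \<zero>\<^bsub>Q\<^esub>" using a by (simp add: quot_zero quot_map_eq_iff)
    next
      assume "X = \<zero>\<^bsub>Q\<^esub>"
      then show "anorm Q X = 0"
        using quot_norm_le[of \<zero>] quot_norm_nonneg[of \<zero>] by (simp add: quot_zero)
    qed
  next
    case (14 X Y)
    then obtain a b where ab: "a \<in> carrier A" "X = q a" "b \<in> carrier A" "Y = q b" using c by metis
    show ?case
    proof (rule field_le_epsilon)
      fix e :: real assume e: "e > 0"
      obtain x where x: "x \<in> carrier A" "q x = q a" "anorm A x < anorm Q (q a) + e / 2"
        using quot_norm_less[OF ab(1), of "anorm Q (q a) + e / 2"] e by auto
      obtain y where y: "y \<in> carrier A" "q y = q b" "anorm A y < anorm Q (q b) + e / 2"
        using quot_norm_less[OF ab(3), of "anorm Q (q b) + e / 2"] e by auto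
      have "anorm Q (X \<oplus>\<^bsub>Q\<^esub> Y) = anorm Q (q (x \<oplus> y))"
        using ab x y by (metis quot_add)
      also have "\<dots> \<le> anorm A x + anorm A y"
        using quot_norm_le[of "x \<oplus> y"] anorm_triangle[of x y] x y by simp
      finally show "anorm Q (X \<oplus>\<^bsub>Q\<^esub> Y) \<le> anorm Q X + anorm Q Y + e" using x y ab by simp
    qed
  next
    case (15 X d)
    then obtain a where a: "a \<in> carrier A" "X = q a" using c by blast
    show ?case
    proof (cases "d = 0")
      case True
      then show ?thesis
        using a quot_norm_smult_le[OF a(1), of 0] quot_norm_nonneg[of \<zero>] by (simp add: quot_smult)
    next
      case False
      have "anorm Q (q a) = anorm Q (q (inverse d \<odot> (d \<odot> a)))"
        using False a by (simp add: smult_smult smult_1)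
      also have "\<dots> \<le> cmod (inverse d) * anorm Q (q (d \<odot> a))"
        using quot_norm_smult_le[of "d \<odot> a" "inverse d"] a by simp
      finally have "cmod d * anorm Q (q a) \<le> anorm Q (q (d \<odot> a))"
        using False by (simp add: norm_inverse norm_divide field_simps)
      then show ?thesis using a quot_norm_smult_le[OF a(1), of d] by (simp add: quot_smult)
    qed
  next
    case (16 X Y)
    then obtain a b where ab: "a \<in> carrier A" "X = q a" "b \<in> carrier A" "Y = q b" using c by metis
    show ?case
    proof (rule le_mult_of_approx)
      fix e :: real assume e: "e > 0"
      obtain x where x: "x \<in> carrier A" "q x = q a" "anorm A x < anorm Q (q a) + e"
        using quot_norm_less[OF ab(1), of "anorm Q (q a) + e"] e by auto
      obtain y where y: "y \<in> carrier A" "q y = q b" "anorm A y < anorm Q (q b) + e"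
        using quot_norm_less[OF ab(3), of "anorm Q (q b) + e"] e by auto
      have "anorm Q (X \<otimes>\<^bsub>Q\<^esub> Y) = anorm Q (q (x \<otimes> y))"
        using ab x y by (metis quot_mult)
      also have "\<dots> \<le> anorm A x * anorm A y"
        using quot_norm_le[of "x \<otimes> y"] anorm_mult[of x y] x y by simp
      also have "\<dots> \<le> (anorm Q X + e) * (anorm Q Y + e)"
        using x y ab e quot_norm_nonneg[OF ab(1)] by (intro mult_mono) auto
      finally show "anorm Q (X \<otimes>\<^bsub>Q\<^esub> Y) \<le> (anorm Q X + e) * (anorm Q Y + e)" .
    qed
  qed (auto simp: quot_carrier quot_add quot_mult quot_smult mult_assoc mult_add_left mult_add_right
      smult_add_scalar smult_add_vector smult_smult smult_1 smult_mult_left smult_mult_right intro!: imageI)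
  show ?thesis unfolding nalg_def normed_algebra_def using abel ax by blast
qed

sublocale Q: nalg "quot_alg A I"
  by (rule nalg_quot)

lemma quot_map_closed: "a \<in> carrier A \<Longrightarrow> q a \<in> carrier Q"
  by (simp add: quot_carrier)

lemma quot_diff: "a \<in> carrier A \<Longrightarrow> b \<in> carrier A \<Longrightarrow> q a \<ominus>\<^bsub>Q\<^esub> q b = q (a \<ominus> b)"
  by (simp add: Q.minus_smult minus_smult quot_map_closed quot_smult quot_add)

lemma small_quot_map: "M \<in> small_sets k A \<Longrightarrow> q ` M \<in> small_sets k Q"
proof (rule small_image[OF nalg_axioms nalg_quot, where c = 1])
  assume M: "M \<in> small_sets k A"
  show "anorm Q (q x \<ominus>\<^bsub>Q\<^esub> q x') \<le> 1 * anorm A (x \<ominus> x')" if "x \<in> M" "x' \<in> M" for x x'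
    using that small_carrier[OF M] quot_norm_le[of "x \<ominus> x'"] by (auto simp: quot_diff subset_iff)
qed (use small_carrier quot_map_closed in auto)

lemma bounded_quot_map: "M \<in> bounded_subsets A \<Longrightarrow> q ` M \<in> bounded_subsets Q"
  using small_quot_map[of M Bounded] by simp

lemma jsr_quot_map_le:
  "M \<in> bounded_subsets A \<Longrightarrow> joint_spectral_radius Q (q ` M) \<le> joint_spectral_radius A M"
  by (rule jsr_image_le[OF nalg_axioms nalg_quot, where c = 1])
     (auto simp: bounded_quot_map quot_mult quot_norm_le)

text \<open>
  A precompact set of \<open>A/I\<close> is lifted only up to density, because a full lift would have to control
  uncountably many points at once.  Finite nets \<open>F k\<close> of \<open>M\<close> are lifted successively: a point of
  \<open>F (k + 1)\<close> is close to a point of \<open>F k\<close>, and the difference of the two lifts is chosen of norm less than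
  \<open>d / 2\<^sup>k\<^sup>+\<^sup>1\<close>.  All later lifts then stay within \<open>d / 2\<^sup>k\<close> of the \<open>k\<close>-th one, which makes the union of the
  lifts precompact although neither \<open>A\<close> nor \<open>I\<close> is complete.
\<close>

lemma small_lift:
  assumes M: "M \<in> small_sets k Q" and d: "\<And>X. X \<in> M \<Longrightarrow> anorm Q X < d"
  obtains N where "N \<in> small_sets k A" "\<And>x. x \<in> N \<Longrightarrow> anorm A x < 2 * d" "q ` N \<subseteq> M"
    "\<And>X e. X \<in> M \<Longrightarrow> e > 0 \<Longrightarrow> \<exists>x\<in>N. anorm Q (X \<ominus>\<^bsub>Q\<^esub> q x) < e"
proof -
  have Mc: "X \<in> carrier Q" if "X \<in> M" for X using that Q.small_carrier[OF M] by blast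
  obtain X0 where "X0 \<in> M" using Q.small_nonempty[OF M] by blast
  then have d0: "d > 0" using d[of X0] Q.anorm_nonneg[OF Mc, of X0] by linarith
  have lift: "\<exists>x. x \<in> carrier A \<and> q x = X \<and> anorm A x < e" if X: "X \<in> carrier Q" "anorm Q X < e" for X e
  proof -
    obtain a where a: "a \<in> carrier A" "X = q a" using X(1) by (auto simp: quot_carrier)
    obtain x where "x \<in> carrier A" "q x = q a" "anorm A x < e"
      using quot_norm_less[of a e] a X(2) by blast
    then show ?thesis using a(2) by blast
  qed
  define g where "g X = (SOME x. x \<in> carrier A \<and> q x = X \<and> anorm A x < d)" for X
  have g: "g X \<in> carrier A \<and> q (g X) = X \<and> anorm A (g X) < d" if "X \<in> M" for X
    unfolding g_def using lift[OF Mc[OF that] d[OF that]] by (rule someI_ex)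
  show ?thesis
  proof (cases "k = Precompact")
    case False
    have "g ` M \<in> small_sets k A"
    proof (cases k)
      case Finite
      then show ?thesis using M g by (auto simp: finite_subsets_def)
    next
      case Bounded
      have "\<forall>x\<in>g ` M. anorm A x \<le> d" using g by (auto intro: less_imp_le)
      moreover have "g ` M \<subseteq> carrier A" "g ` M \<noteq> {}" using g Q.small_nonempty[OF M] by auto
      ultimately show ?thesis using Bounded d0 by (auto simp: bounded_subsets_iff)
    qed (use False in simp)
    moreover have "anorm A x < 2 * d" if "x \<in> g ` M" for x using that g d0 by fastforce
    moreover have "q ` g ` M \<subseteq> M" using g by auto
    moreover have "\<exists>x\<in>g ` M. anorm Q (X \<ominus>\<^bsub>Q\<^esub> q x) < e" if "X \<in> M" "e > 0" for X e
      using that g[OF that(1)] Mc by (intro bexI[of _ "g X"]) auto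
    ultimately show ?thesis by (rule that)
  next
    case True
    have dk: "0 < d / 2 ^ k" for k using d0 by simp
    have "\<forall>k. \<exists>F. finite F \<and> F \<subseteq> M \<and> (\<forall>X\<in>M. \<exists>Y\<in>F. anorm Q (X \<ominus>\<^bsub>Q\<^esub> Y) < d / 2 ^ Suc k)"
    proof
      fix k
      obtain F where "finite F" "F \<subseteq> M" "\<And>X. X \<in> M \<Longrightarrow> \<exists>Y\<in>F. anorm Q (X \<ominus>\<^bsub>Q\<^esub> Y) < d / 2 ^ Suc k"
        using Q.small_net[OF M _ dk[of "Suc k"]] True by auto
      then show "\<exists>F. finite F \<and> F \<subseteq> M \<and> (\<forall>X\<in>M. \<exists>Y\<in>F. anorm Q (X \<ominus>\<^bsub>Q\<^esub> Y) < d / 2 ^ Suc k)"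
        by blast
    qed
    then obtain F where F: "\<And>k. finite (F k)" "\<And>k. F k \<subseteq> M"
      "\<And>k X. X \<in> M \<Longrightarrow> \<exists>Y\<in>F k. anorm Q (X \<ominus>\<^bsub>Q\<^esub> Y) < d / 2 ^ Suc k" by metis
    \<comment> \<open>The bound \<open>d (2 - 1 / 2\<^sup>k)\<close> leaves room for the steps still to come, which add up to \<open>d / 2\<^sup>k\<close>.\<close>
    let ?P = "\<lambda>k S. finite S \<and> S \<subseteq> carrier A \<and> q ` S = F k \<and> (\<forall>x\<in>S. anorm A x < d * (2 - 1 / 2 ^ k))"
    let ?R = "\<lambda>k S S'. \<forall>x\<in>S'. \<exists>y\<in>S. anorm A (x \<ominus> y) < d / 2 ^ Suc k"
    have "\<exists>S. \<forall>k. ?P k (S k) \<and> ?R k (S k) (S (Suc k))"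
    proof (rule dependent_nat_choice)
      have "q ` g ` F 0 = F 0" using F(2)[of 0] g by (force simp: image_image)
      moreover have "g ` F 0 \<subseteq> carrier A" "\<forall>x\<in>g ` F 0. anorm A x < d" using F(2)[of 0] g by auto
      ultimately show "\<exists>S. ?P 0 S" using F(1)[of 0] by (intro exI[of _ "g ` F 0"]) auto
    next
      fix S k assume S: "?P k S"
      have "\<exists>x. x \<in> carrier A \<and> q x = Y \<and> anorm A x < d * (2 - 1 / 2 ^ Suc k) \<and>
          (\<exists>y\<in>S. anorm A (x \<ominus> y) < d / 2 ^ Suc k)" if Y: "Y \<in> F (Suc k)" for Y
      proof -
        have YM: "Y \<in> M" using Y F(2) by blast
        obtain Z where Z: "Z \<in> F k" "anorm Q (Y \<ominus>\<^bsub>Q\<^esub> Z) < d / 2 ^ Suc k" using F(3)[OF YM] by blast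
        obtain z where z: "z \<in> S" "Z = q z" using S Z(1) by blast
        have zc: "z \<in> carrier A" using z(1) S by blast
        have Zc: "Z \<in> carrier Q" using z zc by (simp add: quot_map_closed)
        obtain l where l: "l \<in> carrier A" "q l = Y \<ominus>\<^bsub>Q\<^esub> Z" "anorm A l < d / 2 ^ Suc k"
          using lift[OF _ Z(2)] Mc[OF YM] Zc by auto
        have "q (l \<oplus> z) = Y" using l zc z Mc[OF YM] Zc by (simp add: Q.diff_add_cancel flip: quot_add)
        moreover have "anorm A ((l \<oplus> z) \<ominus> z) < d / 2 ^ Suc k" using l zc by (simp add: add_diff_cancel)
        moreover have "anorm A (l \<oplus> z) < d * (2 - 1 / 2 ^ Suc k)"
        proof -
          have "anorm A (l \<oplus> z) < d / 2 ^ Suc k + d * (2 - 1 / 2 ^ k)"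
            using anorm_triangle[OF l(1) zc] l(3) S z(1) by fastforce
          also have "\<dots> = d * (2 - 1 / 2 ^ Suc k)" by (simp add: field_simps)
          finally show ?thesis .
        qed
        ultimately show ?thesis using l zc z by blast
      qed
      then obtain h where h: "\<And>Y. Y \<in> F (Suc k) \<Longrightarrow> h Y \<in> carrier A \<and> q (h Y) = Y \<and>
          anorm A (h Y) < d * (2 - 1 / 2 ^ Suc k) \<and> (\<exists>y\<in>S. anorm A (h Y \<ominus> y) < d / 2 ^ Suc k)"
        by metis
      have "q ` h ` F (Suc k) = F (Suc k)" using h by (force simp: image_image)
      then show "\<exists>S'. ?P (Suc k) S' \<and> ?R k S S'"
        using h F(1)[of "Suc k"] by (intro exI[of _ "h ` F (Suc k)"]) auto
    qed
    then obtain S where S: "\<And>k. finite (S k)" "\<And>k. S k \<subseteq> carrier A" "\<And>k. q ` S k = F k"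
      "\<And>k x. x \<in> S k \<Longrightarrow> anorm A x < d * (2 - 1 / 2 ^ k)"
      "\<And>k x. x \<in> S (Suc k) \<Longrightarrow> \<exists>y\<in>S k. anorm A (x \<ominus> y) < d / 2 ^ Suc k" by metis
    have tail: "\<exists>y\<in>S k. anorm A (x \<ominus> y) \<le> d / 2 ^ k * (1 - 1 / 2 ^ j)" if "x \<in> S (k + j)" for x k j
      using that
    proof (induction j arbitrary: x)
      case 0
      then have "x \<in> S k" "x \<in> carrier A" using S(2)[of k] by auto
      then show ?case by (intro bexI[of _ x]) auto
    next
      case (Suc j)
      then obtain z where z: "z \<in> S (k + j)" "anorm A (x \<ominus> z) < d / 2 ^ Suc (k + j)"
        using S(5)[of x "k + j"] by auto
      obtain y where y: "y \<in> S k" "anorm A (z \<ominus> y) \<le> d / 2 ^ k * (1 - 1 / 2 ^ j)"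
        using Suc.IH[OF z(1)] by blast
      have "anorm A (x \<ominus> y) \<le> anorm A (x \<ominus> z) + anorm A (z \<ominus> y)"
        using Suc.prems z(1) y(1) S(2) by (intro anorm_diff_triangle) blast+
      also have "\<dots> \<le> d / 2 ^ Suc (k + j) + d / 2 ^ k * (1 - 1 / 2 ^ j)" using z y by simp
      also have "\<dots> = d / 2 ^ k * (1 - 1 / 2 ^ Suc j)" by (simp add: field_simps power_add)
      finally show ?case using y(1) by blast
    qed
    have small: "\<exists>k. d / 2 ^ k < e" if "e > 0" for e
    proof -
      obtain k where "(1 / 2) ^ k < e / d" using real_arch_pow_inv[of "e / d" "1 / 2"] \<open>e > 0\<close> d0 by auto
      then show ?thesis using d0 by (intro exI[of _ k]) (simp add: field_simps power_divide)
    qed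
    define N where "N = (\<Union>k. S k)"
    have Nc: "N \<subseteq> carrier A" using S(2) by (auto simp: N_def)
    have "F 0 \<noteq> {}" using F(3) Q.small_nonempty[OF M] by blast
    then have "S 0 \<noteq> {}" using S(3)[of 0] by auto
    then have ne: "N \<noteq> {}" by (auto simp: N_def)
    have "N \<in> precompact_subsets A"
    proof (rule precompactI[OF ne Nc])
      fix e :: real assume "e > 0"
      then obtain k where k: "d / 2 ^ k < e" using small by blast
      have "\<exists>y\<in>(\<Union>i\<in>{..k}. S i). anorm A (x \<ominus> y) < e" if "x \<in> N" for x
      proof -
        obtain m where m: "x \<in> S m" using \<open>x \<in> N\<close> by (auto simp: N_def)
        show ?thesis
        proof (cases "m \<le> k")
          case True
          have "x \<in> carrier A" using m S(2) by blast
          then show ?thesis using True m \<open>e > 0\<close> by (intro bexI[of _ x]) auto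
        next
          case False
          then obtain y where y: "y \<in> S k" "anorm A (x \<ominus> y) \<le> d / 2 ^ k * (1 - 1 / 2 ^ (m - k))"
            using tail[of x k "m - k"] m by auto
          have "d / 2 ^ k * (1 - 1 / 2 ^ (m - k)) \<le> d / 2 ^ k"
            using dk[of k] by (intro mult_left_le) auto
          then show ?thesis using y k by (intro bexI[of _ y]) auto
        qed
      qed
      moreover have "finite (\<Union>i\<in>{..k}. S i)" "(\<Union>i\<in>{..k}. S i) \<subseteq> carrier A" using S by auto
      ultimately show "\<exists>F. finite F \<and> F \<subseteq> carrier A \<and> (\<forall>x\<in>N. \<exists>y\<in>F. anorm A (x \<ominus> y) < e)"
        by (intro exI[of _ "\<Union>i\<in>{..k}. S i"]) auto
    qed
    then have "N \<in> small_sets k A" using True by simp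
    moreover have "anorm A x < 2 * d" if x: "x \<in> N" for x
    proof -
      obtain m where "x \<in> S m" using x by (auto simp: N_def)
      then have "anorm A x < d * (2 - 1 / 2 ^ m)" by (rule S(4))
      also have "\<dots> \<le> d * 2" using d0 by (intro mult_left_mono) auto
      finally show ?thesis by simp
    qed
    moreover have "q ` N \<subseteq> M" unfolding N_def image_UN S(3) using F(2) by blast
    moreover have "\<exists>x\<in>N. anorm Q (X \<ominus>\<^bsub>Q\<^esub> q x) < e" if X: "X \<in> M" and e: "e > 0" for X e
    proof -
      obtain k where k: "d / 2 ^ k < e" using small[OF e] by blast
      obtain Y where Y: "Y \<in> F k" "anorm Q (X \<ominus>\<^bsub>Q\<^esub> Y) < d / 2 ^ Suc k" using F(3)[OF X] by blast
      have "d / 2 ^ Suc k \<le> d / 2 ^ k" using d0 by (intro divide_left_mono) auto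
      then have "anorm Q (X \<ominus>\<^bsub>Q\<^esub> Y) < e" using Y k by linarith
      moreover obtain x where "x \<in> S k" "Y = q x" using Y(1) S(3)[of k] by blast
      ultimately show ?thesis by (auto simp: N_def)
    qed
    ultimately show ?thesis by (rule that)
  qed
qed

text \<open>
  Let \<open>b = c a\<close>, and let \<open>T'\<close> and \<open>P'\<close> lift \<open>M\<^sup>n\<close>, of small norm, and the union of the lower powers.
  Rebalancing gives a set \<open>{b / s} \<union> s P' \<union> T'\<close> with \<open>\<rho> < 1\<close> in \<open>A\<close>, hence in \<open>A/I\<close>.  There \<open>b\<close>, the elements of
  \<open>M\<^sup>n\<close> and the products \<open>x b\<close> with \<open>x\<close> in a lower power contract a common norm, by closure under limits, and
  the criterion for powers applies.
\<close>

lemma quot_map_radical: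
  assumes a: "a \<in> small_radical k A"
  shows "q a \<in> small_radical k Q"
proof (rule Q.radicalI)
  have ac: "a \<in> carrier A" by (rule radical_carrier[OF a])
  then show "q a \<in> carrier Q" by (rule quot_map_closed)
  fix c M assume M: "M \<in> small_sets k Q" and less: "joint_spectral_radius Q M < 1"
  have Mb: "M \<in> bounded_subsets Q" by (rule Q.small_bounded[OF M])
  define b where "b = c \<odot> a"
  have b: "b \<in> small_radical k A" unfolding b_def by (rule radical_smult[OF a])
  have bc: "b \<in> carrier A" by (rule radical_carrier[OF b])
  obtain n0 where n0: "\<And>n X. n \<ge> n0 \<Longrightarrow> n \<ge> 1 \<Longrightarrow> X \<in> set_power Q M n \<Longrightarrow> anorm Q X < 1 / 4"
    using Q.jsr_small_power[OF Mb less, of "1 / 4"] by auto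
  \<comment> \<open>From 2 on, the lower powers form a nonempty test set.\<close>
  define n where "n = max n0 2"
  have n: "n \<ge> 1" "1 < n" "n \<ge> n0" by (auto simp: n_def)
  define T where "T = set_power Q M n"
  define P where "P = (\<Union>j\<in>{1..<n}. set_power Q M j)"
  have T: "T \<in> small_sets k Q" unfolding T_def by (rule Q.small_set_power[OF M n(1)])
  have P: "P \<in> small_sets k Q" unfolding P_def by (rule Q.small_UN_powers[OF M n(2)])
  have T_less: "anorm Q X < 1 / 4" if "X \<in> T" for X using that n0 n unfolding T_def by blast
  obtain T' where T': "T' \<in> small_sets k A" "\<And>x. x \<in> T' \<Longrightarrow> anorm A x < 2 * (1 / 4)"
    "\<And>X e. X \<in> T \<Longrightarrow> e > 0 \<Longrightarrow> \<exists>x\<in>T'. anorm Q (X \<ominus>\<^bsub>Q\<^esub> q x) < e"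
    using small_lift[OF T T_less] by metis
  obtain K where K: "K > 0" "\<And>X. X \<in> P \<Longrightarrow> anorm Q X \<le> K"
    using Q.small_bounded[OF P] unfolding Q.bounded_subsets_iff by blast
  have P_less: "anorm Q X < K + 1" if "X \<in> P" for X using K(2)[OF that] by simp
  obtain P' where P': "P' \<in> small_sets k A" "\<And>x. x \<in> P' \<Longrightarrow> anorm A x < 2 * (K + 1)"
    "\<And>X e. X \<in> P \<Longrightarrow> e > 0 \<Longrightarrow> \<exists>x\<in>P'. anorm Q (X \<ominus>\<^bsub>Q\<^esub> q x) < e"
    using small_lift[OF P P_less] by metis
  have T'c: "x \<in> carrier A" if "x \<in> T'" for x using that small_carrier[OF T'(1)] by blast
  have P'c: "x \<in> carrier A" if "x \<in> P'" for x using that small_carrier[OF P'(1)] by blast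
  \<comment> \<open>The lift \<open>P'\<close> has norm below \<open>2 (K + 1)\<close>, so \<open>s P'\<close> has norm at most 1/2; also \<open>\<bar>s\<bar> \<le> 1\<close>, so that \<open>b\<close> itself contracts.\<close>
  define s where "s = complex_of_real (1 / (4 * (K + 1)))"
  have s: "s \<noteq> 0" "cmod s = 1 / (4 * (K + 1))" "cmod s \<le> 1"
    using K(1) by (auto simp: s_def norm_divide simp del: of_real_divide of_real_add of_real_mult)
  let ?V = "(\<lambda>x. s \<odot> x) ` P' \<union> T'"
  have V: "?V \<in> small_sets k A" by (rule small_Un[OF small_smult[OF P'(1)] T'(1)])
  have "anorm A (s \<odot> x) \<le> 1 / 2" if x: "x \<in> P'" for x
  proof -
    have "anorm A (s \<odot> x) = 1 / (4 * (K + 1)) * anorm A x"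
      using P'c[OF x] by (simp only: anorm_smult s(2))
    also have "\<dots> \<le> 1 / (4 * (K + 1)) * (2 * (K + 1))"
      using K(1) P'(2)[OF x] by (intro mult_left_mono) auto
    also have "\<dots> = 1 / 2" using K(1) by (simp add: field_simps)
    finally show ?thesis .
  qed
  then have "anorm A x \<le> 1 / 2" if "x \<in> ?V" for x using that T'(2) by force
  then have V_less: "joint_spectral_radius A ?V < 1"
    by (intro jsr_less_one_of_norm[OF small_bounded[OF V], of "1 / 2"]) auto
  let ?W = "insert (inverse s \<odot> b) ?V"
  have Wb: "?W \<in> bounded_subsets A" using bounded_insert[OF small_bounded[OF V]] bc by simp
  have "joint_spectral_radius Q (q ` ?W) < 1"
    using jsr_quot_map_le[OF Wb] radical_jsr[OF b V, of "inverse s"] V_less by simp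
  then obtain N where N: "Q.equivalent_norm N" "\<And>X. X \<in> q ` ?W \<Longrightarrow> Q.contraction N 1 X"
    using Q.contracting_norm_exists[OF bounded_quot_map[OF Wb]] by blast
  have unscale: "r \<odot>\<^bsub>Q\<^esub> q (inverse r \<odot> x) = q x" if "x \<in> carrier A" "r \<noteq> 0" for x r
    using that by (simp add: quot_smult smult_smult smult_1)
  have qb: "Q.contraction N (cmod s) (q b)"
    using Q.contraction_smult[OF N(1) N(2)[of "q (inverse s \<odot> b)"], of s] unscale[OF bc s(1)] by simp
  have qP: "Q.contraction N (cmod (inverse s)) X" if X: "X \<in> P" for X
  proof (rule Q.contraction_closure[OF N(1)])
    show "X \<in> carrier Q" using X Q.small_carrier[OF P] by blast
    fix e :: real assume "e > 0"
    then obtain x where x: "x \<in> P'" "anorm Q (X \<ominus>\<^bsub>Q\<^esub> q x) < e" using P'(3)[OF X] by blast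
    have "Q.contraction N (cmod (inverse s) * 1) (inverse s \<odot>\<^bsub>Q\<^esub> q (inverse (inverse s) \<odot> x))"
      using x(1) by (intro Q.contraction_smult[OF N(1) N(2)]) auto
    then have "Q.contraction N (cmod (inverse s)) (q x)"
      using unscale[OF P'c[OF x(1)], of "inverse s"] s(1) by simp
    then show "\<exists>Y. Q.contraction N (cmod (inverse s)) Y \<and> anorm Q (X \<ominus>\<^bsub>Q\<^esub> Y) \<le> e"
      using x(2) by (intro exI[of _ "q x"]) auto
  qed
  have qT: "Q.contraction N 1 X" if X: "X \<in> T" for X
  proof (rule Q.contraction_closure[OF N(1)])
    show "X \<in> carrier Q" using X Q.small_carrier[OF T] by blast
    fix e :: real assume "e > 0"
    then obtain x where x: "x \<in> T'" "anorm Q (X \<ominus>\<^bsub>Q\<^esub> q x) < e" using T'(3)[OF X] by blast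
    then show "\<exists>Y. Q.contraction N 1 Y \<and> anorm Q (X \<ominus>\<^bsub>Q\<^esub> Y) \<le> e"
      using N(2) by (intro exI[of _ "q x"]) auto
  qed
  have "joint_spectral_radius Q (insert (q b) M) \<le> 1"
  proof (rule Q.jsr_le_one_of_power[OF Mb _ N(1) n(1)])
    show "Q.contraction N 1 (q b)" by (rule Q.contraction_mono[OF N(1) qb s(3)])
    show "Q.contraction N 1 X" if "X \<in> set_power Q M n" for X using that qT by (simp add: T_def)
    show "Q.contraction N 1 (X \<otimes>\<^bsub>Q\<^esub> q b)" if "1 \<le> j" "j < n" "X \<in> set_power Q M j" for j X
    proof -
      have "X \<in> P" using that by (auto simp: P_def)
      from Q.contraction_mult[OF N(1) _ qP[OF this] qb] show ?thesis
        using s(1) by (simp add: norm_inverse)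
    qed
  qed
  then show "joint_spectral_radius Q (insert (c \<odot>\<^bsub>Q\<^esub> q a) M) \<le> 1"
    by (simp add: b_def quot_smult ac)
qed

end

context nalg
begin

text \<open>
  Let \<open>W = K\<^sup>n\<close> be a power whose image in the quotient has norm less than 1/12, and take a finite net of \<open>W\<close> with
  radius 1/12.  Each point of the net differs from some element of the radical by less than 1/12, so that every \<open>w \<in> W\<close> is
  \<open>u + g\<close> with \<open>\<parallel>u\<parallel> < 1/6\<close> and \<open>g\<close> from a finite subset \<open>G\<close> of the radical.  The doubles of the \<open>u\<close> have norm at
  most 1/3 and form a test set, since the \<open>u\<close> are differences of elements of \<open>W\<close> and \<open>G\<close>; adding the
  doubles of \<open>G\<close> preserves \<open>\<rho> < 1\<close>, and \<open>w\<close> is an average of such doubles.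
\<close>

lemma quotient_by_radical:
  assumes k: "k \<noteq> Bounded"
    and Xr: "X \<in> small_radical k (quot_alg A (small_radical k A))"
  shows "X = \<zero>\<^bsub>quot_alg A (small_radical k A)\<^esub>"
proof -
  define J where "J = small_radical k A"
  interpret nalg_quotient A J by unfold_locales (simp add: J_def radical_closed_ideal)
  have X: "X \<in> small_radical k Q" using Xr by (simp add: J_def)
  obtain a where a: "a \<in> carrier A" "X = q a" using Q.radical_carrier[OF X] by (auto simp: quot_carrier)
  have "a \<in> small_radical k A"
  proof (rule radicalI[OF a(1)])
    fix c M assume M: "M \<in> small_sets k A" and less: "joint_spectral_radius A M < 1"
    define K where "K = insert (c \<odot> a) M"
    have K: "K \<in> small_sets k A" unfolding K_def using a(1) by (intro small_insert[OF M]) auto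
    have Kb: "K \<in> bounded_subsets A" by (rule small_bounded[OF K])
    have "joint_spectral_radius Q (insert (c \<odot>\<^bsub>Q\<^esub> X) (q ` M)) < 1"
      using Q.radical_jsr[OF X small_quot_map[OF M], of c] jsr_quot_map_le[OF small_bounded[OF M]] less
      by simp
    then have qK: "joint_spectral_radius Q (q ` K) < 1" using a by (simp add: K_def quot_smult)
    obtain n0 where n0: "\<And>n Y. n \<ge> n0 \<Longrightarrow> n \<ge> 1 \<Longrightarrow> Y \<in> set_power Q (q ` K) n \<Longrightarrow> anorm Q Y < 1 / 12"
      using Q.jsr_small_power[OF bounded_quot_map[OF Kb] qK, of "1 / 12"] by auto
    define n where "n = max n0 1"
    have n: "n \<ge> n0" "n \<ge> 1" by (auto simp: n_def)
    define W where "W = set_power A K n"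
    have W: "W \<in> small_sets k A" unfolding W_def by (rule small_set_power[OF K n(2)])
    have Wc: "w \<in> carrier A" if "w \<in> W" for w using that small_carrier[OF W] by blast
    have "set_power Q (q ` K) n = q ` W"
      unfolding W_def by (rule set_power_hom[OF nalg_axioms small_carrier[OF K]]) (simp add: quot_mult)
    then have qW: "anorm Q (q w) < 1 / 12" if "w \<in> W" for w using that n0[OF n, of "q w"] by simp
    obtain F where F: "finite F" "F \<subseteq> W" "\<And>w. w \<in> W \<Longrightarrow> \<exists>f\<in>F. anorm A (w \<ominus> f) < 1 / 12"
      using small_net[OF W k, of "1 / 12"] by auto
    have "\<exists>j\<in>J. anorm A (f \<ominus> j) < 1 / 12" if f: "f \<in> F" for f
    proof -
      have fW: "f \<in> W" using f F(2) by blast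
      obtain x where x: "x \<in> carrier A" "q x = q f" "anorm A x < 1 / 12"
        using quot_norm_less[OF Wc[OF fW] qW[OF fW]] by blast
      have "f \<ominus> x \<in> J" using x Wc[OF fW] by (simp flip: quot_map_eq_iff)
      moreover have "f \<ominus> (f \<ominus> x) = x"
        using x(1) Wc[OF fW] diff_diff_cancel by simp
      ultimately show ?thesis using x(3) by (intro bexI[of _ "f \<ominus> x"]) auto
    qed
    then obtain j where j: "\<And>f. f \<in> F \<Longrightarrow> j f \<in> J" "\<And>f. f \<in> F \<Longrightarrow> anorm A (f \<ominus> j f) < 1 / 12" by metis
    define G where "G = j ` F"
    have G: "finite G" "G \<subseteq> small_radical k A" using F(1) j(1) by (auto simp: G_def J_def)
    have Gc: "g \<in> carrier A" if "g \<in> G" for g using that G(2) radical_carrier by blast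
    have near: "\<exists>g\<in>G. anorm A (w \<ominus> g) < 1 / 6" if w: "w \<in> W" for w
    proof -
      obtain f where f: "f \<in> F" "anorm A (w \<ominus> f) < 1 / 12" using F(3)[OF w] by blast
      have "f \<in> carrier A" "j f \<in> carrier A" using f(1) F(2) Wc Gc by (auto simp: G_def)
      then have "anorm A (w \<ominus> j f) < 1 / 6"
        using anorm_diff_triangle[OF Wc[OF w], of f "j f"] f(2) j(2)[OF f(1)] by simp
      then show ?thesis using f(1) by (auto simp: G_def)
    qed
    obtain w0 where w0: "w0 \<in> W" using small_nonempty[OF W] by blast
    then have "G \<noteq> {}" using near by blast
    then have G': "G \<in> small_sets k A" using G(1) Gc by (intro finite_small) auto
    define U where "U = {w \<ominus> g | w g. w \<in> W \<and> g \<in> G \<and> anorm A (w \<ominus> g) < 1 / 6}"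
    have U: "U \<in> small_sets k A"
    proof (rule small_subset[OF small_diff[OF W G']])
      show "U \<noteq> {}" using near[OF w0] w0 by (auto simp: U_def)
    qed (auto simp: U_def)
    let ?T = "(\<lambda>x. 2 \<odot> x) ` U"
    have T: "?T \<in> small_sets k A" by (rule small_smult[OF U])
    have "anorm A (2 \<odot> u) \<le> 1 / 3" if "u \<in> U" for u
    proof -
      have "u \<in> carrier A" "anorm A u < 1 / 6" using that Wc Gc by (auto simp: U_def)
      then show ?thesis by (simp add: anorm_smult)
    qed
    then have "joint_spectral_radius A ?T < 1"
      by (intro jsr_less_one_of_norm[OF small_bounded[OF T], of "1 / 3"]) auto
    then have "joint_spectral_radius A ((\<lambda>x. 2 \<odot> x) ` G \<union> ?T) < 1"
      and GT: "(\<lambda>x. 2 \<odot> x) ` G \<union> ?T \<in> small_sets k A"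
      using radical_finite[OF G T, of 2] by auto
    then obtain N where N: "equivalent_norm N"
      "\<And>x. x \<in> (\<lambda>x. 2 \<odot> x) ` G \<union> ?T \<Longrightarrow> contraction N 1 x"
      using contracting_norm_exists[OF small_bounded[OF GT]] by blast
    have top: "contraction N 1 w" if w: "w \<in> W" for w
    proof -
      obtain g where g: "g \<in> G" "anorm A (w \<ominus> g) < 1 / 6" using near[OF w] by blast
      then have "w \<ominus> g \<in> U" using w by (auto simp: U_def)
      then have "contraction N 1 ((w \<ominus> g) \<oplus> g)"
        using g(1) Gc Wc[OF w] N by (intro contraction_mean) auto
      then show ?thesis using g(1) Gc Wc[OF w] by (simp add: diff_add_cancel)
    qed
    have Kc: "x \<in> carrier A" if "x \<in> set_power A K i" for x i
      using that set_power_carrier[OF small_carrier[OF K], of i] by blast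
    \<comment> \<open>The criterion for powers speaks of \<open>M\<close> and one further element; 0 is a harmless choice.\<close>
    have "joint_spectral_radius A (insert \<zero> K) \<le> 1"
    proof (rule jsr_le_one_of_power[OF Kb _ N(1) n(2)])
      show "contraction N 1 \<zero>" using N(1) by (simp add: contraction_zero)
      show "contraction N 1 x" if "x \<in> set_power A K n" for x using that top by (simp add: W_def)
      show "contraction N 1 (x \<otimes> \<zero>)" if "x \<in> set_power A K i" for i x
        using Kc[OF that] N(1) by (simp add: contraction_zero)
    qed
    moreover have "joint_spectral_radius A K \<le> joint_spectral_radius A (insert \<zero> K)"
      using Kb by (intro jsr_mono) (auto simp: bounded_insert)
    ultimately show "joint_spectral_radius A (insert (c \<odot> a) M) \<le> 1" by (simp add: K_def)
  qed
  then have "a \<in> J" by (simp add: J_def)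
  then have "X = \<zero>\<^bsub>Q\<^esub>" using a by (simp add: quot_zero quot_map_eq_iff)
  then show ?thesis by (simp add: J_def)
qed

end

lemma rad4_radical: "rad4 (small_radical k) (small_radical k)"
  unfolding rad4_def
proof (intro allI impI, elim conjE)
  fix A :: "'a nalg" and I assume A: "normed_algebra A" and I: "closed_ideal I A"
  interpret nalg_quotient A I
    using A I by (simp add: nalg_quotient_def nalg_quotient_axioms_def nalg_def)
  show "quot_map A I ` small_radical k A \<subseteq> small_radical k (quot_alg A I)"
    using quot_map_radical by blast
qed

lemma rad2_radical:
  assumes k: "k \<noteq> Bounded"
  shows "rad2 (small_radical k) (small_radical k)"
  unfolding rad2_def
proof (intro allI impI)
  fix A :: "'a nalg" assume "normed_algebra A"
  then interpret nalg A by (simp add: nalg_def)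
  let ?J = "small_radical k A"
  interpret nalg_quotient A ?J by unfold_locales (rule radical_closed_ideal)
  show "small_radical k (quot_alg A ?J) = {\<zero>\<^bsub>quot_alg A ?J\<^esub>}"
    using quotient_by_radical[OF k] Q.radical_zero by blast
qed

section \<open>Invariance under topological isomorphisms\<close>

definition bounded_hom :: "'a nalg \<Rightarrow> 'b nalg \<Rightarrow> ('a \<Rightarrow> 'b) \<Rightarrow> bool" where
  "bounded_hom A B f \<longleftrightarrow>
     (\<forall>x\<in>carrier A. f x \<in> carrier B) \<and>
     (\<forall>x\<in>carrier A. \<forall>y\<in>carrier A. f (x \<oplus>\<^bsub>A\<^esub> y) = f x \<oplus>\<^bsub>B\<^esub> f y) \<and>
     (\<forall>x\<in>carrier A. \<forall>y\<in>carrier A. f (x \<otimes>\<^bsub>A\<^esub> y) = f x \<otimes>\<^bsub>B\<^esub> f y) \<and>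
     (\<forall>c. \<forall>x\<in>carrier A. f (c \<odot>\<^bsub>A\<^esub> x) = c \<odot>\<^bsub>B\<^esub> f x) \<and>
     (\<exists>c>0. \<forall>x\<in>carrier A. anorm B (f x) \<le> c * anorm A x)"

lemma bounded_hom_diff:
  assumes "nalg A" "nalg B" "bounded_hom A B f" "x \<in> carrier A" "y \<in> carrier A"
  shows "f (x \<ominus>\<^bsub>A\<^esub> y) = f x \<ominus>\<^bsub>B\<^esub> f y"
proof -
  interpret A: nalg A by (rule assms(1))
  interpret B: nalg B by (rule assms(2))
  show ?thesis using assms(3-5) by (simp add: bounded_hom_def A.minus_smult B.minus_smult)
qed

lemma small_bounded_hom:
  assumes A: "nalg A" and B: "nalg B" and f: "bounded_hom A B f" and M: "M \<in> small_sets k A"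
  shows "f ` M \<in> small_sets k B"
proof -
  interpret A: nalg A by (rule A)
  have Mc: "x \<in> carrier A" if "x \<in> M" for x using that A.small_carrier[OF M] by blast
  obtain c where c: "c > 0" "\<And>x. x \<in> carrier A \<Longrightarrow> anorm B (f x) \<le> c * anorm A x"
    using f unfolding bounded_hom_def by blast
  show ?thesis
    by (rule small_image[OF A B M _ c(1)])
      (use f Mc c(2) in \<open>auto simp: bounded_hom_def simp flip: bounded_hom_diff[OF A B f]\<close>)
qed

lemma jsr_bounded_hom_le:
  assumes A: "nalg A" and B: "nalg B" and f: "bounded_hom A B f" and M: "M \<in> bounded_subsets A"
  shows "joint_spectral_radius B (f ` M) \<le> joint_spectral_radius A M"
proof -
  obtain c where c: "c > 0" "\<And>x. x \<in> carrier A \<Longrightarrow> anorm B (f x) \<le> c * anorm A x"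
    using f unfolding bounded_hom_def by blast
  have "f ` M \<in> bounded_subsets B" using small_bounded_hom[OF A B f, of M Bounded] M by simp
  then show ?thesis
    using f c by (intro jsr_image_le[OF A B M, where c = c]) (auto simp: bounded_hom_def)
qed

text \<open>
  The preimage of the open unit ball contains a ball of some radius \<open>r\<close>; every \<open>x \<noteq> 0\<close> is scaled to norm
  \<open>r / 2\<close>.
\<close>

lemma continuous_linear_bounded:
  assumes A: "nalg A" and B: "nalg B" and f: "\<And>x. x \<in> carrier A \<Longrightarrow> f x \<in> carrier B"
    and smult: "\<And>c x. x \<in> carrier A \<Longrightarrow> f (c \<odot>\<^bsub>A\<^esub> x) = c \<odot>\<^bsub>B\<^esub> f x"
    and cont: "continuous_map (atopology A) (atopology B) f"
  shows "\<exists>c>0. \<forall>x\<in>carrier A. anorm B (f x) \<le> c * anorm A x"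
proof -
  interpret A: nalg A by (rule A)
  interpret B: nalg B by (rule B)
  have f0: "f \<zero>\<^bsub>A\<^esub> = \<zero>\<^bsub>B\<^esub>" using smult[of "\<zero>\<^bsub>A\<^esub>" 0] f by simp
  have "openin (atopology A) {x \<in> topspace (atopology A). f x \<in> B.Met.mball \<zero>\<^bsub>B\<^esub> 1}"
    by (rule openin_continuous_map_preimage[OF cont B.Met.openin_mball])
  then obtain r where r: "r > 0" "A.Met.mball \<zero>\<^bsub>A\<^esub> r \<subseteq> {x \<in> carrier A. f x \<in> B.Met.mball \<zero>\<^bsub>B\<^esub> 1}"
    using f0 unfolding A.Met.openin_mtopology by (auto simp: adist_def)
  have norm_A: "adist A \<zero>\<^bsub>A\<^esub> x = anorm A x" if "x \<in> carrier A" for x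
    using that A.anorm_diff_commute[of "\<zero>\<^bsub>A\<^esub>" x] by (simp add: adist_def)
  have norm_B: "adist B \<zero>\<^bsub>B\<^esub> x = anorm B x" if "x \<in> carrier B" for x
    using that B.anorm_diff_commute[of "\<zero>\<^bsub>B\<^esub>" x] by (simp add: adist_def)
  have "anorm B (f x) \<le> 2 / r * anorm A x" if x: "x \<in> carrier A" for x
  proof (cases "x = \<zero>\<^bsub>A\<^esub>")
    case True
    then show ?thesis using f0 by simp
  next
    case False
    then have pos: "anorm A x > 0" using x A.anorm_nonneg[OF x] A.anorm_eq_0[OF x] by linarith
    let ?t = "complex_of_real (r / (2 * anorm A x))"
    have t: "cmod ?t = r / (2 * anorm A x)" using r pos by (simp only: norm_of_real) simp
    have "anorm A (?t \<odot>\<^bsub>A\<^esub> x) = r / 2" using x pos t by (simp only: A.anorm_smult) simp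
    then have "?t \<odot>\<^bsub>A\<^esub> x \<in> A.Met.mball \<zero>\<^bsub>A\<^esub> r" using x r by (simp add: norm_A)
    then have "f (?t \<odot>\<^bsub>A\<^esub> x) \<in> B.Met.mball \<zero>\<^bsub>B\<^esub> 1" using r(2) by blast
    then have "anorm B (f (?t \<odot>\<^bsub>A\<^esub> x)) < 1" using f x by (simp add: norm_B)
    then have "cmod ?t * anorm B (f x) < 1" using x f by (simp only: smult B.anorm_smult)
    then show ?thesis unfolding t using pos r by (simp add: field_simps)
  qed
  moreover have "2 / r > 0" using r by simp
  ultimately show ?thesis by blast
qed

lemma topological_iso_bounded_hom:
  assumes A: "nalg A" and B: "nalg B" and iso: "topological_iso A B f"
  obtains g where "bounded_hom A B f" "bounded_hom B A g"
    "\<And>x. x \<in> carrier A \<Longrightarrow> g (f x) = x" "\<And>y. y \<in> carrier B \<Longrightarrow> f (g y) = y"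
proof -
  interpret A: nalg A by (rule A)
  interpret B: nalg B by (rule B)
  have fc: "f x \<in> carrier B" if "x \<in> carrier A" for x
    using iso that by (auto simp: topological_iso_def bij_betw_def)
  have hom: "\<And>x y. x \<in> carrier A \<Longrightarrow> y \<in> carrier A \<Longrightarrow> f (x \<oplus>\<^bsub>A\<^esub> y) = f x \<oplus>\<^bsub>B\<^esub> f y"
    "\<And>x y. x \<in> carrier A \<Longrightarrow> y \<in> carrier A \<Longrightarrow> f (x \<otimes>\<^bsub>A\<^esub> y) = f x \<otimes>\<^bsub>B\<^esub> f y"
    "\<And>c x. x \<in> carrier A \<Longrightarrow> f (c \<odot>\<^bsub>A\<^esub> x) = c \<odot>\<^bsub>B\<^esub> f x"
    using iso by (auto simp: topological_iso_def)
  obtain g where "homeomorphic_maps (atopology A) (atopology B) f g"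
    using iso by (auto simp: topological_iso_def homeomorphic_map_maps)
  then have cf: "continuous_map (atopology A) (atopology B) f"
    and cg: "continuous_map (atopology B) (atopology A) g"
    and gf: "\<And>x. x \<in> carrier A \<Longrightarrow> g (f x) = x" and fg: "\<And>y. y \<in> carrier B \<Longrightarrow> f (g y) = y"
    by (auto simp: homeomorphic_maps_def)
  have gc: "g y \<in> carrier A" if "y \<in> carrier B" for y
    using continuous_map_image_subset_topspace[OF cg] that by auto
  have ghom: "g (x \<oplus>\<^bsub>B\<^esub> y) = g x \<oplus>\<^bsub>A\<^esub> g y" "g (x \<otimes>\<^bsub>B\<^esub> y) = g x \<otimes>\<^bsub>A\<^esub> g y" "g (c \<odot>\<^bsub>B\<^esub> x) = c \<odot>\<^bsub>A\<^esub> g x"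
    if "x \<in> carrier B" "y \<in> carrier B" for x y c
    using gf[of "g x \<oplus>\<^bsub>A\<^esub> g y"] gf[of "g x \<otimes>\<^bsub>A\<^esub> g y"] gf[of "c \<odot>\<^bsub>A\<^esub> g x"] that
    by (simp_all add: hom gc fg)
  have "\<exists>c>0. \<forall>x\<in>carrier A. anorm B (f x) \<le> c * anorm A x"
    by (rule continuous_linear_bounded[OF A B fc hom(3) cf])
  then have "bounded_hom A B f"
    unfolding bounded_hom_def by (intro conjI ballI allI fc hom)
  moreover have "\<exists>d>0. \<forall>y\<in>carrier B. anorm A (g y) \<le> d * anorm B y"
    by (rule continuous_linear_bounded[OF B A gc ghom(3) cg])
  then have "bounded_hom B A g"
    unfolding bounded_hom_def by (intro conjI ballI allI gc ghom)
  ultimately show ?thesis using gf fg by (rule that)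
qed

text \<open>
  A test set \<open>M\<close> of \<open>B\<close> is pulled back along \<open>g\<close>, and \<open>\<rho>\<close> does not increase in either direction.
\<close>

lemma radical_bounded_iso:
  assumes A: "nalg A" and B: "nalg B" and f: "bounded_hom A B f" and g: "bounded_hom B A g"
    and gf: "\<And>x. x \<in> carrier A \<Longrightarrow> g (f x) = x" and fg: "\<And>y. y \<in> carrier B \<Longrightarrow> f (g y) = y"
  shows "f ` small_radical k A \<subseteq> small_radical k B"
proof clarify
  interpret A: nalg A by (rule A)
  interpret B: nalg B by (rule B)
  fix a assume a: "a \<in> small_radical k A"
  have fa: "f a \<in> carrier B" using f A.radical_carrier[OF a] by (simp add: bounded_hom_def)
  show "f a \<in> small_radical k B"
    unfolding B.radical_iff
  proof (intro conjI ballI fa antisym)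
    fix M assume M: "M \<in> small_sets k B"
    have Mb: "M \<in> bounded_subsets B" by (rule B.small_bounded[OF M])
    have gM: "g ` M \<in> small_sets k A" by (rule small_bounded_hom[OF B A g M])
    have "f ` insert a (g ` M) = insert (f a) M"
      using fg B.small_carrier[OF M] by (force simp: image_image)
    then have "joint_spectral_radius B (insert (f a) M) \<le> joint_spectral_radius A (insert a (g ` M))"
      using jsr_bounded_hom_le[OF A B f A.bounded_insert[OF A.small_bounded[OF gM] A.radical_carrier[OF a]]]
      by simp
    also have "\<dots> = joint_spectral_radius A (g ` M)" using a gM by (simp add: A.radical_iff)
    also have "\<dots> \<le> joint_spectral_radius B M" by (rule jsr_bounded_hom_le[OF B A g Mb])
    finally show "joint_spectral_radius B (insert (f a) M) \<le> joint_spectral_radius B M" .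
    show "joint_spectral_radius B M \<le> joint_spectral_radius B (insert (f a) M)"
      using Mb fa by (intro B.jsr_mono) (auto simp: B.bounded_insert)
  qed
qed

lemma rad3_radical: "rad3 (small_radical k) (small_radical k)"
  unfolding rad3_def
proof (intro allI impI, elim conjE)
  fix A :: "'a nalg" and B :: "'b nalg" and f
  assume "normed_algebra A" "normed_algebra B" and iso: "topological_iso A B f"
  then have A: "nalg A" and B: "nalg B" by (auto simp: nalg_def)
  obtain g where g: "bounded_hom A B f" "bounded_hom B A g"
    "\<And>x. x \<in> carrier A \<Longrightarrow> g (f x) = x" "\<And>y. y \<in> carrier B \<Longrightarrow> f (g y) = y"
    using topological_iso_bounded_hom[OF A B iso] by blast
  show "f ` small_radical k A = small_radical k B"
  proof
    show "f ` small_radical k A \<subseteq> small_radical k B"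
      by (rule radical_bounded_iso[OF A B g])
    show "small_radical k B \<subseteq> f ` small_radical k A"
    proof
      fix y assume y: "y \<in> small_radical k B"
      then have "g y \<in> small_radical k A" using radical_bounded_iso[OF B A g(2,1,4,3), of k] by blast
      moreover have "f (g y) = y" using g(4) nalg.radical_carrier[OF B y] by blast
      ultimately show "y \<in> f ` small_radical k A" by force
    qed
  qed
qed

lemma radicals_small: "Rf = small_radical Finite" "Rc = small_radical Precompact" "Rb = small_radical Bounded"
  by (simp_all add: Rf_def Rc_def Rb_def small_radical_def)

theorem theorem4p25:
  shows "(ideal_map (Rf :: 'a nalg \<Rightarrow> 'a set) \<and>
      rad1 (Rf :: 'a nalg \<Rightarrow> 'a set) \<and>
      rad2 (Rf :: 'a nalg \<Rightarrow> 'a set) (Rf :: 'a set nalg \<Rightarrow> 'a set set) \<and>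
      rad3 (Rf :: 'a nalg \<Rightarrow> 'a set) (Rf :: 'b nalg \<Rightarrow> 'b set) \<and>
      rad4 (Rf :: 'a nalg \<Rightarrow> 'a set) (Rf :: 'a set nalg \<Rightarrow> 'a set set)) \<and>
    hereditary_topological_radical (Rc :: 'a nalg \<Rightarrow> 'a set)
      (Rc :: 'b nalg \<Rightarrow> 'b set) (Rc :: 'a set nalg \<Rightarrow> 'a set set) \<and>
    hereditary_under_topological_radical (Rb :: 'a nalg \<Rightarrow> 'a set)
      (Rb :: 'b nalg \<Rightarrow> 'b set) (Rb :: 'a set nalg \<Rightarrow> 'a set set)"
  unfolding hereditary_topological_radical_def topological_radical_def
    hereditary_under_topological_radical_def under_topological_radical_def radicals_small
  by (intro conjI ideal_map_radical rad1_radical rad2_radical rad3_radical rad4_radical rad6_radical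
      rad5_of_rad6) simp_all

end
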